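(* Let $\lambda\in\mathbb C$ with $\lambda\notin\{0,1,2,\dots\}$, and put $\tilde{\boldsymbol y}\otimes\tilde{\boldsymbol x}=\sum_{i=1}^n\tilde y_i\otimes\tilde x_i$. The element $$\sum_{m=0}^\infty\frac{(-1)^mq^{(\lambda+1)m-m^2}}{[m]_q!\prod_{j=0}^{m-1}[\lambda-j]_q}(\tilde{\boldsymbol y}\otimes\tilde{\boldsymbol x})^m$$ is a lift of the inverse of the invariant form on $M^-_{-\lambda}\otimes M^+_\lambda$; that is, applying it to $v_\lambda\otimes v_{-\lambda}$ gives the canonical element (the sum of tensor products of dual bases) in the completed tensor product $M^+_\lambda\otimes M^-_{-\lambda}$ of the invariant pairing between $M^-_{-\lambda}$ and $M^+_\lambda$.
   Context: $q=e^\hbar$, $[k]_q=\frac{q^k-q^{-k}}{q-q^{-1}}$, $[m]_q!=\prod_{k=1}^m[k]_q$, $[x,y]_a=xy-a\,yx$, $\bar q=q^{-1}$. Let $\mathfrak g=\mathfrak{gl}(n+1)\supset\mathfrak l=\mathfrak{gl}(1)\oplus\mathfrak{gl}(n)$, simple roots $\alpha_i=\varepsilon_i-\varepsilon_{i+1}$, $i=1,\dots,n$, $(\varepsilon_i,\varepsilon_j)=\delta_{ij}$; the simple roots of $\mathfrak l$ are $\alpha_2,\dots,\alpha_n$. $U_\hbar(\mathfrak g)$ is the $\mathbb C[[\hbar]]$-Hopf algebra with Chevalley generators $e_i=e_{\alpha_i}$, $f_i=f_{\alpha_i}$ and Cartan elements $h_\alpha$: $[h_\alpha,e_\beta]=(\alpha,\beta)e_\beta$,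 $[h_\alpha,f_\beta]=-(\alpha,\beta)f_\beta$, $[e_\alpha,f_\beta]=\delta_{\alpha\beta}\frac{q^{h_\alpha}-q^{-h_\alpha}}{q-q^{-1}}$, the quantum Serre relations, $\Delta(e_\alpha)=e_\alpha\otimes1+q^{h_\alpha}\otimes e_\alpha$, $\Delta(f_\alpha)=f_\alpha\otimes q^{-h_\alpha}+1\otimes f_\alpha$, $\Delta(h_\alpha)=h_\alpha\otimes1+1\otimes h_\alpha$, antipode $\gamma(e_\alpha)=-q^{-h_\alpha}e_\alpha$, $\gamma(f_\alpha)=-f_\alpha q^{h_\alpha}$, $\gamma(h_\alpha)=-h_\alpha$. Put $\beta_i=\alpha_1+\dots+\alpha_i$ and $\tilde x_i=q^{2(i-1)}[e_1,[e_2,\dots[e_{i-1},e_i]_{\bar q}\dots]_{\bar q}]_{\bar q}$, $y_i=[f_i,[f_{i-1},\dots[f_2,f_1]_{\bar q}\dots]_{\bar q}]_{\bar q}$ (so $\tilde x_1=e_1$, $y_1=f_1$). $U_\hbar(\mathfrak n^+)$ and $U_\hbar(\mathfrak n^-)$ are the subalgebras generated by the $\tilde x_i$'s (up to Cartan-free equivalence, by the positive root vectors of weights $\beta_i$) and by the $y_i$'s respectively; $U_\hbar(\mathfrak p^\pm)=U_\hbar(\mathfrak l)U_\hbar(\mathfrak n^\pm)$. $M^+_\lambda$ is the $U_\hbar(\mathfrak g)$-module induced from the one dimensional $U_\hbar(\mathfrak p^+)$-module of weight $\lambda\varepsilon_1$ with generator $v_\lambda$ (annihilated by all $e_i$ and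 by $f_2,\dots,f_n$, $h_\alpha v_\lambda=\lambda(\alpha,\varepsilon_1)v_\lambda$). $M^-_{-\lambda}$ is induced from the one dimensional $U_\hbar(\mathfrak p^-)$-module of weight $-\lambda\varepsilon_1$ with generator $v_{-\lambda}$. The invariant pairing is $\langle uv_{-\lambda},wv_\lambda\rangle=\lambda([\gamma(u)w]_{\mathfrak l})$, where $[\cdot]_{\mathfrak l}\colon U_\hbar(\mathfrak g)\to U_\hbar(\mathfrak l)$ is the projection defined by $U_\hbar(\mathfrak g)=U_\hbar(\mathfrak n^-)U_\hbar(\mathfrak l)U_\hbar(\mathfrak n^+)$ and $\lambda$ is the character of $U_\hbar(\mathfrak l)$ on $v_\lambda$. A lift of an element of $M^+_\lambda\otimes M^-_{-\lambda}$ is an element of (completed) $U_\hbar(\mathfrak p^-)\otimes U_\hbar(\mathfrak p^+)$ whose action on $v_\lambda\otimes v_{-\lambda}$ yields it. Let $\mathfrak h$ be the span of the $\beta_i$ (identified with the Cartan subalgebra of $\mathfrak{sl}(n+1)$ via $(\cdot,\cdot)$, $\eta\in\mathfrak h$ acting on a vector of weight $\xi$ by $(\eta,\xi)$). Put $\tilde y_i=q^{(\eta_i,\lambda\varepsilon_1)}y_iq^{-\eta_i}$, where $\eta_1,\dots,\eta_n\in\mathfrak h$ is the unique sequence such that $D_i=\tilde y_i\otimes\tilde x_i$ satisfy $D_jD_i=q^2D_iD_j$ for $j<i$ and the matrix coefficients are unchanged: $\langle\tilde x_n^{k_n}\cdots\tilde x_1^{k_1}v_{-\lambda},\tilde y_n^{m_n}\cdots\tilde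 y_1^{m_1}v_\lambda\rangle=\langle\tilde x_n^{k_n}\cdots\tilde x_1^{k_1}v_{-\lambda},y_n^{m_n}\cdots y_1^{m_1}v_\lambda\rangle$. Concretely, $(\eta_i,\beta_j)=0$ for $i\ge j$ and $(\eta_i,\beta_j)=2$ for $i<j$. *)

theory Defs
  imports
    Complex_Main
    "HOL-Library.Poly_Mapping"
    "HOL-Library.Product_Plus"
    "HOL-Computational_Algebra.Formal_Power_Series"
begin

text \<open>
  The base ring C[[h]] is \<open>complex fps\<close>; the variable of the power series plays the role of
  h-bar, so that \<open>q\<close> powered to \<open>a\<close> is \<open>fps_exp a\<close>. The topology of the library on \<open>fps\<close>
  (\<open>closed\<close>, \<open>tendsto\<close>) is the h-adic one.
\<close>

abbreviation qpw :: "complex \<Rightarrow> complex fps" where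
  "qpw a \<equiv> fps_exp a"

definition qnum :: "complex \<Rightarrow> complex fps" where
  "qnum x = (qpw x - qpw (- x)) / (qpw 1 - qpw (- 1))"

definition qfact :: "nat \<Rightarrow> complex fps" where
  "qfact m = (\<Prod>k = 1..m. qnum (of_nat k))"


section \<open>The topological Hopf algebra\<close>

text \<open>
  \<open>Egen i\<close>, \<open>Fgen i\<close> are the Chevalley generators and \<open>Hgen a\<close> is the Cartan element of
  \<open>\<epsilon>\<^sub>a\<close> (indices start at 1). Words form a monoid under concatenation, written additively
  in order to obtain the free algebra as a monoid algebra \<open>word \<Rightarrow>\<^sub>0 complex\<close>.
\<close>

datatype gen = Egen nat | Fgen nat | Hgen nat

datatype word = Word (letters: "gen list")

instantiation word :: monoid_add
begin

definition zero_word :: word where "0 = Word []"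

definition plus_word :: "word \<Rightarrow> word \<Rightarrow> word" where
  "v + w = Word (letters v @ letters w)"

instance
  by standard (simp_all add: zero_word_def plus_word_def)

end

type_synonym 'k hser = "('k \<Rightarrow>\<^sub>0 complex) fps"

text \<open>
  \<open>alg\<close> is the h-adically completed free algebra on all the generators, and \<open>alg2\<close> its completed
  tensor square. The quantum group, its modules and their tensor products are quotients of
  these; elements are handled through representatives, and equality in a quotient is
  membership of the difference in the submodule factored out.
\<close>

type_synonym alg = "word hser"
type_synonym alg2 = "(word \<times> word) hser"

definition scal :: "complex fps \<Rightarrow> ('k::monoid_add) hser" where
  "scal c = Abs_fps (\<lambda>k. Poly_Mapping.single 0 (fps_nth c k))"

definition gen :: "gen \<Rightarrow> alg" where
  "gen g = fps_const (Poly_Mapping.single (Word [g]) 1)"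

abbreviation ee :: "nat \<Rightarrow> alg" where "ee i \<equiv> gen (Egen i)"
abbreviation ff :: "nat \<Rightarrow> alg" where "ff i \<equiv> gen (Fgen i)"

definition tensor0 :: "(word \<Rightarrow>\<^sub>0 complex) \<Rightarrow> (word \<Rightarrow>\<^sub>0 complex) \<Rightarrow> (word \<times> word) \<Rightarrow>\<^sub>0 complex" where
  "tensor0 x y = (\<Sum>v\<in>Poly_Mapping.keys x. \<Sum>w\<in>Poly_Mapping.keys y.
     Poly_Mapping.single (v, w) (Poly_Mapping.lookup x v * Poly_Mapping.lookup y w))"

definition tensor :: "alg \<Rightarrow> alg \<Rightarrow> alg2"  (infixr "\<otimes>\<^sub>h" 72) where
  "X \<otimes>\<^sub>h Y = Abs_fps (\<lambda>k. \<Sum>i\<le>k. tensor0 (fps_nth X i) (fps_nth Y (k - i)))"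

text \<open>
  Weights of gl(n+1) are given by their coordinates with respect to
  \<open>\<epsilon>\<^sub>1, \<dots>, \<epsilon>\<^sub>n\<^sub>+\<^sub>1\<close>; coordinates at other indices play no role.
\<close>

definition eps :: "nat \<Rightarrow> nat \<Rightarrow> complex" where
  "eps a = (\<lambda>b. if b = a then 1 else 0)"

definition alpha :: "nat \<Rightarrow> nat \<Rightarrow> complex" where
  "alpha i = (\<lambda>b. eps i b - eps (i + 1) b)"

definition beta :: "nat \<Rightarrow> nat \<Rightarrow> complex" where
  "beta i = (\<lambda>b. \<Sum>j = 1..i. alpha j b)"

definition form :: "nat \<Rightarrow> (nat \<Rightarrow> complex) \<Rightarrow> (nat \<Rightarrow> complex) \<Rightarrow> complex" where
  "form n \<mu> \<nu> = (\<Sum>a = 1..n + 1. \<mu> a * \<nu> a)"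

definition cartan0 :: "nat \<Rightarrow> (nat \<Rightarrow> complex) \<Rightarrow> word \<Rightarrow>\<^sub>0 complex" where
  "cartan0 n \<mu> = (\<Sum>a = 1..n + 1. Poly_Mapping.single (Word [Hgen a]) (\<mu> a))"

definition cartan :: "nat \<Rightarrow> (nat \<Rightarrow> complex) \<Rightarrow> alg" where
  "cartan n \<mu> = fps_const (cartan0 n \<mu>)"

definition qcartan :: "nat \<Rightarrow> (nat \<Rightarrow> complex) \<Rightarrow> alg" where
  "qcartan n \<mu> = Abs_fps (\<lambda>k. Poly_Mapping.single 0 (1 / fact k) * cartan0 n \<mu> ^ k)"

text \<open>
  Both \<open>q\<^sup>h - q\<^sup>-\<^sup>h\<close> and \<open>q - q\<^sup>-\<^sup>1\<close> are divisible by h-bar, the latter with a unit as quotient.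
\<close>

definition qnum_cartan :: "nat \<Rightarrow> (nat \<Rightarrow> complex) \<Rightarrow> alg" where
  "qnum_cartan n \<mu> = scal (inverse (fps_shift 1 (qpw 1 - qpw (- 1))))
     * fps_shift 1 (qcartan n \<mu> - qcartan n (\<lambda>a. - \<mu> a))"

definition serre :: "alg \<Rightarrow> alg \<Rightarrow> alg" where
  "serre x y = x * x * y - scal (qpw 1 + qpw (- 1)) * (x * y * x) + y * x * x"

definition gens :: "nat \<Rightarrow> gen set" where
  "gens n = Egen ` {1..n} \<union> Fgen ` {1..n} \<union> Hgen ` {1..n + 1}"

text \<open>The free algebra has generators for all indices; the superfluous ones are set to 0.\<close>

definition relators :: "nat \<Rightarrow> alg set" where
  "relators n =
     {gen g |g. g \<notin> gens n}
   \<union> {gen (Hgen a) * gen (Hgen b) - gen (Hgen b) * gen (Hgen a) |a b. a \<in> {1..n + 1} \<and> b \<in> {1..n + 1}}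
   \<union> {gen (Hgen a) * ee i - ee i * gen (Hgen a) - scal (fps_const (form n (eps a) (alpha i))) * ee i
        |a i. a \<in> {1..n + 1} \<and> i \<in> {1..n}}
   \<union> {gen (Hgen a) * ff i - ff i * gen (Hgen a) + scal (fps_const (form n (eps a) (alpha i))) * ff i
        |a i. a \<in> {1..n + 1} \<and> i \<in> {1..n}}
   \<union> {ee i * ff j - ff j * ee i - (if i = j then qnum_cartan n (alpha i) else 0)
        |i j. i \<in> {1..n} \<and> j \<in> {1..n}}
   \<union> {serre (ee i) (ee j) |i j. i \<in> {1..n} \<and> j \<in> {1..n} \<and> (j = i + 1 \<or> i = j + 1)}
   \<union> {serre (ff i) (ff j) |i j. i \<in> {1..n} \<and> j \<in> {1..n} \<and> (j = i + 1 \<or> i = j + 1)}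
   \<union> {ee i * ee j - ee j * ee i |i j. i \<in> {1..n} \<and> j \<in> {1..n} \<and> (i + 1 < j \<or> j + 1 < i)}
   \<union> {ff i * ff j - ff j * ff i |i j. i \<in> {1..n} \<and> j \<in> {1..n} \<and> (i + 1 < j \<or> j + 1 < i)}"

definition additive :: "'a::group_add set \<Rightarrow> bool" where
  "additive S \<longleftrightarrow> 0 \<in> S \<and> (\<forall>x\<in>S. \<forall>y\<in>S. x - y \<in> S)"

definition hmodule :: "('k::monoid_add) hser set \<Rightarrow> bool" where
  "hmodule S \<longleftrightarrow> additive S \<and> (\<forall>c. \<forall>x\<in>S. scal c * x \<in> S)"

definition left_ideal :: "alg set \<Rightarrow> bool" where
  "left_ideal S \<longleftrightarrow> additive S \<and> (\<forall>u. \<forall>x\<in>S. u * x \<in> S)"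

definition two_sided_ideal :: "alg set \<Rightarrow> bool" where
  "two_sided_ideal S \<longleftrightarrow> left_ideal S \<and> (\<forall>u. \<forall>x\<in>S. x * u \<in> S)"

text \<open>The quantum group is the quotient of \<^typ>\<open>alg\<close> by \<open>rel_ideal n\<close>.\<close>

definition rel_ideal :: "nat \<Rightarrow> alg set" where
  "rel_ideal n = (\<lambda>S. two_sided_ideal S \<and> closed S) hull relators n"

text \<open>
  Antipode, as an h-adically continuous anti-endomorphism of \<^typ>\<open>alg\<close>;
  it preserves \<open>rel_ideal n\<close>.
\<close>

fun antipode_gen :: "nat \<Rightarrow> gen \<Rightarrow> alg" where
  "antipode_gen n (Egen i) = - (qcartan n (\<lambda>a. - alpha i a) * ee i)"
| "antipode_gen n (Fgen i) = - (ff i * qcartan n (alpha i))"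
| "antipode_gen n (Hgen a) = - gen (Hgen a)"

definition antipode0 :: "nat \<Rightarrow> (word \<Rightarrow>\<^sub>0 complex) \<Rightarrow> alg" where
  "antipode0 n p = (\<Sum>w\<in>Poly_Mapping.keys p. scal (fps_const (Poly_Mapping.lookup p w))
     * prod_list (rev (map (antipode_gen n) (letters w))))"

definition antipode :: "nat \<Rightarrow> alg \<Rightarrow> alg" where
  "antipode n u = Abs_fps (\<lambda>k. \<Sum>i\<le>k. fps_nth (antipode0 n (fps_nth u i)) (k - i))"

text \<open>The counit annihilates all generators, so it picks the coefficient of the empty word.\<close>

definition counit :: "alg \<Rightarrow> complex fps" where
  "counit u = Abs_fps (\<lambda>k. Poly_Mapping.lookup (fps_nth u k) 0)"


section \<open>Root vectors and subalgebras\<close>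

definition qcomm :: "complex fps \<Rightarrow> alg \<Rightarrow> alg \<Rightarrow> alg" where
  "qcomm a x y = x * y - scal a * (y * x)"

definition xroot :: "nat \<Rightarrow> alg" where
  "xroot i = scal (qpw (2 * (of_nat i - 1)))
     * foldr (\<lambda>j z. qcomm (qpw (- 1)) (ee j) z) [1..<i] (ee i)"

definition yroot :: "nat \<Rightarrow> alg" where
  "yroot i = foldr (\<lambda>j z. qcomm (qpw (- 1)) (ff j) z) (rev [2..<i + 1]) (ff 1)"

text \<open>
  A closed subalgebra of the quantum group is represented by its full preimage in \<^typ>\<open>alg\<close>,
  i.e. it contains \<open>rel_ideal n\<close>.
\<close>

definition subalgebra :: "alg set \<Rightarrow> bool" where
  "subalgebra S \<longleftrightarrow> hmodule S \<and> 1 \<in> S \<and> (\<forall>x\<in>S. \<forall>y\<in>S. x * y \<in> S)"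

definition gen_subalgebra :: "nat \<Rightarrow> alg set \<Rightarrow> alg set" where
  "gen_subalgebra n G = (\<lambda>S. subalgebra S \<and> closed S) hull (G \<union> rel_ideal n)"

definition U_l :: "nat \<Rightarrow> alg set" where
  "U_l n = gen_subalgebra n (ee ` {2..n} \<union> ff ` {2..n} \<union> (\<lambda>a. gen (Hgen a)) ` {1..n + 1})"

definition U_n_plus :: "nat \<Rightarrow> alg set" where
  "U_n_plus n = gen_subalgebra n (xroot ` {1..n})"

definition U_n_minus :: "nat \<Rightarrow> alg set" where
  "U_n_minus n = gen_subalgebra n (yroot ` {1..n})"

definition closed_span :: "('k::monoid_add) hser set \<Rightarrow> 'k hser set" where
  "closed_span B = (\<lambda>S. hmodule S \<and> closed S) hull B"

definition U_p_plus :: "nat \<Rightarrow> alg set" where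
  "U_p_plus n = closed_span {b * c |b c. b \<in> U_l n \<and> c \<in> U_n_plus n}"

definition U_p_minus :: "nat \<Rightarrow> alg set" where
  "U_p_minus n = closed_span {b * a |b a. b \<in> U_l n \<and> a \<in> U_n_minus n}"

text \<open>
  The projection to \<open>U_l n\<close> is \<open>\<epsilon> \<otimes> id \<otimes> \<epsilon>\<close> with respect to the triangular factorization,
  \<open>\<epsilon>\<close> being the counit. The value is determined modulo \<open>rel_ideal n\<close> only.
\<close>

definition proj_l_kernel :: "nat \<Rightarrow> alg set" where
  "proj_l_kernel n = closed_span {a * b * c |a b c.
     a \<in> U_n_minus n \<and> b \<in> U_l n \<and> c \<in> U_n_plus n \<and> (counit a = 0 \<or> counit c = 0)}"

definition proj_l :: "nat \<Rightarrow> alg \<Rightarrow> alg" where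
  "proj_l n u = (SOME l. l \<in> U_l n \<and> u - l \<in> proj_l_kernel n)"


section \<open>The modules and the invariant pairing\<close>

text \<open>
  The induced modules are the quotients of \<^typ>\<open>alg\<close> by the closed left ideals \<open>J_plus\<close>,
  \<open>J_minus\<close>; the class of \<open>u\<close> is \<open>u v\<^sub>\<lambda>\<close>, respectively \<open>u v\<^sub>-\<^sub>\<lambda>\<close>, and the class of 1 is the
  generator.
\<close>

definition J_plus :: "nat \<Rightarrow> complex \<Rightarrow> alg set" where
  "J_plus n lam = (\<lambda>S. left_ideal S \<and> closed S) hull
     (rel_ideal n \<union> ee ` {1..n} \<union> ff ` {2..n}
      \<union> {gen (Hgen a) - scal (fps_const (lam * form n (eps a) (eps 1))) |a. a \<in> {1..n + 1}})"

definition J_minus :: "nat \<Rightarrow> complex \<Rightarrow> alg set" where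
  "J_minus n lam = (\<lambda>S. left_ideal S \<and> closed S) hull
     (rel_ideal n \<union> ff ` {1..n} \<union> ee ` {2..n}
      \<union> {gen (Hgen a) + scal (fps_const (lam * form n (eps a) (eps 1))) |a. a \<in> {1..n + 1}})"

definition weight_vector :: "nat \<Rightarrow> alg set \<Rightarrow> (nat \<Rightarrow> complex) \<Rightarrow> alg \<Rightarrow> bool" where
  "weight_vector n J \<mu> u \<longleftrightarrow>
     (\<forall>a\<in>{1..n + 1}. gen (Hgen a) * u - scal (fps_const (\<mu> a)) * u \<in> J)"

text \<open>The character of \<open>U_l n\<close> on \<open>v\<^sub>\<lambda>\<close>.\<close>

definition character :: "nat \<Rightarrow> complex \<Rightarrow> alg \<Rightarrow> complex fps" where
  "character n lam l = (THE c. l - scal c \<in> J_plus n lam)"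

text \<open>\<open>pairing n lam u w\<close> is the pairing of \<open>u v\<^sub>-\<^sub>\<lambda>\<close> with \<open>w v\<^sub>\<lambda>\<close>.\<close>

definition pairing :: "nat \<Rightarrow> complex \<Rightarrow> alg \<Rightarrow> alg \<Rightarrow> complex fps" where
  "pairing n lam u w = character n lam (proj_l n (antipode n u * w))"

text \<open>
  Bases are topological: the quotient modules are h-adically complete, and each element has a
  unique expansion with coefficients tending to 0.
\<close>

definition is_basis :: "alg set \<Rightarrow> (nat \<Rightarrow> alg) \<Rightarrow> bool" where
  "is_basis J a \<longleftrightarrow> (\<forall>u. \<exists>!c :: nat \<Rightarrow> complex fps. c \<longlonglongrightarrow> 0 \<and>
     (\<exists>s. (\<lambda>k. \<Sum>i<k. scal (c i) * a i) \<longlonglongrightarrow> s \<and> u - s \<in> J))"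

definition dual_bases :: "nat \<Rightarrow> complex \<Rightarrow> (nat \<Rightarrow> alg) \<Rightarrow> (nat \<Rightarrow> alg) \<Rightarrow> bool" where
  "dual_bases n lam a b \<longleftrightarrow>
     is_basis (J_plus n lam) a \<and> (\<forall>i. \<exists>\<mu>. weight_vector n (J_plus n lam) \<mu> (a i)) \<and>
     is_basis (J_minus n lam) b \<and> (\<forall>i. \<exists>\<mu>. weight_vector n (J_minus n lam) \<mu> (b i)) \<and>
     (\<forall>i j. pairing n lam (b i) (a j) = (if i = j then 1 else 0))"


section \<open>Completed tensor products\<close>

text \<open>
  A completed tensor product is the completion with respect to a decreasing filtration by
  subgroups of \<^typ>\<open>alg2\<close>. Its elements are given by Cauchy sequences, two of which define the
  same element iff their difference is a null sequence.
\<close>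

definition null_seq :: "(nat \<Rightarrow> alg2 set) \<Rightarrow> (nat \<Rightarrow> alg2) \<Rightarrow> bool" where
  "null_seq N S \<longleftrightarrow> (\<forall>d. \<forall>\<^sub>F k in sequentially. S k \<in> N d)"

definition cauchy_seq :: "(nat \<Rightarrow> alg2 set) \<Rightarrow> (nat \<Rightarrow> alg2) \<Rightarrow> bool" where
  "cauchy_seq N S \<longleftrightarrow> (\<forall>d. \<exists>K. \<forall>k\<ge>K. \<forall>l\<ge>K. S k - S l \<in> N d)"

text \<open>
  The weights of the first module are \<open>\<lambda>\<epsilon>\<^sub>1 - \<Sum>k\<^sub>i\<beta>\<^sub>i\<close>, those of the second one are opposite.
  There are finitely many of them with given degree \<open>\<Sum>k\<^sub>i\<close>, and the degree is read off
  the action of \<open>Hgen 1\<close>. The filtration \<open>MM_filt\<close> of the tensor product of the two modules is by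
  degree in either factor and by powers of h-bar, so the completion is the direct product of
  the tensor products of the weight spaces.
\<close>

definition deg_plus :: "nat \<Rightarrow> complex \<Rightarrow> nat \<Rightarrow> alg set" where
  "deg_plus n lam j = {u. gen (Hgen 1) * u - scal (fps_const (lam - of_nat j)) * u \<in> J_plus n lam}"

definition deg_minus :: "nat \<Rightarrow> complex \<Rightarrow> nat \<Rightarrow> alg set" where
  "deg_minus n lam j = {u. gen (Hgen 1) * u + scal (fps_const (lam - of_nat j)) * u \<in> J_minus n lam}"

definition MM_filt :: "nat \<Rightarrow> complex \<Rightarrow> nat \<Rightarrow> alg2 set" where
  "MM_filt n lam d = hmodule hull
     ({x \<otimes>\<^sub>h y |x y. x \<in> J_plus n lam \<or> y \<in> J_minus n lam}
      \<union> {x \<otimes>\<^sub>h y |x y. \<exists>j\<ge>d. x \<in> deg_plus n lam j \<or> y \<in> deg_minus n lam j}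
      \<union> range (\<lambda>t. fps_X ^ d * t))"

definition U_p_tensor :: "nat \<Rightarrow> alg2 set" where
  "U_p_tensor n = closed_span
     ({x \<otimes>\<^sub>h y |x y. x \<in> U_p_minus n \<and> y \<in> U_p_plus n}
      \<union> {x \<otimes>\<^sub>h y |x y. x \<in> rel_ideal n \<or> y \<in> rel_ideal n})"

text \<open>
  Likewise for \<open>U_p_tensor n\<close>, with the degree given by the adjoint action of \<open>Hgen 1\<close>, which is
  non-positive on \<open>U_p_minus n\<close> and non-negative on \<open>U_p_plus n\<close>.
\<close>

definition deg_U_p_minus :: "nat \<Rightarrow> nat \<Rightarrow> alg set" where
  "deg_U_p_minus n j = {u \<in> U_p_minus n.
     gen (Hgen 1) * u - u * gen (Hgen 1) + scal (of_nat j) * u \<in> rel_ideal n}"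

definition deg_U_p_plus :: "nat \<Rightarrow> nat \<Rightarrow> alg set" where
  "deg_U_p_plus n j = {u \<in> U_p_plus n.
     gen (Hgen 1) * u - u * gen (Hgen 1) - scal (of_nat j) * u \<in> rel_ideal n}"

definition U_p_filt :: "nat \<Rightarrow> nat \<Rightarrow> alg2 set" where
  "U_p_filt n d = hmodule hull
     ({x \<otimes>\<^sub>h y |x y. x \<in> rel_ideal n \<or> y \<in> rel_ideal n}
      \<union> {x \<otimes>\<^sub>h y |x y. x \<in> U_p_minus n \<and> y \<in> U_p_plus n \<and>
           (\<exists>j\<ge>d. x \<in> deg_U_p_minus n j \<or> y \<in> deg_U_p_plus n j)}
      \<union> {fps_X ^ d * t |t. t \<in> U_p_tensor n})"

definition canonical_element :: "nat \<Rightarrow> complex \<Rightarrow> (nat \<Rightarrow> alg2) \<Rightarrow> bool" where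
  "canonical_element n lam \<Omega> \<longleftrightarrow> cauchy_seq (MM_filt n lam) \<Omega> \<and>
     (\<exists>a b. dual_bases n lam a b \<and>
        null_seq (MM_filt n lam) (\<lambda>k. \<Omega> k - (\<Sum>i<k. a i \<otimes>\<^sub>h b i)))"

text \<open>
  \<open>1 \<otimes>\<^sub>h 1\<close> represents the tensor product of the generators, so \<open>S k * (1 \<otimes>\<^sub>h 1)\<close>
  represents the result of applying \<open>S k\<close> to it.
\<close>

definition is_lift :: "nat \<Rightarrow> complex \<Rightarrow> (nat \<Rightarrow> alg2) \<Rightarrow> (nat \<Rightarrow> alg2) \<Rightarrow> bool" where
  "is_lift n lam S \<Omega> \<longleftrightarrow> (\<forall>k. S k \<in> U_p_tensor n) \<and> cauchy_seq (U_p_filt n) S \<and>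
     null_seq (MM_filt n lam) (\<lambda>k. S k * (1 \<otimes>\<^sub>h 1) - \<Omega> k)"


section \<open>The modified root vectors and the series\<close>

definition eta :: "nat \<Rightarrow> nat \<Rightarrow> nat \<Rightarrow> complex" where
  "eta n i = (THE \<eta>. (\<exists>c. \<eta> = (\<lambda>b. \<Sum>j = 1..n. c j * beta j b)) \<and>
     (\<forall>j\<in>{1..n}. form n \<eta> (beta j) = (if i < j then 2 else 0)))"

definition yroot' :: "nat \<Rightarrow> complex \<Rightarrow> nat \<Rightarrow> alg" where
  "yroot' n lam i = scal (qpw (form n (eta n i) (\<lambda>b. lam * eps 1 b)))
     * yroot i * qcartan n (\<lambda>b. - eta n i b)"

definition yx :: "nat \<Rightarrow> complex \<Rightarrow> alg2" where
  "yx n lam = (\<Sum>i = 1..n. yroot' n lam i \<otimes>\<^sub>h xroot i)"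

definition lift_coeff :: "complex \<Rightarrow> nat \<Rightarrow> complex fps" where
  "lift_coeff lam m = (- 1) ^ m * qpw ((lam + 1) * of_nat m - (of_nat m)\<^sup>2)
     / (qfact m * (\<Prod>j<m. qnum (lam - of_nat j)))"

text \<open>Existence and uniqueness of \<open>eta n i\<close>.\<close>

lemma beta_eq: "beta i b = eps 1 b - eps (i + 1) b"
proof (induction i)
  case 0
  show ?case by (simp add: beta_def)
next
  case (Suc i)
  have "beta (Suc i) b = beta i b + alpha (Suc i) b"
    by (simp add: beta_def)
  then show ?case using Suc by (simp add: alpha_def)
qed

lemma form_span_beta:
  assumes "j \<in> {1..n}"
  shows "form n (\<lambda>b. \<Sum>k = 1..n. c k * beta k b) (beta j) = (\<Sum>k = 1..n. c k) + c j"
proof -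
  define \<eta> where "\<eta> = (\<lambda>b. \<Sum>k = 1..n. c k * beta k b)"
  have s: "(\<Sum>a = 1..n + 1. \<eta> a * eps i a) = \<eta> i" if "i \<in> {1..n + 1}" for i
    using that by (simp add: eps_def if_distrib cong: if_cong)
  have "form n \<eta> (beta j) = \<eta> 1 - \<eta> (j + 1)"
    using s[of 1] s[of "j + 1"] assms
    by (simp add: form_def beta_eq right_diff_distrib sum_subtractf del: sum.cl_ivl_Suc)
  moreover have "\<eta> 1 = (\<Sum>k = 1..n. c k)"
    unfolding \<eta>_def by (rule sum.cong) (auto simp: beta_eq eps_def)
  moreover have "\<eta> (j + 1) = (\<Sum>k = 1..n. if k = j then - c k else 0)"
    unfolding \<eta>_def by (rule sum.cong) (use assms in \<open>auto simp: beta_eq eps_def\<close>)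
  hence "\<eta> (j + 1) = - c j" using assms by simp
  ultimately show ?thesis by (simp add: \<eta>_def)
qed

lemma eta_ex1:
  "\<exists>!\<eta>. (\<exists>c. \<eta> = (\<lambda>b. \<Sum>j = 1..n. c j * beta j b)) \<and>
     (\<forall>j\<in>{1..n}. form n \<eta> (beta j) = (if i < j then 2 else 0))"
proof -
  define t :: "nat \<Rightarrow> complex" where "t = (\<lambda>j. if i < j then 2 else 0)"
  define s where "s = (\<Sum>j = 1..n. t j) / of_nat (n + 1)"
  have n0: "(of_nat n + 1 :: complex) \<noteq> 0"
    by (metis of_nat_Suc of_nat_eq_0_iff add.commute nat.distinct(1))
  have ts: "(\<Sum>j = 1..n. t j) = s * (of_nat n + 1)"
    using n0 by (simp add: s_def add.commute)
  have sum: "(\<Sum>j = 1..n. t j - s) = s"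
    unfolding sum_subtractf ts by (simp add: algebra_simps)
  show ?thesis
  proof (intro ex1I conjI)
    show "\<exists>c. (\<lambda>b. \<Sum>j = 1..n. (t j - s) * beta j b) = (\<lambda>b. \<Sum>j = 1..n. c j * beta j b)"
      by (rule exI[of _ "\<lambda>j. t j - s"]) (rule refl)
    show "\<forall>j\<in>{1..n}. form n (\<lambda>b. \<Sum>j = 1..n. (t j - s) * beta j b) (beta j)
        = (if i < j then 2 else 0)"
    proof
      fix j assume j: "j \<in> {1..n}"
      show "form n (\<lambda>b. \<Sum>j = 1..n. (t j - s) * beta j b) (beta j) = (if i < j then 2 else 0)"
        unfolding form_span_beta[OF j] sum by (simp add: t_def)
    qed
  next
    fix \<eta> assume *: "(\<exists>c. \<eta> = (\<lambda>b. \<Sum>j = 1..n. c j * beta j b)) \<and>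
      (\<forall>j\<in>{1..n}. form n \<eta> (beta j) = (if i < j then 2 else 0))"
    then obtain c where c: "\<eta> = (\<lambda>b. \<Sum>j = 1..n. c j * beta j b)" by blast
    define C where "C = (\<Sum>k = 1..n. c k)"
    have cj: "c j = t j - C" if "j \<in> {1..n}" for j
    proof -
      have "C + c j = t j"
        using * that form_span_beta[OF that, of c] unfolding c C_def t_def by metis
      then show ?thesis by (simp add: algebra_simps)
    qed
    have "C = (\<Sum>j = 1..n. t j - C)"
      by (subst C_def, rule sum.cong) (use cj in auto)
    then have "C = s * (of_nat n + 1) - of_nat n * C"
      unfolding sum_subtractf ts by simp
    then have "(C - s) * (of_nat n + 1) = 0" by (simp add: algebra_simps)
    then have "C = s" using n0 by simp
    then show "\<eta> = (\<lambda>b. \<Sum>j = 1..n. (t j - s) * beta j b)"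
      unfolding c using cj by (intro ext sum.cong) auto
  qed
qed

end

theory Submission
  imports Defs "HOL-Library.Countable_Set"
begin

text \<open>
  The oscillator representation of the quantum group on monomials in \<open>n + 1\<close> variables, with
  the exponent of the first variable shifted by \<open>\<lambda>\<close>, provides a model of both induced modules
  (for the second one E and F are exchanged). A quantum PBW argument, based on commutation
  relations between the root vectors and the simple generators, shows that an element of the
  quantum group annihilates the generator of the induced module as soon as it annihilates the
  monomial of exponent 0. Hence every computation in the induced modules can be made with monomials:
  the weight spaces are one-dimensional, the pairing is diagonal, and its entries follow from invariance
  under the \<open>e\<^sub>i\<close>. On the other side, the powers of the tensor \<open>yx\<close> expand with
  multinomial coefficients in the squared parameter, since its summands commute up to such factors; comparison of
  the two closed formulas gives the theorem. For \<open>\<lambda> \<notin> \<nat>\<close> all entries are invertible in \<open>complex fps\<close>.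
\<close>

section \<open>Completed free modules over the power series ring\<close>

text \<open>Projection, character and pairing are defined through choice, and the modules are
  quotients by closed left ideals, so nothing can be evaluated before a concrete map out of these
  quotients is known. The oscillator space provides it, and it also settles well-definedness: the
  coefficient of the monomial of exponent 0 vanishes on \<open>proj_l_kernel\<close>, so every
  choice made by \<open>proj_l\<close> gives the same character. What is left to do inside the
  algebra is existence: enough relations to order words, both modulo the left ideals and in
  triangular form.

  The basis vectors are multiples of words in the simple generators because the antipode is given on
  words. The Gram matrix is not computed. Its diagonal inverse is guessed to be the coefficient
  \<open>Gc\<close> produced by the series, and the guess is confirmed by invariance under the e's.

  The condition on \<lambda> enters through the factors \<open>qnum (lam - of_nat m)\<close>: their
  constant terms \<lambda> - m do not vanish, so they are units, and the dual bases exist over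
  C[[h]] itself.\<close>

abbreviation (input) "lookup \<equiv> Poly_Mapping.lookup"
abbreviation (input) "single \<equiv> Poly_Mapping.single"
abbreviation (input) "keys \<equiv> Poly_Mapping.keys"

definition smul :: "complex fps \<Rightarrow> ('k::monoid_add) hser \<Rightarrow> 'k hser"  (infixr "\<star>" 73) where
  "c \<star> x = scal c * x"

definition bas :: "'k \<Rightarrow> ('k::monoid_add) hser" where
  "bas k = fps_const (single k 1)"

lemma lookup_single_0_mult:
  "lookup (single 0 a * p) k = a * lookup p k"
  for p :: "'k::monoid_add \<Rightarrow>\<^sub>0 complex"
  by (cases "a = 0") (simp_all flip: mult_map_scale_conv_mult add: Poly_Mapping.map.rep_eq when_def)

lemma poly_mapping_sum_single:
  "p = (\<Sum>k\<in>keys p. single k (lookup p k))"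
  by (rule poly_mapping_eqI)
    (simp add: lookup_sum lookup_single when_def in_keys_iff sum.delta')

lemma poly_mapping_single_induct [case_names single add]:
  fixes p :: "'k \<Rightarrow>\<^sub>0 'b::comm_monoid_add"
  assumes "\<And>k c. P (single k c)"
    and "\<And>p r. P p \<Longrightarrow> P r \<Longrightarrow> P (p + r)"
  shows "P p"
proof -
  have "P 0" using assms(1)[of undefined 0] by simp
  then have "P (\<Sum>k\<in>K. single k (lookup p k))" for K
    by (induction K rule: infinite_finite_induct) (auto intro: assms)
  then show ?thesis using poly_mapping_sum_single[of p] by metis
qed

text \<open>Scalars sit on the unit of the monoid, hence are central although words do not
  commute.\<close>

lemma single_0_central:
  "p * single 0 a = single 0 a * p"
  for p :: "'k::monoid_add \<Rightarrow>\<^sub>0 complex"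
  by (induction p rule: poly_mapping_single_induct) (simp_all add: mult_single algebra_simps)

lemma scal_nth [simp]: "fps_nth (scal c) m = single 0 (fps_nth c m)"
  by (simp add: scal_def)

lemma scal_add: "scal (a + b) = scal a + scal b"
  by (rule fps_ext) (simp add: single_add)

lemma single_0_sum: "single 0 (\<Sum>i\<in>A. f i) = (\<Sum>i\<in>A. single 0 (f i))"
  by (induction A rule: infinite_finite_induct) (simp_all add: single_add)

lemma scal_mult: "scal (a * b) = scal a * scal b"
  by (rule fps_ext) (simp add: fps_mult_nth single_0_sum mult_single)

lemma scal_0 [simp]: "scal 0 = 0"
  by (rule fps_ext) simp

lemma scal_1 [simp]: "scal 1 = 1"
  by (rule fps_ext) simp

lemma scal_minus: "scal (- a) = - scal a"
  by (rule fps_ext) (simp add: single_uminus)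

lemma scal_commute: "x * scal c = scal c * x"
proof (rule fps_ext)
  fix m
  have "fps_nth (x * scal c) m = (\<Sum>i=0..m. single 0 (fps_nth c (m - i)) * fps_nth x i)"
    by (simp add: fps_mult_nth single_0_central)
  also have "\<dots> = (\<Sum>i=0..m. single 0 (fps_nth c i) * fps_nth x (m - i))"
    by (rule sum.reindex_bij_witness[of _ "\<lambda>i. m - i" "\<lambda>i. m - i"]) auto
  finally show "fps_nth (x * scal c) m = fps_nth (scal c * x) m"
    by (simp add: fps_mult_nth)
qed

interpretation hs: module "smul :: complex fps \<Rightarrow> 'k::monoid_add hser \<Rightarrow> 'k hser"
  by unfold_locales (simp_all add: smul_def distrib_left distrib_right scal_add scal_mult mult.assoc)

lemma scal_conv: "scal c = c \<star> 1"
  by (simp add: smul_def)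

lemma smul_mult_left [simp]: "(c \<star> x) * y = c \<star> (x * y)"
  by (simp add: smul_def mult.assoc)

lemma smul_mult_right [simp]: "x * (c \<star> y) = c \<star> (x * y)"
  unfolding smul_def by (metis mult.assoc scal_commute)

lemma smul_nth:
  "lookup (fps_nth (c \<star> x) m) k
     = (\<Sum>i=0..m. fps_nth c i * lookup (fps_nth x (m - i)) k)"
  by (simp add: smul_def fps_mult_nth lookup_sum lookup_single_0_mult)

lemma smul_const_nth: "fps_nth (fps_const a \<star> x) m = single 0 a * fps_nth x m"
  by (simp add: smul_def fps_mult_nth if_distrib cong: if_cong)
    (subst sum.remove[of _ 0], auto)

text \<open>Each order in h has finite support, but the supports may grow with the order. So an
  element has a scalar series at every basis vector, and infinitely many of these may be
  non-zero.\<close>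

definition coord :: "'k \<Rightarrow> ('k::monoid_add) hser \<Rightarrow> complex fps" where
  "coord k x = Abs_fps (\<lambda>m. lookup (fps_nth x m) k)"

lemma coord_nth [simp]: "fps_nth (coord k x) m = lookup (fps_nth x m) k"
  by (simp add: coord_def)

lemma hser_eqI: "(\<And>k. coord k x = coord k y) \<Longrightarrow> x = y"
  by (intro fps_ext poly_mapping_eqI) (metis coord_nth)

lemma coord_add [simp]: "coord k (x + y) = coord k x + coord k y"
  by (rule fps_ext) (simp add: lookup_add)

lemma coord_0 [simp]: "coord k 0 = 0"
  by (rule fps_ext) simp

lemma coord_smul [simp]: "coord k (c \<star> x) = c * coord k x"
  by (rule fps_ext) (simp add: smul_nth fps_mult_nth)

lemma coord_bas: "coord k (bas l) = (if k = l then 1 else 0)"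
  by (rule fps_ext) (simp add: bas_def lookup_single when_def)

lemma coord_minus [simp]: "coord k (- x) = - coord k x"
  by (rule fps_ext) simp

lemma coord_diff [simp]: "coord k (x - y) = coord k x - coord k y"
  by (rule fps_ext) (simp add: lookup_minus)

lemma coord_sum: "coord k (sum f A) = (\<Sum>i\<in>A. coord k (f i))"
  by (induction A rule: infinite_finite_induct) simp_all

section \<open>Powers of h, closed submodules and topological generation\<close>

abbreviation hX :: "complex fps" where "hX \<equiv> fps_X"

lemma hX_power_smul_nth: "fps_nth (hX ^ d \<star> x) m = (if m < d then 0 else fps_nth x (m - d))"
proof (rule poly_mapping_eqI)
  fix k
  have "lookup (fps_nth (hX ^ d \<star> x) m) k = fps_nth (hX ^ d * coord k x) m"
    by (metis coord_nth coord_smul)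
  then show "lookup (fps_nth (hX ^ d \<star> x) m) k
      = lookup (if m < d then 0 else fps_nth x (m - d)) k"
    by (simp add: fps_X_power_mult_nth)
qed

lemma hX_power_smul_iff: "(\<exists>y. x = hX ^ d \<star> y) \<longleftrightarrow> (\<forall>i<d. fps_nth x i = 0)"
proof
  assume "\<forall>i<d. fps_nth x i = 0"
  then have "x = hX ^ d \<star> fps_shift d x"
    by (intro fps_ext) (simp add: hX_power_smul_nth)
  then show "\<exists>y. x = hX ^ d \<star> y" ..
qed (auto simp: hX_power_smul_nth)

lemma fps_const_sum_bas:
  "fps_const p = (\<Sum>k\<in>keys p. fps_const (lookup p k) \<star> bas k)"
proof -
  have "fps_const (lookup p k) \<star> bas k
      = fps_const (single k (lookup p k))" for k
    by (rule fps_ext) (simp add: smul_const_nth bas_def mult_single)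
  then have "(\<Sum>k\<in>K. fps_const (lookup p k) \<star> bas k)
      = fps_const (\<Sum>k\<in>K. single k (lookup p k))" for K
    by (induction K rule: infinite_finite_induct) simp_all
  then show ?thesis using poly_mapping_sum_single[of p] by metis
qed

lemma hser_expand:
  "x = (\<Sum>i<d. hX ^ i \<star> fps_const (fps_nth x i)) + hX ^ d \<star> fps_shift d x"
proof (rule fps_ext)
  fix m
  have "(\<Sum>i<d. fps_nth (hX ^ i \<star> fps_const (fps_nth x i)) m)
      = (\<Sum>i<d. if i = m then fps_nth x m else 0)"
    by (rule sum.cong) (auto simp: hX_power_smul_nth)
  then show "fps_nth x m = fps_nth ((\<Sum>i<d. hX ^ i \<star> fps_const (fps_nth x i)) + hX ^ d \<star> fps_shift d x) m"
    by (simp add: fps_sum_nth hX_power_smul_nth)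
qed

text \<open>The h-adic topology is given by truncations: a limit point is a series that agrees with
  members of the set up to every finite order.\<close>

lemma closed_fps_iff:
  fixes S :: "'a::group_add fps set"
  shows "closed S \<longleftrightarrow> (\<forall>x. (\<forall>d. \<exists>y\<in>S. \<forall>i<d. fps_nth y i = fps_nth x i) \<longrightarrow> x \<in> S)"
proof
  assume cl: "closed S"
  show "\<forall>x. (\<forall>d. \<exists>y\<in>S. \<forall>i<d. fps_nth y i = fps_nth x i) \<longrightarrow> x \<in> S"
  proof (intro allI impI)
    fix x assume "\<forall>d. \<exists>y\<in>S. \<forall>i<d. fps_nth y i = fps_nth x i"
    then obtain Y where Y: "\<And>d. Y d \<in> S" "\<And>d i. i < d \<Longrightarrow> fps_nth (Y d) i = fps_nth x i"
      by metis
    have "Y \<longlonglongrightarrow> x"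
      unfolding tendsto_fps_iff
    proof
      fix i
      have "\<forall>\<^sub>F d in sequentially. i < d" by (rule eventually_gt_at_top)
      then show "\<forall>\<^sub>F d in sequentially. fps_nth (Y d) i = fps_nth x i"
        by (rule eventually_mono) (rule Y(2))
    qed
    then show "x \<in> S" using cl Y(1) closed_sequentially by blast
  qed
next
  assume *: "\<forall>x. (\<forall>d. \<exists>y\<in>S. \<forall>i<d. fps_nth y i = fps_nth x i) \<longrightarrow> x \<in> S"
  show "closed S"
    unfolding closed_def open_fps_iff
  proof
    fix x assume "x \<in> - S"
    then have "\<not> (\<forall>d. \<exists>y\<in>S. \<forall>i<d. fps_nth y i = fps_nth x i)"
      using *[rule_format, of x] by (metis ComplD)
    then obtain d where d: "\<not> (\<exists>y\<in>S. \<forall>i<d. fps_nth y i = fps_nth x i)" by blast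
    show "\<exists>d. {y. fps_cutoff d y = fps_cutoff d x} \<subseteq> - S"
    proof (intro exI[of _ d] subsetI ComplI)
      fix y assume "y \<in> {y. fps_cutoff d y = fps_cutoff d x}" "y \<in> S"
      then show False using d by (auto simp: fps_cutoff_eq_fps_cutoff_iff)
    qed
  qed
qed

lemma closed_hserI:
  assumes "\<And>x. (\<And>d. \<exists>y\<in>S. \<exists>z. x = y + hX ^ d \<star> z) \<Longrightarrow> x \<in> S"
  shows "closed S"
  unfolding closed_fps_iff
proof (intro allI impI)
  fix x assume x: "\<forall>d. \<exists>y\<in>S. \<forall>i<d. fps_nth y i = fps_nth x i"
  show "x \<in> S"
  proof (rule assms)
    fix d
    obtain y where y: "y \<in> S" "\<forall>i<d. fps_nth y i = fps_nth x i" using x by blast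
    then have "\<forall>i<d. fps_nth (x - y) i = 0" by simp
    then obtain z where "x - y = hX ^ d \<star> z" by (metis hX_power_smul_iff)
    then have "x = y + hX ^ d \<star> z" by (simp add: algebra_simps)
    then show "\<exists>y\<in>S. \<exists>z. x = y + hX ^ d \<star> z" using y(1) by blast
  qed
qed

lemma closed_hserD:
  assumes "closed S" and "\<And>d. \<exists>y\<in>S. \<exists>z. x = y + hX ^ d \<star> z"
  shows "x \<in> S"
proof -
  have "\<exists>y\<in>S. \<forall>i<d. fps_nth y i = fps_nth x i" for d
  proof -
    obtain y z where "y \<in> S" "x = y + hX ^ d \<star> z" using assms(2) by blast
    then show ?thesis by (intro bexI[of _ y]) (simp_all add: hX_power_smul_nth)
  qed
  then show ?thesis using assms(1) unfolding closed_fps_iff by blast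
qed

lemma hmoduleI:
  assumes "0 \<in> S" "\<And>x y. x \<in> S \<Longrightarrow> y \<in> S \<Longrightarrow> x + y \<in> S" "\<And>c x. x \<in> S \<Longrightarrow> c \<star> x \<in> S"
  shows "hmodule S"
proof -
  have "x - y \<in> S" if "x \<in> S" "y \<in> S" for x y
    using assms(2)[OF that(1) assms(3)[OF that(2), of "-1"]] by simp
  then show ?thesis
    using assms by (simp add: hmodule_def additive_def smul_def)
qed

lemma additive_uminus: "additive S \<Longrightarrow> x \<in> S \<Longrightarrow> - x \<in> S"
  unfolding additive_def by (metis diff_0)

lemma additive_add: "additive S \<Longrightarrow> x \<in> S \<Longrightarrow> y \<in> S \<Longrightarrow> x + y \<in> S"
  using additive_uminus unfolding additive_def by (metis diff_minus_eq_add)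

lemma hmodule_0: "hmodule S \<Longrightarrow> 0 \<in> S"
  by (simp add: hmodule_def additive_def)

lemma hmodule_add: "hmodule S \<Longrightarrow> x \<in> S \<Longrightarrow> y \<in> S \<Longrightarrow> x + y \<in> S"
  by (simp add: hmodule_def additive_add)

lemma hmodule_diff: "hmodule S \<Longrightarrow> x \<in> S \<Longrightarrow> y \<in> S \<Longrightarrow> x - y \<in> S"
  by (simp add: hmodule_def additive_def)

lemma hmodule_uminus: "hmodule S \<Longrightarrow> x \<in> S \<Longrightarrow> - x \<in> S"
  by (simp add: hmodule_def additive_uminus)

lemma hmodule_smul: "hmodule S \<Longrightarrow> x \<in> S \<Longrightarrow> c \<star> x \<in> S"
  by (simp add: hmodule_def smul_def)

lemma hmodule_sum: "hmodule S \<Longrightarrow> (\<And>i. i \<in> A \<Longrightarrow> f i \<in> S) \<Longrightarrow> sum f A \<in> S"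
  by (induction A rule: infinite_finite_induct) (auto intro: hmodule_0 hmodule_add)

lemma hmodule_cong: "hmodule S \<Longrightarrow> x - y \<in> S \<Longrightarrow> y \<in> S \<Longrightarrow> x \<in> S"
  using hmodule_add[of S "x - y" y] by simp

lemma hmodule_Inter: "(\<And>S. S \<in> T \<Longrightarrow> hmodule S) \<Longrightarrow> hmodule (\<Inter>T)"
  by (intro hmoduleI) (auto intro: hmodule_0 hmodule_add hmodule_smul)

lemma hmodule_hull: "hmodule (hmodule hull B)"
  by (rule hull_in) (simp add: hmodule_Inter)

lemma closed_hmodule_coeffI:
  assumes "hmodule S" "closed S" "\<And>m. fps_const (fps_nth x m) \<in> S"
  shows "x \<in> S"
proof (rule closed_hserD[OF assms(2)])
  fix d
  show "\<exists>y\<in>S. \<exists>z. x = y + hX ^ d \<star> z"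
    using hser_expand[of x d] assms(1,3) by (metis (no_types, lifting) hmodule_smul hmodule_sum)
qed

text \<open>A series is the limit of its truncations, and their coefficients are finite combinations
  of basis vectors. This is the induction principle behind all reductions to words or
  monomials.\<close>

lemma closed_hmodule_UNIV:
  assumes "hmodule S" "closed S" "\<And>k. bas k \<in> S"
  shows "x \<in> S"
proof (rule closed_hmodule_coeffI[OF assms(1,2)])
  fix m
  show "fps_const (fps_nth x m) \<in> S"
    by (subst fps_const_sum_bas) (intro hmodule_sum hmodule_smul assms)
qed

text \<open>Linearity over C[[h]] forces h-adic continuity, since
  \<open>f (hX ^ d \<star> x) = hX ^ d \<star> f x\<close> preserves congruences modulo h^d. Such
  maps are therefore determined on the basis.\<close>

definition hlin :: "(('k::monoid_add) hser \<Rightarrow> ('l::monoid_add) hser) \<Rightarrow> bool" where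
  "hlin f \<longleftrightarrow> (\<forall>x y. f (x + y) = f x + f y) \<and> (\<forall>c x. f (c \<star> x) = c \<star> f x)"

lemma hlinI: "(\<And>x y. f (x + y) = f x + f y) \<Longrightarrow> (\<And>c x. f (c \<star> x) = c \<star> f x) \<Longrightarrow> hlin f"
  by (simp add: hlin_def)

lemma hlin_add: "hlin f \<Longrightarrow> f (x + y) = f x + f y"
  and hlin_smul: "hlin f \<Longrightarrow> f (c \<star> x) = c \<star> f x"
  by (simp_all add: hlin_def)

lemma hlin_0: "hlin f \<Longrightarrow> f 0 = 0"
  using hlin_smul[of f 0 0] by simp

lemma hlin_uminus: "hlin f \<Longrightarrow> f (- x) = - f x"
  using hlin_smul[of f "-1" x] by simp

lemma hlin_diff: "hlin f \<Longrightarrow> f (x - y) = f x - f y"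
  using hlin_add[of f x "- y"] by (simp add: hlin_uminus)

lemma hlin_sum: "hlin f \<Longrightarrow> f (sum g A) = (\<Sum>i\<in>A. f (g i))"
  by (induction A rule: infinite_finite_induct) (simp_all add: hlin_0 hlin_add)

lemma hlin_id: "hlin (\<lambda>x. x)"
  by (simp add: hlin_def)

lemma hlin_comp: "hlin f \<Longrightarrow> hlin g \<Longrightarrow> hlin (\<lambda>x. f (g x))"
  by (simp add: hlin_def)

lemma hlin_lmult: "hlin (\<lambda>x. u * x)"
  and hlin_rmult: "hlin (\<lambda>x. x * u)"
  by (simp_all add: hlin_def distrib_left distrib_right)

lemma hlin_smul_fun: "hlin f \<Longrightarrow> hlin (\<lambda>x. c \<star> f x)"
  by (simp add: hlin_def hs.scale_right_distrib mult.commute)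

lemma hlin_add_fun: "hlin f \<Longrightarrow> hlin g \<Longrightarrow> hlin (\<lambda>x. f x + g x)"
  and hlin_diff_fun: "hlin f \<Longrightarrow> hlin g \<Longrightarrow> hlin (\<lambda>x. f x - g x)"
  by (simp_all add: hlin_def hs.scale_right_distrib hs.scale_right_diff_distrib)

lemma hlin_zero_fun: "hlin (\<lambda>x. 0)"
  by (simp add: hlin_def)

lemma hmodule_vimage: "hlin f \<Longrightarrow> hmodule S \<Longrightarrow> hmodule {x. f x \<in> S}"
  by (rule hmoduleI) (simp_all add: hlin_0 hlin_add hlin_smul hmodule_0 hmodule_add hmodule_smul)

lemma closed_vimage_hlin: "hlin f \<Longrightarrow> closed S \<Longrightarrow> closed {x. f x \<in> S}"
proof (rule closed_hserI)
  fix x assume f: "hlin f" and S: "closed S" and x: "\<And>d. \<exists>y\<in>{x. f x \<in> S}. \<exists>z. x = y + hX ^ d \<star> z"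
  have "f x \<in> S"
  proof (rule closed_hserD[OF S])
    fix d
    obtain y z where "f y \<in> S" "x = y + hX ^ d \<star> z" using x[of d] by auto
    then show "\<exists>y\<in>S. \<exists>z. f x = y + hX ^ d \<star> z"
      by (metis f hlin_add hlin_smul)
  qed
  then show "x \<in> {x. f x \<in> S}" by simp
qed

lemma hmodule_zero: "hmodule ({0} :: 'k::monoid_add hser set)" and closed_zero: "closed ({0} :: 'k::monoid_add hser set)"
  by (rule hmoduleI; simp) (rule closed_singleton)

lemma hlin_zeroI:
  assumes "hlin f" "\<And>k. f (bas k) = 0"
  shows "f x = 0"
  using closed_hmodule_UNIV[OF hmodule_vimage[OF assms(1) hmodule_zero]
    closed_vimage_hlin[OF assms(1) closed_zero], of x] assms(2) by simp

lemma hlin_eqI: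
  assumes "hlin f" "hlin g" "\<And>k. f (bas k) = g (bas k)"
  shows "f x = g x"
  using hlin_zeroI[OF hlin_diff_fun[OF assms(1,2)], of x] assms(3) by simp

lemma hlin_nth:
  assumes "hlin f"
  shows "fps_nth (f x) m = (\<Sum>i\<le>m. fps_nth (f (fps_const (fps_nth x i))) (m - i))"
proof -
  have "f x = (\<Sum>i<Suc m. hX ^ i \<star> f (fps_const (fps_nth x i))) + hX ^ Suc m \<star> f (fps_shift (Suc m) x)"
    by (subst hser_expand[of x "Suc m"]) (simp only: hlin_add[OF assms] hlin_sum[OF assms] hlin_smul[OF assms])
  then have "fps_nth (f x) m = (\<Sum>i<Suc m. fps_nth (hX ^ i \<star> f (fps_const (fps_nth x i))) m)"
    by (simp only: fps_add_nth fps_sum_nth hX_power_smul_nth) simp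
  also have "\<dots> = (\<Sum>i\<le>m. fps_nth (f (fps_const (fps_nth x i))) (m - i))"
    by (rule sum.cong) (auto simp: hX_power_smul_nth)
  finally show ?thesis .
qed

text \<open>The continuous linear extension of a map given on the basis. Order i of the argument is
  combined with order m - i of the values, which leaves a finite sum in every order.\<close>

definition ext :: "('k \<Rightarrow> ('l::monoid_add) hser) \<Rightarrow> ('k::monoid_add) hser \<Rightarrow> 'l hser" where
  "ext f x = Abs_fps (\<lambda>m. \<Sum>i\<le>m. \<Sum>k\<in>keys (fps_nth x i).
     single 0 (lookup (fps_nth x i) k) * fps_nth (f k) (m - i))"

text \<open>Keys may be lost by cancellation in a sum; a common larger index set makes the inner sum
  additive.\<close>

lemma ext_inner_superset:
  assumes "finite K" "keys p \<subseteq> K"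
  shows "(\<Sum>k\<in>keys p. single 0 (lookup p k) * g k)
    = (\<Sum>k\<in>K. single 0 (lookup p k) * (g k :: 'l::monoid_add \<Rightarrow>\<^sub>0 complex))"
  by (rule sum.mono_neutral_left) (use assms in \<open>auto simp: in_keys_iff\<close>)

lemma ext_inner_add:
  fixes g :: "'k \<Rightarrow> 'l::monoid_add \<Rightarrow>\<^sub>0 complex"
  shows "(\<Sum>k\<in>keys (p + r). single 0 (lookup (p + r) k) * g k)
    = (\<Sum>k\<in>keys p. single 0 (lookup p k) * g k)
      + (\<Sum>k\<in>keys r. single 0 (lookup r k) * g k)"
proof -
  define K where "K = keys p \<union> keys r"
  have K: "finite K" "keys p \<subseteq> K" "keys r \<subseteq> K" "keys (p + r) \<subseteq> K"
    using keys_add[of p r] by (auto simp: K_def)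
  show ?thesis
    unfolding ext_inner_superset[OF K(1,2)] ext_inner_superset[OF K(1,3)] ext_inner_superset[OF K(1,4)]
    by (simp add: lookup_add single_add distrib_right sum.distrib)
qed

lemma ext_inner_smul:
  fixes g :: "'k::monoid_add \<Rightarrow> 'l::monoid_add \<Rightarrow>\<^sub>0 complex"
  shows "(\<Sum>k\<in>keys (single 0 a * p).
      single 0 (lookup (single 0 a * p) k) * g k)
    = single 0 a * (\<Sum>k\<in>keys p. single 0 (lookup p k) * g k)"
proof -
  have K: "keys (single 0 a * p) \<subseteq> keys p"
    by (auto simp: in_keys_iff lookup_single_0_mult)
  have s: "single 0 (a * b) = single (0::'l) a * single 0 b"
    for b :: complex by (simp add: mult_single)
  show ?thesis
    unfolding ext_inner_superset[OF finite_keys K]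
    by (simp add: lookup_single_0_mult sum_distrib_left s mult.assoc)
qed

lemma ext_inner_sum:
  fixes g :: "'k::monoid_add \<Rightarrow> 'l::monoid_add \<Rightarrow>\<^sub>0 complex"
  shows "(\<Sum>k\<in>keys (\<Sum>j\<in>A. p j). single 0 (lookup (\<Sum>j\<in>A. p j) k) * g k)
    = (\<Sum>j\<in>A. \<Sum>k\<in>keys (p j). single 0 (lookup (p j) k) * g k)"
proof (induction A rule: infinite_finite_induct)
  case (insert a A)
  then show ?case
    by (simp only: sum.insert[OF insert.hyps] ext_inner_add)
qed simp_all

lemma hlin_ext: "hlin (ext f)"
proof (rule hlinI)
  fix x y
  show "ext f (x + y) = ext f x + ext f y"
    by (rule fps_ext) (simp add: ext_def ext_inner_add sum.distrib)
next
  fix c x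
  show "ext f (c \<star> x) = c \<star> ext f x"
  proof (rule fps_ext)
    fix m
    define h where "h = (\<lambda>i r. \<Sum>k\<in>keys (fps_nth x i).
      single 0 (lookup (fps_nth x i) k) * fps_nth (f k) r)"
    define s where "s j = single (0::'b) (fps_nth c j)" for j
    have n: "fps_nth (c \<star> x) i = (\<Sum>j\<le>i. single 0 (fps_nth c j) * fps_nth x (i - j))" for i
      by (simp add: smul_def fps_mult_nth atLeast0AtMost)
    \<comment> \<open>Both sides sum over the triples of orders with total m: of the scalar, of the
      argument, and of the image of a basis vector.\<close>
    have "fps_nth (ext f (c \<star> x)) m = (\<Sum>i\<le>m. \<Sum>j\<le>i. s j * h (i - j) (m - i))"
      unfolding ext_def fps_nth_Abs_fps n ext_inner_sum ext_inner_smul h_def s_def ..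
    also have "\<dots> = (\<Sum>(i, j)\<in>(SIGMA i:{..m}. {..i}). s j * h (i - j) (m - i))"
      by (rule sum.Sigma) auto
    also have "\<dots> = (\<Sum>(j, i)\<in>(SIGMA j:{..m}. {..m - j}). s j * h i (m - j - i))"
      by (rule sum.reindex_bij_witness[of _ "\<lambda>(j, i). (j + i, j)" "\<lambda>(i, j). (j, i - j)"]) auto
    also have "\<dots> = (\<Sum>j\<le>m. \<Sum>i\<le>m - j. s j * h i (m - j - i))"
      by (rule sum.Sigma[symmetric]) auto
    also have "\<dots> = fps_nth (c \<star> ext f x) m"
      by (simp add: ext_def smul_def fps_mult_nth atLeast0AtMost sum_distrib_left h_def s_def)
    finally show "fps_nth (ext f (c \<star> x)) m = fps_nth (c \<star> ext f x) m" .
  qed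
qed

lemma ext_bas [simp]: "ext f (bas k) = f k"
proof (rule fps_ext)
  fix m
  have "fps_nth (ext f (bas k)) m = (\<Sum>i\<le>m. if i = 0 then fps_nth (f k) m else 0)"
    unfolding ext_def fps_nth_Abs_fps by (rule sum.cong) (auto simp: bas_def)
  then show "fps_nth (ext f (bas k)) m = fps_nth (f k) m" by simp
qed

lemma bas_mult: "bas k * bas l = bas (k + l)"
  by (simp add: bas_def mult_single)

lemma bas_0: "bas 0 = 1"
  by (simp add: bas_def)

section \<open>Commutation of root vectors\<close>

lemma left_ideal_hmodule: "left_ideal S \<Longrightarrow> hmodule S"
  by (simp add: left_ideal_def hmodule_def)

lemma two_sided_hmodule: "two_sided_ideal S \<Longrightarrow> hmodule S"
  by (simp add: two_sided_ideal_def left_ideal_hmodule)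

lemma ideal_lmult: "two_sided_ideal S \<Longrightarrow> x \<in> S \<Longrightarrow> u * x \<in> S"
  and ideal_rmult: "two_sided_ideal S \<Longrightarrow> x \<in> S \<Longrightarrow> x * u \<in> S"
  by (simp_all add: two_sided_ideal_def left_ideal_def)

lemma left_ideal_Inter: "(\<And>S. S \<in> T \<Longrightarrow> left_ideal S) \<Longrightarrow> left_ideal (\<Inter>T)"
  by (fastforce simp: left_ideal_def additive_def)

lemma two_sided_ideal_Inter: "(\<And>S. S \<in> T \<Longrightarrow> two_sided_ideal S) \<Longrightarrow> two_sided_ideal (\<Inter>T)"
  by (fastforce simp: two_sided_ideal_def left_ideal_def additive_def)

lemma rel_ideal_ideal: "two_sided_ideal (rel_ideal n)"
  and rel_ideal_closed: "closed (rel_ideal n)"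
proof -
  have "two_sided_ideal (rel_ideal n) \<and> closed (rel_ideal n)"
    unfolding rel_ideal_def
    by (rule hull_in) (auto intro!: two_sided_ideal_Inter closed_Inter)
  then show "two_sided_ideal (rel_ideal n)" "closed (rel_ideal n)" by blast+
qed

lemma relators_rel_ideal: "r \<in> relators n \<Longrightarrow> r \<in> rel_ideal n"
  unfolding rel_ideal_def by (rule hull_inc)

lemma qpw_inverse [simp]: "qpw (- 1) \<star> qpw 1 \<star> x = x" "qpw 1 \<star> qpw (- 1) \<star> x = x"
  by (simp_all flip: fps_exp_add_mult)

lemma qpw_0 [simp]: "qpw 0 = 1"
  by (rule fps_ext) simp

lemma qcomm_conv: "qcomm a x y = x * y - a \<star> (y * x)"
  by (simp add: qcomm_def smul_def)

lemma serre_conv: "serre x y = x * x * y - qpw 1 \<star> (x * y * x) - qpw (- 1) \<star> (x * y * x) + y * x * x"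
  by (simp add: serre_def hs.scale_left_distrib flip: smul_def)

lemmas hser_expand_simps = distrib_left distrib_right left_diff_distrib right_diff_distrib
  hs.scale_right_distrib hs.scale_right_diff_distrib hs.scale_left_distrib mult.assoc

section \<open>Brackets and Serre elements modulo a two-sided ideal\<close>

locale ideal =
  fixes I :: "alg set"
  assumes ideal: "two_sided_ideal I"
begin

lemma hmod: "hmodule I"
  by (rule two_sided_hmodule) (rule ideal)

lemmas I_add = hmodule_add[OF hmod] and I_diff = hmodule_diff[OF hmod]
  and I_smul = hmodule_smul[OF hmod] and I_0 = hmodule_0[OF hmod]
  and I_uminus = hmodule_uminus[OF hmod]
  and I_l = ideal_lmult[OF ideal] and I_r = ideal_rmult[OF ideal]

lemma cong_sym: "x - y \<in> I \<Longrightarrow> y - x \<in> I"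
  using I_uminus[of "x - y"] by simp

lemma cong_trans: "x - y \<in> I \<Longrightarrow> y - z \<in> I \<Longrightarrow> x - z \<in> I"
  using I_add[of "x - y" "y - z"] by simp

lemma cong_mult: "x - x' \<in> I \<Longrightarrow> y - y' \<in> I \<Longrightarrow> x * y - x' * y' \<in> I"
proof -
  assume "x - x' \<in> I" "y - y' \<in> I"
  then have "(x - x') * y + x' * (y - y') \<in> I" by (intro I_add I_l I_r)
  then show ?thesis by (simp add: algebra_simps)
qed

lemma cong_diff: "x - x' \<in> I \<Longrightarrow> y - y' \<in> I \<Longrightarrow> (x - y) - (x' - y') \<in> I"
  using I_diff[of "x - x'" "y - y'"] by (simp add: algebra_simps)

lemma cong_smul: "x - x' \<in> I \<Longrightarrow> c \<star> x - c \<star> x' \<in> I"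
  using I_smul[of "x - x'" c] by (simp add: hs.scale_right_diff_distrib)

lemma cong_qcomm: "x - x' \<in> I \<Longrightarrow> y - y' \<in> I \<Longrightarrow> qcomm a x y - qcomm a x' y' \<in> I"
  unfolding qcomm_conv by (intro cong_diff cong_mult cong_smul)

lemma comm_qcomm:
  assumes "a * b - b * a \<in> I" "a * c - c * a \<in> I"
  shows "a * qcomm p b c - qcomm p b c * a \<in> I"
proof -
  have "a * qcomm p b c - qcomm p b c * a
      = (a * b - b * a) * c + b * (a * c - c * a) - p \<star> ((a * c - c * a) * b + c * (a * b - b * a))"
    by (simp add: qcomm_conv hser_expand_simps)
  then show ?thesis
    by (auto intro!: I_add I_diff I_smul I_l[OF assms(1)] I_l[OF assms(2)] I_r[OF assms(1)] I_r[OF assms(2)])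
qed

text \<open>In the difference only terms containing the commutator of a and c survive. This is how
  brackets nested from the left and from the right come to represent the same root vector.\<close>

lemma qcomm_assoc:
  assumes "a * c - c * a \<in> I"
  shows "qcomm p a (qcomm p b c) - qcomm p (qcomm p a b) c \<in> I"
proof -
  have "qcomm p a (qcomm p b c) - qcomm p (qcomm p a b) c
      = p \<star> (b * (a * c - c * a) - (a * c - c * a) * b)"
    by (simp add: qcomm_conv hser_expand_simps)
  then show ?thesis by (auto intro!: I_diff I_smul I_l[OF assms] I_r[OF assms])
qed

text \<open>\<open>serre A\<close> is linear in its second argument and passes over a factor that
  commutes with A, so q-brackets with such a factor inherit the Serre relation.\<close>

lemma serre_qcomm:
  assumes "serre A B \<in> I" "A * C - C * A \<in> I"
  shows "serre A (qcomm p B C) \<in> I" "serre A (qcomm p C B) \<in> I"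
proof -
  define K where "K = A * C - C * A"
  have K: "K \<in> I" using assms by (simp add: K_def)
  have 1: "serre A (B * C) = serre A B * C + qpw 1 \<star> (A * B * K) + qpw (- 1) \<star> (A * B * K) - B * A * K - B * K * A"
    by (simp add: serre_conv K_def hser_expand_simps)
  have 2: "serre A (C * B) = C * serre A B + A * K * B + K * A * B - qpw 1 \<star> (K * B * A) - qpw (- 1) \<star> (K * B * A)"
    by (simp add: serre_conv K_def hser_expand_simps)
  have mem: "serre A (B * C) \<in> I" "serre A (C * B) \<in> I"
    unfolding 1 2 by (auto intro!: I_add I_diff I_smul intro: I_l I_r K assms(1))
  have lin: "serre A (x - p \<star> y) = serre A x - p \<star> serre A y" for x y
    by (simp add: serre_conv hser_expand_simps mult.commute[of p])
  show "serre A (qcomm p B C) \<in> I" "serre A (qcomm p C B) \<in> I"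
    unfolding qcomm_conv lin by (intro I_diff I_smul mem)+
qed

text \<open>The constant term of q + q^-1 is 2, so this scalar is a unit of C[[h]].\<close>

lemma qpw_sum_cancel:
  assumes "(qpw 1 + qpw (- 1)) \<star> x \<in> I" shows "x \<in> I"
proof -
  have "inverse (qpw 1 + qpw (- 1)) * (qpw 1 + qpw (- 1)) = (1 :: complex fps)"
    by (rule inverse_mult_eq_1) simp
  then have "inverse (qpw 1 + qpw (- 1)) \<star> (qpw 1 + qpw (- 1)) \<star> x = x" by simp
  then show ?thesis using I_smul[OF assms] by metis
qed

text \<open>
  The reason why a simple root vector commutes with a longer one that contains it in the middle:
  twice (in the q-sense) the commutator is an explicit combination of Serre elements.
\<close>

lemma middle_comm:
  assumes "serre A B \<in> I" "serre A C \<in> I" "B * C - C * B \<in> I"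
  defines "p \<equiv> qpw (- 1)"
  shows "A * qcomm p B (qcomm p A C) - qcomm p B (qcomm p A C) * A \<in> I"
    and "A * qcomm p (qcomm p C A) B - qcomm p (qcomm p C A) B * A \<in> I"
proof -
  define K where "K = B * C - C * B"
  have K: "K \<in> I" using assms by (simp add: K_def)
  let ?Y = "qcomm p B (qcomm p A C)" and ?Z = "qcomm p (qcomm p C A) B"
  have "(qpw 1 + qpw (- 1)) \<star> (A * ?Y - ?Y * A) =
      B * serre A C - serre A B * C - p \<star> p \<star> (serre A C * B) + p \<star> p \<star> (C * serre A B)
      + A * A * K + p \<star> p \<star> (K * A * A) - A * K * A - p \<star> p \<star> (A * K * A)"
    by (simp add: qcomm_conv serre_conv K_def p_def hser_expand_simps hs.scale_scale[symmetric] del: hs.scale_scale)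
  moreover have "\<dots> \<in> I"
    by (auto intro!: I_add I_diff I_smul intro: I_l I_r K assms(1,2))
  ultimately show "A * ?Y - ?Y * A \<in> I" using qpw_sum_cancel by metis
  have "(qpw 1 + qpw (- 1)) \<star> (A * ?Z - ?Z * A) =
      C * serre A B - serre A C * B + p \<star> p \<star> (B * serre A C) - p \<star> p \<star> (serre A B * C)
      + K * A * A + p \<star> p \<star> (A * A * K) - A * K * A - p \<star> p \<star> (A * K * A)"
    by (simp add: qcomm_conv serre_conv K_def p_def hser_expand_simps hs.scale_scale[symmetric] del: hs.scale_scale)
  moreover have "\<dots> \<in> I"
    by (auto intro!: I_add I_diff I_smul intro: I_l I_r K assms(1,2))
  ultimately show "A * ?Z - ?Z * A \<in> I" using qpw_sum_cancel by metis
qed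

end

text \<open>Both recursions lengthen a root by its last simple root, whereas the bracket in
  \<open>xroot\<close> starts from the last generator and grows towards the first. With a common
  direction one induction treats both kinds. The value at 0 is a dummy.\<close>

primrec yv :: "(nat \<Rightarrow> alg) \<Rightarrow> nat \<Rightarrow> alg" where
  "yv g 0 = g 1"
| "yv g (Suc i) = (if i = 0 then g 1 else qcomm (qpw (- 1)) (g (Suc i)) (yv g i))"

primrec xv :: "(nat \<Rightarrow> alg) \<Rightarrow> nat \<Rightarrow> alg" where
  "xv g 0 = g 1"
| "xv g (Suc i) = (if i = 0 then g 1 else qcomm (qpw (- 1)) (xv g i) (g (Suc i)))"

text \<open>Abstracting from e and f lets the same relations serve both nilpotent parts, as well as
  the lowering generators of either module.\<close>

locale serre_family = ideal I for I +
  fixes n :: nat and g :: "nat \<Rightarrow> alg"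
  assumes g_comm: "\<And>i j. i \<in> {1..n} \<Longrightarrow> j \<in> {1..n} \<Longrightarrow> i + 1 < j \<or> j + 1 < i \<Longrightarrow> g i * g j - g j * g i \<in> I"
    and g_serre: "\<And>i j. i \<in> {1..n} \<Longrightarrow> j \<in> {1..n} \<Longrightarrow> j = i + 1 \<or> i = j + 1 \<Longrightarrow> serre (g i) (g j) \<in> I"
begin

lemma yv_1: "yv g 1 = g 1" and xv_1: "xv g 1 = g 1"
  by simp_all

lemma yv_step: "1 \<le> i \<Longrightarrow> yv g (Suc i) = qcomm (qpw (- 1)) (g (Suc i)) (yv g i)"
  and xv_step: "1 \<le> i \<Longrightarrow> xv g (Suc i) = qcomm (qpw (- 1)) (xv g i) (g (Suc i))"
  by simp_all

lemma far_comm: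
  assumes "1 \<le> i" "i + 1 < j" "j \<le> n"
  shows "g j * yv g i - yv g i * g j \<in> I" "g j * xv g i - xv g i * g j \<in> I"
proof -
  have "(g j * yv g i - yv g i * g j \<in> I) \<and> (g j * xv g i - xv g i * g j \<in> I)"
    using assms(1,2)
  proof (induction i rule: dec_induct)
    case base
    then show ?case using g_comm[of j 1] assms by (auto simp: yv_1 xv_1)
  next
    case (step i)
    then have c: "g j * g (Suc i) - g (Suc i) * g j \<in> I"
      using g_comm[of j "Suc i"] assms by auto
    show ?case
      unfolding yv_step[OF step(1)] xv_step[OF step(1)]
      by (intro conjI comm_qcomm c) (use step in auto)
  qed
  then show "g j * yv g i - yv g i * g j \<in> I" "g j * xv g i - xv g i * g j \<in> I" by blast+
qed

text \<open>The root vector of index i arises from \<open>g i\<close> by a bracket with a shorter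
  one, which commutes with \<open>g (Suc i)\<close>; so the relation between two neighbouring
  generators extends by \<open>serre_qcomm\<close>.\<close>

lemma serre_root:
  assumes "1 \<le> i" "i < n"
  shows "serre (g (Suc i)) (yv g i) \<in> I" "serre (g (Suc i)) (xv g i) \<in> I"
proof (atomize(full), cases "i = 1")
  case True
  then show "serre (g (Suc i)) (yv g i) \<in> I \<and> serre (g (Suc i)) (xv g i) \<in> I"
    using g_serre[of 2 1] assms by (simp add: numeral_2_eq_2)
next
  case False
  then obtain k where k: "i = Suc k" "1 \<le> k" using assms by (cases i) auto
  have s: "serre (g (Suc i)) (g i) \<in> I" using g_serre[of "Suc i" i] assms by auto
  show "serre (g (Suc i)) (yv g i) \<in> I \<and> serre (g (Suc i)) (xv g i) \<in> I"
    unfolding k(1) yv_step[OF k(2)] xv_step[OF k(2)]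
    using far_comm[of k "Suc i"] k assms s by (intro conjI serre_qcomm(1) serre_qcomm(2)) auto
qed

text \<open>Expanding the outer bracket of the root vector yields exactly the Serre element of
  \<open>g i\<close> and the root vector one step shorter.\<close>

lemma top_comm:
  assumes "2 \<le> i" "i \<le> n"
  shows "g i * yv g i - qpw 1 \<star> (yv g i * g i) \<in> I" "xv g i * g i - qpw 1 \<star> (g i * xv g i) \<in> I"
proof -
  obtain k where k: "i = Suc k" "1 \<le> k" using assms by (cases i) auto
  have "g i * yv g i - qpw 1 \<star> (yv g i * g i) = serre (g i) (yv g k)"
    unfolding k yv_step[OF k(2)] by (simp add: qcomm_conv serre_conv hser_expand_simps del: yv.simps hs.scale_scale)
  moreover have "xv g i * g i - qpw 1 \<star> (g i * xv g i) = serre (g i) (xv g k)"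
    unfolding k xv_step[OF k(2)] by (simp add: qcomm_conv serre_conv hser_expand_simps del: xv.simps hs.scale_scale)
  ultimately show "g i * yv g i - qpw 1 \<star> (yv g i * g i) \<in> I" "xv g i * g i - qpw 1 \<star> (g i * xv g i) \<in> I"
    using serre_root[of k] k assms by auto
qed

text \<open>When the root first extends beyond j this is \<open>middle_comm\<close>. All generators
  added later are far from j and commute with \<open>g j\<close>.\<close>

lemma inner_comm:
  assumes "2 \<le> j" "j < i" "i \<le> n"
  shows "g j * yv g i - yv g i * g j \<in> I" "g j * xv g i - xv g i * g j \<in> I"
proof -
  obtain k where k: "j = Suc k" "1 \<le> k" using assms by (cases j) auto
  have "Suc j \<le> i" using assms by simp
  then have "(g j * yv g i - yv g i * g j \<in> I) \<and> (g j * xv g i - xv g i * g j \<in> I)"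
    using assms(3)
  proof (induction i rule: dec_induct)
    case base
    have s: "serre (g j) (g (Suc j)) \<in> I" using g_serre[of j "Suc j"] assms base by auto
    have f: "g (Suc j) * yv g k - yv g k * g (Suc j) \<in> I" "g (Suc j) * xv g k - xv g k * g (Suc j) \<in> I"
      using far_comm[of k "Suc j"] k base by auto
    have y: "yv g (Suc j) = qcomm (qpw (- 1)) (g (Suc j)) (qcomm (qpw (- 1)) (g j) (yv g k))"
      and x: "xv g (Suc j) = qcomm (qpw (- 1)) (qcomm (qpw (- 1)) (xv g k) (g j)) (g (Suc j))"
      using k yv_step[of k] yv_step[of j] xv_step[of k] xv_step[of j] by simp_all
    have "serre (g j) (yv g k) \<in> I" "serre (g j) (xv g k) \<in> I"
      using serre_root[of k] k base by auto
    then show ?case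
      unfolding y x by (intro conjI middle_comm s f)
  next
    case (step i)
    then have i1: "1 \<le> i" by simp
    have c: "g j * g (Suc i) - g (Suc i) * g j \<in> I"
      using g_comm[of j "Suc i"] assms step by auto
    show ?case
      unfolding yv_step[OF i1] xv_step[OF i1]
      by (intro conjI comm_qcomm c) (use step in auto)
  qed
  then show "g j * yv g i - yv g i * g j \<in> I" "g j * xv g i - xv g i * g j \<in> I" by blast+
qed

text \<open>Induction on the shorter root, with an inner induction on the longer one for i = 1. In
  the outer step the generator added to the shorter root lies inside the longer one, so
  \<open>inner_comm\<close> lets it pass.\<close>

lemma yv_qcomm:
  assumes "1 \<le> i" "i < j" "j \<le> n"
  shows "yv g j * yv g i - qpw 1 \<star> (yv g i * yv g j) \<in> I"
  using assms(1,2)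
proof (induction i rule: dec_induct)
  case base
  then have "Suc 1 \<le> j" by simp
  then show ?case using assms(3)
  proof (induction j rule: dec_induct)
    case base
    have "yv g (Suc 1) * yv g 1 - qpw 1 \<star> (yv g 1 * yv g (Suc 1)) = serre (g 1) (g (Suc 1))"
      by (simp add: qcomm_conv serre_conv hser_expand_simps del: hs.scale_scale)
    then show ?case using g_serre[of 1 "Suc 1"] base by simp
  next
    case (step j)
    define K where "K = g (Suc j) * g 1 - g 1 * g (Suc j)"
    have K: "K \<in> I" using g_comm[of "Suc j" 1] step K_def by auto
    define L where "L = yv g j * yv g 1 - qpw 1 \<star> (yv g 1 * yv g j)"
    have L: "L \<in> I" using step L_def by auto
    let ?a = "g (Suc j)" and ?b = "yv g j" and ?p = "qpw (- 1)"
    have "1 \<le> j" using step by simp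
    then have "yv g (Suc j) * yv g 1 - qpw 1 \<star> (yv g 1 * yv g (Suc j))
        = ?a * L + qpw 1 \<star> (K * ?b) - ?p \<star> (L * ?a) - ?p \<star> (?b * K)"
      by (simp add: yv_step yv_1[unfolded One_nat_def] K_def L_def qcomm_conv hser_expand_simps del: yv.simps hs.scale_scale)
    then show ?case by (auto intro!: I_add I_diff I_smul I_l[OF L] I_r[OF L] I_l[OF K] I_r[OF K])
  qed
next
  case (step i)
  define K where "K = g (Suc i) * yv g j - yv g j * g (Suc i)"
  have K: "K \<in> I" using inner_comm[of "Suc i" j] step assms K_def by auto
  define L where "L = yv g j * yv g i - qpw 1 \<star> (yv g i * yv g j)"
  have L: "L \<in> I" using step L_def by auto
  let ?a = "g (Suc i)" and ?b = "yv g i" and ?p = "qpw (- 1)"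
  have "yv g j * yv g (Suc i) - qpw 1 \<star> (yv g (Suc i) * yv g j)
      = ?a * L - K * ?b - ?p \<star> (L * ?a) + ?b * K"
    unfolding yv_step[OF step(1)]
    by (simp add: K_def L_def qcomm_conv hser_expand_simps del: yv.simps hs.scale_scale)
  then show ?case by (auto intro!: I_add I_diff I_smul I_l[OF L] I_r[OF L] I_l[OF K] I_r[OF K])
qed

lemma yv_word_mem:
  assumes S: "hmodule S" "I \<subseteq> S" and Y: "\<And>i u. i \<in> {1..n} \<Longrightarrow> u \<in> S \<Longrightarrow> yv g i * u \<in> S"
    and "b \<in> S" "set ws \<subseteq> {1..n}"
  shows "prod_list (map (yv g) ws) * b \<in> S"
  using assms(5) by (induction ws) (auto simp: assms(4) mult.assoc intro!: Y simp del: yv.simps)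

text \<open>A simple generator is moved to the right through a word of root vectors. At each of them
  it commutes, q-commutes, or merges with it into the next root vector; at the end it meets b. With
  \<open>S\<close> left open, the argument serves both the annihilator of the generator and the
  triangular decomposition.\<close>

lemma g_yv_word_mem:
  assumes S: "hmodule S" "I \<subseteq> S" and Y: "\<And>i u. i \<in> {1..n} \<Longrightarrow> u \<in> S \<Longrightarrow> yv g i * u \<in> S"
    and b: "b \<in> S" "\<And>j. j \<in> {2..n} \<Longrightarrow> g j * b \<in> S" and j: "j \<in> {1..n}" and ws: "set ws \<subseteq> {1..n}"
  shows "g j * (prod_list (map (yv g) ws) * b) \<in> S"
proof (cases "j = 1")
  case True
  \<comment> \<open>The first generator is itself a root vector and stays in front.\<close>
  then show ?thesis using Y[OF j yv_word_mem[OF S Y b(1) ws]] by simp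
next
  case False
  show ?thesis
    using ws
  proof (induction ws)
    case Nil
    then show ?case using j False b(2)[of j] by simp
  next
    case (Cons i ws)
    then have i: "i \<in> {1..n}" by simp
    let ?u = "prod_list (map (yv g) ws) * b"
    have IH: "yv g i * (g j * ?u) \<in> S" using Cons i by (intro Y) auto
    have c: "g j * (prod_list (map (yv g) (i # ws)) * b) \<in> S" if "g j * yv g i - v \<in> I" "v * ?u \<in> S" for v
    proof (rule hmodule_cong[OF S(1) _ that(2)])
      show "g j * (prod_list (map (yv g) (i # ws)) * b) - v * ?u \<in> S"
        using I_r[OF that(1), of ?u] S(2) by (auto simp: left_diff_distrib mult.assoc)
    qed
    consider "j = i" | "j = Suc i" | "j < i" | "Suc i < j" by linarith
    then show ?case
    proof cases
      case 1
      then show ?thesis using top_comm(1)[of i] i False IH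
        by (intro c[of "qpw 1 \<star> (yv g i * g j)"]) (auto simp: mult.assoc intro: hmodule_smul[OF S(1)])
    next
      case 2
      have "g j * yv g i - (yv g (Suc i) + qpw (- 1) \<star> (yv g i * g j)) \<in> I"
        using yv_step[of i] i 2 I_0 by (simp add: qcomm_conv)
      moreover have "yv g (Suc i) * ?u \<in> S"
        using 2 j Cons b by (intro Y yv_word_mem[OF S Y]) auto
      ultimately show ?thesis
        using IH by (intro c[of "yv g (Suc i) + qpw (- 1) \<star> (yv g i * g j)"])
          (auto simp: distrib_right mult.assoc intro!: hmodule_add[OF S(1)] hmodule_smul[OF S(1)] simp del: yv.simps)
    next
      case 3
      then show ?thesis using inner_comm(1)[of j i] i j False IH
        by (intro c[of "yv g i * g j"]) (auto simp: mult.assoc)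
    next
      case 4
      then show ?thesis using far_comm(1)[of i j] i j False IH
        by (intro c[of "yv g i * g j"]) (auto simp: mult.assoc)
    qed
  qed
qed

text \<open>\<open>g a\<close> commutes with \<open>g (Suc i)\<close> for a < i, so by
  \<open>qcomm_assoc\<close> the last generator can be pulled out of all inner brackets, one at a
  time.\<close>

lemma foldr_qcomm_xv:
  assumes "1 \<le> i" "i \<le> n"
  shows "foldr (\<lambda>j z. qcomm (qpw (- 1)) (g j) z) [1..<i] (g i) - xv g i \<in> I"
proof -
  define N where "N a i = foldr (\<lambda>j z. qcomm (qpw (- 1)) (g j) z) [a..<i] (g i)" for a i
  have rec: "N a i = qcomm (qpw (- 1)) (g a) (N (Suc a) i)" if "a < i" for a i
    using that by (simp add: N_def upt_conv_Cons)
  have step: "N a (Suc i) - qcomm (qpw (- 1)) (N a i) (g (Suc i)) \<in> I"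
    if "a \<le> i" "1 \<le> a" "Suc i \<le> n" for a i
    using that(1,2)
  proof (induction a rule: inc_induct)
    case base
    then show ?case using I_0 by (simp add: N_def)
  next
    case (step a)
    have "g a * g (Suc i) - g (Suc i) * g a \<in> I" using g_comm[of a "Suc i"] step that by auto
    note qcomm_assoc[OF this, of "qpw (- 1)" "N (Suc a) i"]
    moreover have "N a (Suc i) - qcomm (qpw (- 1)) (g a) (qcomm (qpw (- 1)) (N (Suc a) i) (g (Suc i))) \<in> I"
      using step rec[of a "Suc i"] by (auto intro!: cong_qcomm I_0)
    ultimately show ?case using cong_trans rec[of a i] step by metis
  qed
  have "N 1 i - xv g i \<in> I"
    using assms
  proof (induction i rule: dec_induct)
    case base
    then show ?case using I_0 by (simp add: N_def)
  next
    case (step i)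
    have "qcomm (qpw (- 1)) (N 1 i) (g (Suc i)) - xv g (Suc i) \<in> I"
      unfolding xv_step[OF step(1)] by (rule cong_qcomm) (use step I_0 in auto)
    then show ?case using \<open>\<And>i a. a \<le> i \<Longrightarrow> 1 \<le> a \<Longrightarrow> Suc i \<le> n \<Longrightarrow> _ a i\<close>[of 1 i] step cong_trans by blast
  qed
  then show ?thesis by (simp add: N_def)
qed

end

lemma serre_family_ee: "serre_family (rel_ideal n) n ee"
  and serre_family_ff: "serre_family (rel_ideal n) n ff"
  by (unfold_locales; (rule rel_ideal_ideal | rule relators_rel_ideal; simp add: relators_def; blast))+

lemma yroot_conv: "1 \<le> i \<Longrightarrow> yroot i = yv ff i"
proof (induction i rule: dec_induct)
  case base
  then show ?case by (simp add: yroot_def)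
next
  case (step i)
  then show ?case by (simp add: yroot_def)
qed

lemma xroot_conv:
  assumes "1 \<le> i" "i \<le> n"
  shows "xroot i - qpw (2 * (of_nat i - 1)) \<star> xv ee i \<in> rel_ideal n"
proof -
  interpret serre_family "rel_ideal n" n ee by (rule serre_family_ee)
  show ?thesis unfolding xroot_def smul_def[symmetric] by (intro cong_smul foldr_qcomm_xv assms)
qed

section \<open>Quantum numbers\<close>

lemma qpw_mult: "qpw a * qpw b = qpw (a + b)"
  by (simp add: fps_exp_add_mult)

lemma qpw_diff_nonzero: "qpw 1 - qpw (- 1) \<noteq> 0"
proof
  assume "qpw 1 - qpw (- 1) = 0"
  then have "fps_nth (qpw 1 - qpw (- 1)) 1 = 0" by simp
  then show False by simp
qed

lemma subdegree_qpw_diff: "subdegree (qpw 1 - qpw (- 1)) = 1"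
  by (rule subdegreeI) auto

text \<open>The division in \<open>qnum\<close> is exact: q - q^-1 is h times a unit, and q^x - q^-x
  vanishes at h = 0.\<close>

lemma qnum_mult: "qnum x * (qpw 1 - qpw (- 1)) = qpw x - qpw (- x)"
proof -
  have "subdegree (qpw 1 - qpw (- 1)) \<le> subdegree (qpw x - qpw (- x))" if "qpw x - qpw (- x) \<noteq> 0"
    unfolding subdegree_qpw_diff using that by (intro subdegree_geI) auto
  then have "qpw 1 - qpw (- 1) dvd qpw x - qpw (- x)"
    using qpw_diff_nonzero by (cases "qpw x - qpw (- x) = 0") (auto simp: fps_dvd_iff)
  then show ?thesis by (simp add: qnum_def)
qed

lemma qnum_eqI:
  assumes "c * (qpw 1 - qpw (- 1)) = qpw x - qpw (- x)"
  shows "qnum x = c"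
  using assms qnum_mult[of x] qpw_diff_nonzero mult_right_cancel by metis

lemma qnum_0 [simp]: "qnum 0 = 0"
  by (rule qnum_eqI) simp

lemma qnum_1 [simp]: "qnum 1 = 1"
  by (rule qnum_eqI) simp

lemma qnum_minus: "qnum (- x) = - qnum x"
  by (rule qnum_eqI) (simp add: qnum_mult)

text \<open>The classical limit. Writing [x] for \<open>qnum x\<close>, it shows that [x] is a unit
  exactly when x is not 0.\<close>

lemma qnum_nth_0: "fps_nth (qnum x) 0 = x"
proof -
  have "fps_nth (qnum x * (qpw 1 - qpw (- 1))) 1 = fps_nth (qpw x - qpw (- x)) 1"
    by (simp only: qnum_mult)
  then show ?thesis by (simp add: fps_mult_nth)
qed

lemma qnum_add_1: "qnum (x + 1) = qpw 1 * qnum x + qpw (- x)"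
proof (rule qnum_eqI)
  have "(qpw 1 * qnum x + qpw (- x)) * (qpw 1 - qpw (- 1))
      = qpw 1 * (qnum x * (qpw 1 - qpw (- 1))) + qpw (- x) * (qpw 1 - qpw (- 1))"
    by (simp add: algebra_simps)
  then show "(qpw 1 * qnum x + qpw (- x)) * (qpw 1 - qpw (- 1)) = qpw (x + 1) - qpw (- (x + 1))"
    unfolding qnum_mult by (simp add: right_diff_distrib qpw_mult add.commute)
qed

lemma qnum_add_1': "qnum (x + 1) = qpw (- 1) * qnum x + qpw x"
proof (rule qnum_eqI)
  have "(qpw (- 1) * qnum x + qpw x) * (qpw 1 - qpw (- 1))
      = qpw (- 1) * (qnum x * (qpw 1 - qpw (- 1))) + qpw x * (qpw 1 - qpw (- 1))"
    by (simp add: algebra_simps)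
  then show "(qpw (- 1) * qnum x + qpw x) * (qpw 1 - qpw (- 1)) = qpw (x + 1) - qpw (- (x + 1))"
    unfolding qnum_mult by (simp add: right_diff_distrib qpw_mult add.commute)
qed

text \<open>Both coefficient identities for the Serre relations of the oscillator operators are
  multiples of this one.\<close>

lemma qnum_three_term: "qnum (x + 1) + qnum (x - 1) = qpw 1 * qnum x + qpw (- 1) * qnum x"
proof -
  have "qpw (- 1) * qnum x = qpw (- 1) * (qpw 1 * qnum (x - 1)) + qpw (- 1) * qpw (- (x - 1))"
    using qnum_add_1[of "x - 1"] by (simp add: distrib_left)
  also have "\<dots> = qnum (x - 1) + qpw (- x)"
    unfolding mult.assoc[symmetric] by (simp add: qpw_mult)
  finally show ?thesis by (simp add: qnum_add_1)
qed

text \<open>On a monomial this is the commutator of \<open>opE\<close> and \<open>opF\<close> with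
  the same index.\<close>

lemma qnum_swap: "qnum x * qnum (y + 1) - qnum y * qnum (x + 1) = qnum (x - y)"
proof (rule qnum_eqI[symmetric])
  let ?D = "qpw 1 - qpw (- 1)"
  have "(qnum x * qnum (y + 1) - qnum y * qnum (x + 1)) * ?D
      = qnum x * (qpw 1 * (qnum y * ?D) + qpw (- y) * ?D) - qnum y * (qpw 1 * (qnum x * ?D) + qpw (- x) * ?D)"
    unfolding qnum_add_1 by (simp add: algebra_simps)
  also have "\<dots> = qpw (- y) * (qnum x * ?D) - qpw (- x) * (qnum y * ?D)"
    by (simp add: algebra_simps)
  also have "\<dots> = qpw (x - y) - qpw (- (x - y))"
    unfolding qnum_mult by (simp add: algebra_simps qpw_mult)
  finally show "(qnum x * qnum (y + 1) - qnum y * qnum (x + 1)) * ?D = qpw (x - y) - qpw (- (x - y))" .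
qed

section \<open>The oscillator modules\<close>

type_synonym lat = "nat \<Rightarrow>\<^sub>0 int"
type_synonym osc = "lat hser"

text \<open>
  The monomial of exponent \<open>\<kappa>\<close> stands for \<open>z\<^sub>0\<close> to the power \<open>\<lambda> + \<kappa>\<^sub>0\<close> times the \<open>z\<^sub>j\<close> to the
  powers \<open>\<kappa>\<^sub>j\<close>. Allowing all integer exponents makes the verification of the relations uniform.
\<close>

definition cc :: "complex \<Rightarrow> lat \<Rightarrow> nat \<Rightarrow> complex" where
  "cc lam \<kappa> j = (if j = 0 then lam else 0) + of_int (lookup \<kappa> j)"

definition del :: "nat \<Rightarrow> lat" where
  "del i = single i 1 - single (i - 1) 1"

text \<open>The q-analogue of z_(i-1) d/dz_i, with [k] in place of the exponent k. Likewise
  \<open>opF\<close> is z_i d/dz_(i-1), and \<open>opH\<close> counts the exponent of z_(a-1), the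
  variables being numbered from 0.\<close>

definition opE :: "complex \<Rightarrow> nat \<Rightarrow> osc \<Rightarrow> osc" where
  "opE lam i = ext (\<lambda>\<kappa>. qnum (cc lam \<kappa> i) \<star> bas (\<kappa> - del i))"

definition opF :: "complex \<Rightarrow> nat \<Rightarrow> osc \<Rightarrow> osc" where
  "opF lam i = ext (\<lambda>\<kappa>. qnum (cc lam \<kappa> (i - 1)) \<star> bas (\<kappa> + del i))"

definition opH :: "complex \<Rightarrow> nat \<Rightarrow> osc \<Rightarrow> osc" where
  "opH lam a = ext (\<lambda>\<kappa>. fps_const (cc lam \<kappa> (a - 1)) \<star> bas \<kappa>)"

lemma hlin_opE: "hlin (opE lam i)" and hlin_opF: "hlin (opF lam i)" and hlin_opH: "hlin (opH lam a)"
  by (simp_all add: opE_def opF_def opH_def hlin_ext)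

lemma opE_bas: "opE lam i (bas \<kappa>) = qnum (cc lam \<kappa> i) \<star> bas (\<kappa> - del i)"
  and opF_bas: "opF lam i (bas \<kappa>) = qnum (cc lam \<kappa> (i - 1)) \<star> bas (\<kappa> + del i)"
  and opH_bas: "opH lam a (bas \<kappa>) = fps_const (cc lam \<kappa> (a - 1)) \<star> bas \<kappa>"
  by (simp_all add: opE_def opF_def opH_def)

lemmas op_smul = hlin_smul[OF hlin_opE] hlin_smul[OF hlin_opF] hlin_smul[OF hlin_opH]

lemma lookup_del: "lookup (del i) j = (if j = i then 1 else 0) - (if j = i - 1 then 1 else 0)"
  by (auto simp: del_def lookup_minus lookup_single when_def)

lemma cc_del:
  "cc lam (\<kappa> + del i) j = cc lam \<kappa> j + ((if j = i then 1 else 0) - (if j = i - 1 then 1 else 0))"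
  "cc lam (\<kappa> - del i) j = cc lam \<kappa> j - ((if j = i then 1 else 0) - (if j = i - 1 then 1 else 0))"
  by (auto simp: cc_def lookup_add lookup_minus lookup_del)

lemma opE_comm:
  assumes "1 \<le> i" "i + 1 < j"
  shows "opE lam i (opE lam j (bas \<kappa>)) = opE lam j (opE lam i (bas \<kappa>))"
    and "opF lam i (opF lam j (bas \<kappa>)) = opF lam j (opF lam i (bas \<kappa>))"
  using assms
  by (auto simp: opE_bas opF_bas op_smul cc_del mult.commute diff_diff_eq add.commute add.left_commute)

lemma serre_coeff:
  "qnum b * (qnum (a + 1) * qnum a) - qpw 1 * (qnum a * (qnum b * qnum a))
     - qpw (- 1) * (qnum a * (qnum b * qnum a)) + qnum a * (qnum (a - 1) * qnum b) = 0" (is "?l = 0")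
proof -
  have "?l = qnum a * qnum b * ((qnum (a + 1) + qnum (a - 1)) - (qpw 1 * qnum a + qpw (- 1) * qnum a))"
    by (simp add: algebra_simps)
  then show ?thesis unfolding qnum_three_term by simp
qed

lemma serre_coeff':
  "qnum a * (qnum b * qnum (b - 1)) - qpw 1 * (qnum b * (qnum (a + 1) * qnum (b - 1)))
     - qpw (- 1) * (qnum b * (qnum (a + 1) * qnum (b - 1))) + qnum b * (qnum (b - 1) * qnum (a + 1 + 1)) = 0"
    (is "?l = 0")
proof -
  have "?l = qnum b * qnum (b - 1) * ((qnum (a + 1 + 1) + qnum (a + 1 - 1)) - (qpw 1 * qnum (a + 1) + qpw (- 1) * qnum (a + 1)))"
    by (simp add: algebra_simps)
  then show ?thesis unfolding qnum_three_term by simp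
qed

lemma smul_4_zero:
  "a - b - c + d = 0 \<Longrightarrow> a \<star> x - b \<star> x - c \<star> x + d \<star> x = 0"
  by (simp flip: hs.scale_left_distrib hs.scale_left_diff_distrib)

definition serre_op :: "(osc \<Rightarrow> osc) \<Rightarrow> (osc \<Rightarrow> osc) \<Rightarrow> osc \<Rightarrow> osc" where
  "serre_op A B t = A (A (B t)) - qpw 1 \<star> A (B (A t)) - qpw (- 1) \<star> A (B (A t)) + B (A (A t))"

text \<open>All orders of the three shifts lead to the same monomial, so each relation is one
  identity between products of quantum numbers.\<close>

lemma serre_op_eq:
  assumes "1 \<le> i"
  shows "serre_op (opE lam i) (opE lam (i + 1)) (bas \<kappa>) = 0"
    and "serre_op (opE lam (i + 1)) (opE lam i) (bas \<kappa>) = 0"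
    and "serre_op (opF lam i) (opF lam (i + 1)) (bas \<kappa>) = 0"
    and "serre_op (opF lam (i + 1)) (opF lam i) (bas \<kappa>) = 0"
proof -
  let ?a = "cc lam \<kappa> i" and ?b = "cc lam \<kappa> (i + 1)" and ?c = "cc lam \<kappa> (i - 1)"
  have n: "(i = i + 1) = False" "(i + 1 = i) = False" "(i = i - 1) = False" "(i - 1 = i) = False"
    "(i + 1 = i - 1) = False" "(i - 1 = i + 1) = False" "i + 1 - 1 = i"
    using assms by auto
  have p1: "\<kappa> - del (i + 1) - del i - del i = \<kappa> - del i - del i - del (i + 1)"
    "\<kappa> - del i - del (i + 1) - del i = \<kappa> - del i - del i - del (i + 1)"
    "\<kappa> - del (i + 1) - del i - del (i + 1) = \<kappa> - del (i + 1) - del (i + 1) - del i"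
    "\<kappa> - del i - del (i + 1) - del (i + 1) = \<kappa> - del (i + 1) - del (i + 1) - del i"
    "\<kappa> + del (i + 1) + del i + del i = \<kappa> + del i + del i + del (i + 1)"
    "\<kappa> + del i + del (i + 1) + del i = \<kappa> + del i + del i + del (i + 1)"
    "\<kappa> + del (i + 1) + del i + del (i + 1) = \<kappa> + del (i + 1) + del (i + 1) + del i"
    "\<kappa> + del i + del (i + 1) + del (i + 1) = \<kappa> + del (i + 1) + del (i + 1) + del i"
    by (simp_all add: algebra_simps)
  show "serre_op (opE lam i) (opE lam (i + 1)) (bas \<kappa>) = 0"
    using serre_coeff[of ?b ?a]
    by (simp only: serre_op_def opE_bas opF_bas op_smul cc_del p1 n if_True if_False refl hs.scale_scale
        mult.assoc smul_4_zero diff_0 diff_0_right add_0_right diff_minus_eq_add diff_self add_uminus_conv_diff diff_add_cancel add_diff_cancel_right')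
  show "serre_op (opE lam (i + 1)) (opE lam i) (bas \<kappa>) = 0"
    using serre_coeff'[of ?a ?b]
    by (simp only: serre_op_def opE_bas opF_bas op_smul cc_del p1 n if_True if_False refl hs.scale_scale
        mult.assoc smul_4_zero diff_0 diff_0_right add_0_right diff_minus_eq_add diff_self add_uminus_conv_diff diff_add_cancel add_diff_cancel_right')
  show "serre_op (opF lam i) (opF lam (i + 1)) (bas \<kappa>) = 0"
    using serre_coeff'[of ?a ?c]
    by (simp only: serre_op_def opE_bas opF_bas op_smul cc_del p1 n if_True if_False refl hs.scale_scale
        mult.assoc smul_4_zero diff_0 diff_0_right add_0_right diff_minus_eq_add diff_self add_uminus_conv_diff diff_add_cancel add_diff_cancel_right')
  show "serre_op (opF lam (i + 1)) (opF lam i) (bas \<kappa>) = 0"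
    using serre_coeff[of ?c ?a]
    by (simp only: serre_op_def opE_bas opF_bas op_smul cc_del p1 n if_True if_False refl hs.scale_scale
        mult.assoc smul_4_zero diff_0 diff_0_right add_0_right diff_minus_eq_add diff_self add_uminus_conv_diff diff_add_cancel add_diff_cancel_right')
qed

lemma opEF_comm:
  assumes "1 \<le> i" "1 \<le> j"
  shows "opE lam i (opF lam j (bas \<kappa>)) - opF lam j (opE lam i (bas \<kappa>))
    = (if i = j then qnum (cc lam \<kappa> (i - 1) - cc lam \<kappa> i) \<star> bas \<kappa> else 0)"
proof (cases "i = j")
  case True
  have *: "i - 1 \<noteq> i" using assms by auto
  have "opE lam i (opF lam i (bas \<kappa>)) = (qnum (cc lam \<kappa> (i - 1)) * qnum (cc lam \<kappa> i + 1)) \<star> bas \<kappa>"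
    "opF lam i (opE lam i (bas \<kappa>)) = (qnum (cc lam \<kappa> i) * qnum (cc lam \<kappa> (i - 1) + 1)) \<star> bas \<kappa>"
    using * by (simp_all add: opE_bas opF_bas op_smul cc_del del: One_nat_def)
  then show ?thesis
    using True by (simp add: qnum_swap flip: hs.scale_left_diff_distrib del: One_nat_def)
next
  case False
  have p: "\<kappa> + del j - del i = \<kappa> - del i + del j" by (simp add: algebra_simps)
  have "i \<noteq> i - 1" "j \<noteq> j - 1" "i - 1 \<noteq> j - 1" using assms False by auto
  then show ?thesis
    using False by (simp add: opE_bas opF_bas op_smul cc_del p mult.commute)
qed

lemma opH_E:
  "opH lam a (opE lam i (bas \<kappa>)) - opE lam i (opH lam a (bas \<kappa>))
    = fps_const ((if a - 1 = i - 1 then 1 else 0) - (if a - 1 = i then 1 else 0)) \<star> opE lam i (bas \<kappa>)"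
  and opH_F:
  "opH lam a (opF lam i (bas \<kappa>)) - opF lam i (opH lam a (bas \<kappa>))
    = fps_const ((if a - 1 = i then 1 else 0) - (if a - 1 = i - 1 then 1 else 0)) \<star> opF lam i (bas \<kappa>)"
  by (simp_all add: opE_bas opF_bas opH_bas op_smul cc_del mult.commute
      flip: hs.scale_left_diff_distrib left_diff_distrib right_diff_distrib)

text \<open>\<open>s\<close> selects one of the two modules: swapping the roles of E and F and reversing the sign
  of the Cartan elements is an automorphism.\<close>

definition lo :: "bool \<Rightarrow> nat \<Rightarrow> gen" where "lo s i = (if s then Fgen i else Egen i)"
definition hi :: "bool \<Rightarrow> nat \<Rightarrow> gen" where "hi s i = (if s then Egen i else Fgen i)"
definition sg :: "bool \<Rightarrow> complex" where "sg s = (if s then 1 else - 1)"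

fun rho :: "bool \<Rightarrow> nat \<Rightarrow> complex \<Rightarrow> gen \<Rightarrow> osc \<Rightarrow> osc" where
  "rho s n lam (Egen i) t = (if i \<in> {1..n} then if s then opE lam i t else opF lam i t else 0)"
| "rho s n lam (Fgen i) t = (if i \<in> {1..n} then if s then opF lam i t else opE lam i t else 0)"
| "rho s n lam (Hgen a) t = (if a \<in> {1..n + 1} then fps_const (sg s) \<star> opH lam a t else 0)"

lemma hlin_rho: "hlin (rho s n lam g)"
  by (cases g; cases s) (auto simp: hlin_def hlin_add[OF hlin_opE] hlin_add[OF hlin_opF] hlin_add[OF hlin_opH]
      op_smul hs.scale_right_distrib mult.commute)

section \<open>The action of the free algebra and the verification of the relations\<close>

definition act :: "bool \<Rightarrow> nat \<Rightarrow> complex \<Rightarrow> alg \<Rightarrow> osc \<Rightarrow> osc" where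
  "act s n lam u t = ext (\<lambda>w. foldr (rho s n lam) (letters w) t) u"

lemma hlin_act_left: "hlin (\<lambda>u. act s n lam u t)"
  by (simp add: act_def hlin_ext)

lemma act_bas: "act s n lam (bas w) t = foldr (rho s n lam) (letters w) t"
  by (simp add: act_def)

lemma hlin_foldr: "(\<And>g. hlin (f g)) \<Longrightarrow> hlin (\<lambda>t. foldr f gs t)"
  by (induction gs) (simp_all add: id_def comp_def hlin_id hlin_comp)

lemma hlin_act: "hlin (act s n lam u)"
proof (rule hlinI)
  note l = hlin_act_left[of s n lam]
  have f: "hlin (\<lambda>t. foldr (rho s n lam) gs t)" for gs by (rule hlin_foldr) (rule hlin_rho)
  show "act s n lam u (x + y) = act s n lam u x + act s n lam u y" for x y
    by (rule hlin_eqI[OF l hlin_add_fun[OF l l]]) (simp add: act_bas hlin_add[OF f])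
  show "act s n lam u (c \<star> x) = c \<star> act s n lam u x" for c x
    by (rule hlin_eqI[OF l hlin_smul_fun[OF l]]) (simp add: act_bas hlin_smul[OF f])
qed

lemmas act_add_left = hlin_add[OF hlin_act_left] and act_diff_left = hlin_diff[OF hlin_act_left]
  and act_smul_left = hlin_smul[OF hlin_act_left] and act_0_left = hlin_0[OF hlin_act_left]
  and act_sum_left = hlin_sum[OF hlin_act_left] and act_minus_left = hlin_uminus[OF hlin_act_left]
  and act_smul = hlin_smul[OF hlin_act] and act_0 = hlin_0[OF hlin_act]

lemma act_mult: "act s n lam (u * v) t = act s n lam u (act s n lam v t)"
proof (rule hlin_eqI[where f = "\<lambda>u. act s n lam (u * v) t"])
  show "hlin (\<lambda>u. act s n lam (u * v) t)"
    by (rule hlin_comp[OF hlin_act_left hlin_rmult])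
  show "hlin (\<lambda>u. act s n lam u (act s n lam v t))"
    by (rule hlin_act_left)
  fix w
  show "act s n lam (bas w * v) t = act s n lam (bas w) (act s n lam v t)"
  proof (rule hlin_eqI[where f = "\<lambda>v. act s n lam (bas w * v) t"])
    show "hlin (\<lambda>v. act s n lam (bas w * v) t)"
      by (rule hlin_comp[OF hlin_act_left hlin_lmult])
    show "hlin (\<lambda>v. act s n lam (bas w) (act s n lam v t))"
      by (rule hlin_comp[OF hlin_act hlin_act_left])
    show "act s n lam (bas w * bas w') t = act s n lam (bas w) (act s n lam (bas w') t)" for w'
      by (simp add: bas_mult act_bas plus_word_def)
  qed
qed

lemma act_1: "act s n lam 1 t = t"
  by (simp add: act_bas zero_word_def flip: bas_0)

lemma gen_conv: "gen g = bas (Word [g])"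
  by (simp add: gen_def bas_def)

lemma act_gen: "act s n lam (gen g) t = rho s n lam g t"
  by (simp add: gen_conv act_bas)

lemma act_scal: "act s n lam (scal c) t = c \<star> t"
  by (simp add: scal_conv act_smul_left act_1)

lemma cartan_conv: "cartan n \<mu> = (\<Sum>a = 1..n + 1. fps_const (\<mu> a) \<star> gen (Hgen a))"
proof -
  have "fps_const (\<mu> a) \<star> gen (Hgen a) = fps_const (single (Word [Hgen a]) (\<mu> a))" for a
    by (rule fps_ext) (simp add: smul_const_nth gen_def mult_single)
  moreover have "fps_const (sum f A) = (\<Sum>a\<in>A. fps_const (f a))" for f :: "nat \<Rightarrow> word \<Rightarrow>\<^sub>0 complex" and A
    by (rule fps_ext) (simp add: fps_sum_nth)
  ultimately show ?thesis by (simp add: cartan_def cartan0_def del: sum.cl_ivl_Suc)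
qed

lemma qcartan_coeff: "fps_const (fps_nth (qcartan n \<mu>) k) = fps_const (1 / fact k) \<star> cartan n \<mu> ^ k"
  by (rule fps_ext) (simp add: qcartan_def smul_const_nth cartan_def)

lemma fps_shift_1_hX: "fps_nth x 0 = 0 \<Longrightarrow> hX \<star> fps_shift 1 x = x"
  using hX_power_smul_nth[of 1 "fps_shift 1 x"] by (intro fps_ext) simp

text \<open>One factor h was cancelled in the definition of \<open>qnum_cartan\<close>. It can be
  restored because q^H - q^-H has no constant term.\<close>

lemma qnum_cartan_eq: "(qpw 1 - qpw (- 1)) \<star> qnum_cartan n \<mu> = qcartan n \<mu> - qcartan n (\<lambda>a. - \<mu> a)"
proof -
  let ?x = "qcartan n \<mu> - qcartan n (\<lambda>a. - \<mu> a)"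
  define d where "d = fps_shift 1 (qpw 1 - qpw (- 1))"
  have d: "inverse d * d = 1" by (rule inverse_mult_eq_1) (simp add: d_def)
  have "qpw 1 - qpw (- 1) = hX * d"
    by (rule fps_ext) (simp add: d_def)
  then have h: "(qpw 1 - qpw (- 1)) * inverse d = hX"
    using d by (simp add: mult.assoc mult.commute[of d])
  have "(qpw 1 - qpw (- 1)) \<star> qnum_cartan n \<mu> = ((qpw 1 - qpw (- 1)) * inverse d) \<star> fps_shift 1 ?x"
    unfolding qnum_cartan_def smul_def[symmetric] d_def[symmetric] by (rule hs.scale_scale)
  also have "\<dots> = ?x"
    unfolding h by (rule fps_shift_1_hX) (simp add: qcartan_def)
  finally show ?thesis .
qed

text \<open>Completed free modules are torsion-free, so actions may be compared after multiplication
  by q - q^-1.\<close>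

lemma smul_cancel: "c \<noteq> 0 \<Longrightarrow> c \<star> x = c \<star> y \<Longrightarrow> x = y"
  by (rule hser_eqI) (metis coord_smul mult_left_cancel)

lemma act_cartan:
  assumes "\<And>a. a \<in> {1..n + 1} \<Longrightarrow> act s n lam (gen (Hgen a)) t = fps_const (c a) \<star> t"
  defines "S \<equiv> \<lambda>\<mu>. \<Sum>a = 1..n + 1. \<mu> a * c a"
  shows "act s n lam (cartan n \<mu>) t = fps_const (S \<mu>) \<star> t"
    and "act s n lam (qcartan n \<mu>) t = qpw (S \<mu>) \<star> t"
    and "act s n lam (qnum_cartan n \<mu>) t = qnum (S \<mu>) \<star> t"
proof -
  have fc: "fps_const (sum f A) = (\<Sum>a\<in>A. fps_const (f a))" for f :: "nat \<Rightarrow> complex" and A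
    by (rule fps_ext) (simp add: fps_sum_nth)
  have "act s n lam (cartan n \<mu>) t = (\<Sum>a = 1..n + 1. fps_const (\<mu> a) \<star> (fps_const (c a) \<star> t))" for \<mu>
    unfolding cartan_conv act_sum_left act_smul_left by (rule sum.cong) (simp_all only: assms(1))
  then have c: "act s n lam (cartan n \<mu>) t = fps_const (S \<mu>) \<star> t" for \<mu>
    by (simp add: S_def fc hs.scale_sum_left del: sum.cl_ivl_Suc)
  then show "act s n lam (cartan n \<mu>) t = fps_const (S \<mu>) \<star> t" .
  have pw: "act s n lam (cartan n \<mu> ^ k) t = fps_const (S \<mu> ^ k) \<star> t" for k \<mu>
    by (induction k) (simp_all add: act_1 act_mult act_smul c mult.commute)
  have q: "act s n lam (qcartan n \<mu>) t = qpw (S \<mu>) \<star> t" for \<mu>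
  proof (rule fps_ext)
    fix m
    have "fps_nth (act s n lam (qcartan n \<mu>) t) m
        = (\<Sum>i\<le>m. single 0 (S \<mu> ^ i / fact i) * fps_nth t (m - i))"
      by (subst hlin_nth[OF hlin_act_left])
        (simp add: qcartan_coeff act_smul_left pw smul_const_nth)
    then show "fps_nth (act s n lam (qcartan n \<mu>) t) m = fps_nth (qpw (S \<mu>) \<star> t) m"
      by (simp add: smul_def fps_mult_nth atLeast0AtMost)
  qed
  then show "act s n lam (qcartan n \<mu>) t = qpw (S \<mu>) \<star> t" .
  have "(qpw 1 - qpw (- 1)) \<star> act s n lam (qnum_cartan n \<mu>) t = (qpw (S \<mu>) - qpw (S (\<lambda>a. - \<mu> a))) \<star> t"
    unfolding act_smul_left[symmetric] qnum_cartan_eq act_diff_left q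
    by (rule hs.scale_left_diff_distrib[symmetric])
  also have "S (\<lambda>a. - \<mu> a) = - S \<mu>"
    by (simp add: S_def sum_negf del: sum.cl_ivl_Suc)
  also have "qpw (S \<mu>) - qpw (- S \<mu>) = (qpw 1 - qpw (- 1)) * qnum (S \<mu>)"
    unfolding qnum_mult[of "S \<mu>", symmetric] by (rule mult.commute)
  finally show "act s n lam (qnum_cartan n \<mu>) t = qnum (S \<mu>) \<star> t"
    using smul_cancel[OF qpw_diff_nonzero] by (metis hs.scale_scale)
qed

lemma act_serre:
  "act s n lam (serre x y) t = serre_op (act s n lam x) (act s n lam y) t"
  by (simp add: serre_conv serre_op_def act_add_left act_diff_left act_smul_left act_mult)

definition cartan_weight :: "bool \<Rightarrow> nat \<Rightarrow> complex \<Rightarrow> lat \<Rightarrow> (nat \<Rightarrow> complex) \<Rightarrow> complex" where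
  "cartan_weight s n lam \<kappa> \<mu> = (\<Sum>a = 1..n + 1. \<mu> a * (sg s * cc lam \<kappa> (a - 1)))"

lemma act_H: "a \<in> {1..n + 1} \<Longrightarrow>
    act s n lam (gen (Hgen a)) (bas \<kappa>) = fps_const (sg s * cc lam \<kappa> (a - 1)) \<star> bas \<kappa>"
  by (simp add: act_gen opH_bas)

lemma act_cartan_bas:
  "act s n lam (cartan n \<mu>) (bas \<kappa>) = fps_const (cartan_weight s n lam \<kappa> \<mu>) \<star> bas \<kappa>"
  "act s n lam (qcartan n \<mu>) (bas \<kappa>) = qpw (cartan_weight s n lam \<kappa> \<mu>) \<star> bas \<kappa>"
  "act s n lam (qnum_cartan n \<mu>) (bas \<kappa>) = qnum (cartan_weight s n lam \<kappa> \<mu>) \<star> bas \<kappa>"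
  unfolding cartan_weight_def
  by (rule act_cartan(1)[OF act_H] act_cartan(2)[OF act_H] act_cartan(3)[OF act_H]; assumption)+

lemma sum_eps: "i \<in> {1..n + 1} \<Longrightarrow> (\<Sum>a = 1..n + 1. eps i a * f a) = f i"
  by (simp add: eps_def if_distrib[of "\<lambda>x. x * _"] cong: if_cong del: sum.cl_ivl_Suc)

lemma form_eps: "i \<in> {1..n + 1} \<Longrightarrow> form n (eps i) \<mu> = \<mu> i"
  using sum_eps by (simp only: form_def)

lemma cartan_weight_alpha:
  assumes "i \<in> {1..n}"
  shows "cartan_weight s n lam \<kappa> (alpha i) = sg s * (cc lam \<kappa> (i - 1) - cc lam \<kappa> i)"
    and "cartan_weight s n lam \<kappa> (\<lambda>a. - alpha i a) = - (sg s * (cc lam \<kappa> (i - 1) - cc lam \<kappa> i))"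
proof -
  have "cartan_weight s n lam \<kappa> (alpha i)
      = (\<Sum>a = 1..n + 1. eps i a * (sg s * cc lam \<kappa> (a - 1))) - (\<Sum>a = 1..n + 1. eps (i + 1) a * (sg s * cc lam \<kappa> (a - 1)))"
    by (simp add: cartan_weight_def alpha_def left_diff_distrib sum_subtractf del: sum.cl_ivl_Suc)
  also have "\<dots> = sg s * (cc lam \<kappa> (i - 1) - cc lam \<kappa> i)"
    using assms by (subst (1 2) sum_eps) (auto simp: right_diff_distrib)
  finally show 1: "cartan_weight s n lam \<kappa> (alpha i) = sg s * (cc lam \<kappa> (i - 1) - cc lam \<kappa> i)" .
  have "cartan_weight s n lam \<kappa> (\<lambda>a. - alpha i a) = - cartan_weight s n lam \<kappa> (alpha i)"
    by (simp add: cartan_weight_def sum_negf del: sum.cl_ivl_Suc)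
  then show "cartan_weight s n lam \<kappa> (\<lambda>a. - alpha i a) = - (sg s * (cc lam \<kappa> (i - 1) - cc lam \<kappa> i))"
    using 1 by simp
qed

lemma act_hi: "i \<in> {1..n} \<Longrightarrow> act s n lam (gen (hi s i)) t = opE lam i t"
  and act_lo: "i \<in> {1..n} \<Longrightarrow> act s n lam (gen (lo s i)) t = opF lam i t"
  by (simp_all add: act_gen hi_def lo_def)

lemma act_EF:
  assumes "i \<in> {1..n}"
  shows "act s n lam (ee i) = (if s then opE lam i else opF lam i)"
    and "act s n lam (ff i) = (if s then opF lam i else opE lam i)"
  using assms by (auto simp: act_gen fun_eq_iff)

lemma fps_const_neg_smul: "fps_const (- c) \<star> x = - (fps_const c \<star> x)"
  by (simp flip: fps_const_neg)

lemma relators_act_bas: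
  assumes "r \<in> relators n"
  shows "act s n lam r (bas \<kappa>) = 0"
proof -
  note l = act_add_left act_diff_left act_mult act_smul
  have H: "act s n lam (gen (Hgen a) * ee i - ee i * gen (Hgen a) - scal (fps_const (form n (eps a) (alpha i))) * ee i) (bas \<kappa>) = 0"
    "act s n lam (gen (Hgen a) * ff i - ff i * gen (Hgen a) + scal (fps_const (form n (eps a) (alpha i))) * ff i) (bas \<kappa>) = 0"
    if "a \<in> {1..n + 1}" "i \<in> {1..n}" for a i
  proof -
    have b: "a - 1 = i \<longleftrightarrow> a = i + 1" "a - 1 = i - 1 \<longleftrightarrow> a = i" using that by auto
    have f: "form n (eps a) (alpha i) = (if a = i then 1 else 0) - (if a = i + 1 then 1 else 0)"
      using that by (simp add: form_eps) (simp add: alpha_def eps_def)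
    have h: "act s n lam (gen (Hgen a)) t = fps_const (sg s) \<star> opH lam a t" for t
      using that by (simp add: act_gen)
    have E: "opH lam a (opE lam i (bas \<kappa>)) - opE lam i (opH lam a (bas \<kappa>))
        = fps_const (form n (eps a) (alpha i)) \<star> opE lam i (bas \<kappa>)"
      unfolding opH_E b f ..
    have F: "opH lam a (opF lam i (bas \<kappa>)) - opF lam i (opH lam a (bas \<kappa>))
        = fps_const (- form n (eps a) (alpha i)) \<star> opF lam i (bas \<kappa>)"
      unfolding opH_F b f by simp
    show "act s n lam (gen (Hgen a) * ee i - ee i * gen (Hgen a) - scal (fps_const (form n (eps a) (alpha i))) * ee i) (bas \<kappa>) = 0"
      "act s n lam (gen (Hgen a) * ff i - ff i * gen (Hgen a) + scal (fps_const (form n (eps a) (alpha i))) * ff i) (bas \<kappa>) = 0"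
      using E F that(2)
      by (auto simp: l act_scal act_EF h op_smul sg_def fps_const_neg_smul
          hlin_uminus[OF hlin_opE] hlin_uminus[OF hlin_opF] algebra_simps)
  qed
  have HH: "act s n lam (gen (Hgen a) * gen (Hgen b) - gen (Hgen b) * gen (Hgen a)) (bas \<kappa>) = 0"
    if "a \<in> {1..n + 1}" "b \<in> {1..n + 1}" for a b
    using that by (simp add: l act_H mult.commute)
  have EF: "act s n lam (ee i * ff j - ff j * ee i - (if i = j then qnum_cartan n (alpha i) else 0)) (bas \<kappa>) = 0"
    if "i \<in> {1..n}" "j \<in> {1..n}" for i j
  proof -
    have "1 \<le> i" "1 \<le> j" using that by auto
    note EF = opEF_comm[OF this] opEF_comm[OF this(2,1)]
    have m: "qnum (cc lam \<kappa> j - cc lam \<kappa> (j - Suc 0)) = - qnum (cc lam \<kappa> (j - Suc 0) - cc lam \<kappa> j)"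
      using qnum_minus[of "cc lam \<kappa> (j - Suc 0) - cc lam \<kappa> j"] by simp
    show ?thesis
      using EF[of lam \<kappa>] that
      by (auto simp: l act_EF act_cartan_bas cartan_weight_alpha sg_def act_0_left algebra_simps m)
  qed
  have S: "act s n lam (serre (ee i) (ee j)) (bas \<kappa>) = 0" "act s n lam (serre (ff i) (ff j)) (bas \<kappa>) = 0"
    if "i \<in> {1..n}" "j \<in> {1..n}" "j = i + 1 \<or> i = j + 1" for i j
    using that serre_op_eq[of i lam \<kappa>] serre_op_eq[of j lam \<kappa>] by (auto simp: act_serre act_EF)
  have C: "act s n lam (ee i * ee j - ee j * ee i) (bas \<kappa>) = 0" "act s n lam (ff i * ff j - ff j * ff i) (bas \<kappa>) = 0"
    if "i \<in> {1..n}" "j \<in> {1..n}" "i + 1 < j \<or> j + 1 < i" for i j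
    using that opE_comm[of i j lam \<kappa>] opE_comm[of j i lam \<kappa>] by (auto simp: l act_EF)
  have G: "act s n lam (gen g) (bas \<kappa>) = 0" if "g \<notin> gens n" for g
    using that by (cases g) (auto simp: act_gen gens_def)
  show ?thesis
    using assms unfolding relators_def by (elim UnE CollectE exE conjE; simp only:) (rule G HH H EF S C; simp)+
qed

text \<open>The annihilator of the whole oscillator space is a closed two-sided ideal, so the
  relators decide.\<close>

lemma rel_ideal_act:
  assumes "u \<in> rel_ideal n"
  shows "act s n lam u t = 0"
proof -
  define Z where "Z = {u. \<forall>t. act s n lam u t = 0}"
  have "closed Z"
  proof -
    have "Z = (\<Inter>t. {u. act s n lam u t \<in> {0}})" by (auto simp: Z_def)
    then show ?thesis using closed_vimage_hlin[OF hlin_act_left closed_zero] by auto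
  qed
  moreover have "two_sided_ideal Z"
    by (simp add: two_sided_ideal_def left_ideal_def additive_def Z_def act_diff_left act_mult act_0 act_0_left)
  moreover have "relators n \<subseteq> Z"
    unfolding Z_def using hlin_zeroI[OF hlin_act relators_act_bas] by blast
  ultimately have "rel_ideal n \<subseteq> Z"
    unfolding rel_ideal_def by (intro hull_minimal conjI)
  then show ?thesis using assms by (auto simp: Z_def)
qed

section \<open>The left ideals of the two modules\<close>

definition JJ :: "bool \<Rightarrow> nat \<Rightarrow> complex \<Rightarrow> alg set" where
  "JJ s n lam = (if s then J_plus n lam else J_minus n lam)"

lemma JJ_def':
  "JJ s n lam = (\<lambda>S. left_ideal S \<and> closed S) hull
     (rel_ideal n \<union> (\<lambda>i. gen (hi s i)) ` {1..n} \<union> (\<lambda>i. gen (lo s i)) ` {2..n}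
      \<union> {gen (Hgen a) - scal (fps_const (sg s * (lam * form n (eps a) (eps 1)))) |a. a \<in> {1..n + 1}})"
  by (simp add: JJ_def J_plus_def J_minus_def hi_def lo_def sg_def scal_minus flip: fps_const_neg)

lemma JJ_left_ideal: "left_ideal (JJ s n lam)" and JJ_closed: "closed (JJ s n lam)"
proof -
  have "left_ideal (JJ s n lam) \<and> closed (JJ s n lam)"
    unfolding JJ_def' by (rule hull_in) (auto intro!: left_ideal_Inter closed_Inter)
  then show "left_ideal (JJ s n lam)" "closed (JJ s n lam)" by blast+
qed

lemma JJ_hmodule: "hmodule (JJ s n lam)"
  by (rule left_ideal_hmodule) (rule JJ_left_ideal)

lemma JJ_lmult: "x \<in> JJ s n lam \<Longrightarrow> u * x \<in> JJ s n lam"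
  using JJ_left_ideal by (auto simp: left_ideal_def)

lemma JJ_hi: "i \<in> {1..n} \<Longrightarrow> gen (hi s i) \<in> JJ s n lam"
  and JJ_lo: "i \<in> {2..n} \<Longrightarrow> gen (lo s i) \<in> JJ s n lam"
  and JJ_rel: "u \<in> rel_ideal n \<Longrightarrow> u \<in> JJ s n lam"
  and JJ_H: "a \<in> {1..n + 1} \<Longrightarrow> gen (Hgen a) - scal (fps_const (sg s * (lam * form n (eps a) (eps 1)))) \<in> JJ s n lam"
  unfolding JJ_def' by (rule hull_inc; blast)+

lemma cc_0: "cc lam 0 j = (if j = 0 then lam else 0)"
  by (simp add: cc_def)

text \<open>The annihilator of a single vector is a closed left ideal. At exponent 0 all exponents
  but that of z_0 vanish, and [0] = 0 kills the required generators.\<close>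

lemma JJ_act:
  assumes "u \<in> JJ s n lam"
  shows "act s n lam u (bas 0) = 0"
proof -
  define Z where "Z = {u. act s n lam u (bas 0) \<in> {0}}"
  have "left_ideal Z \<and> closed Z"
    using closed_vimage_hlin[OF hlin_act_left closed_zero, of s n lam "bas 0"]
    by (simp add: left_ideal_def additive_def Z_def act_diff_left act_mult act_0 act_0_left)
  moreover have "gen (Hgen a) - scal (fps_const (sg s * (lam * form n (eps a) (eps 1)))) \<in> Z" if "a \<in> {1..n + 1}" for a
    using that by (simp add: Z_def act_diff_left act_H act_scal form_eps cc_0)
      (auto simp: eps_def)
  then have "(rel_ideal n \<union> (\<lambda>i. gen (hi s i)) ` {1..n} \<union> (\<lambda>i. gen (lo s i)) ` {2..n}
      \<union> {gen (Hgen a) - scal (fps_const (sg s * (lam * form n (eps a) (eps 1)))) |a. a \<in> {1..n + 1}}) \<subseteq> Z"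
    by (auto simp: Z_def rel_ideal_act act_hi act_lo opE_bas opF_bas cc_0)
  ultimately have "JJ s n lam \<subseteq> Z"
    unfolding JJ_def' by (intro hull_minimal)
  then show ?thesis using assms by (auto simp: Z_def)
qed

section \<open>The annihilator of the generator\<close>

lemma serre_family_lo: "serre_family (rel_ideal n) n (\<lambda>i. gen (lo s i))"
  using serre_family_ee serre_family_ff by (cases s) (simp_all add: lo_def)

lemma rel_EF:
  assumes "i \<in> {1..n}" "j \<in> {1..n}"
  shows "ee i * ff j - ff j * ee i - (if i = j then qnum_cartan n (alpha i) else 0) \<in> rel_ideal n"
  by (rule relators_rel_ideal) (use assms in \<open>unfold relators_def, blast\<close>)

lemma rel_H_ee:
  assumes "a \<in> {1..n + 1}" "i \<in> {1..n}"
  shows "gen (Hgen a) * ee i - ee i * gen (Hgen a) - fps_const (alpha i a) \<star> ee i \<in> rel_ideal n"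
proof -
  have "gen (Hgen a) * ee i - ee i * gen (Hgen a) - scal (fps_const (form n (eps a) (alpha i))) * ee i \<in> rel_ideal n"
    by (rule relators_rel_ideal) (use assms in \<open>unfold relators_def, blast\<close>)
  then show ?thesis using assms by (simp add: form_eps flip: smul_def)
qed

lemma rel_H_ff:
  assumes "a \<in> {1..n + 1}" "i \<in> {1..n}"
  shows "gen (Hgen a) * ff i - ff i * gen (Hgen a) + fps_const (alpha i a) \<star> ff i \<in> rel_ideal n"
proof -
  have "gen (Hgen a) * ff i - ff i * gen (Hgen a) + scal (fps_const (form n (eps a) (alpha i))) * ff i \<in> rel_ideal n"
    by (rule relators_rel_ideal) (use assms in \<open>unfold relators_def, blast\<close>)
  then show ?thesis using assms by (simp add: form_eps flip: smul_def)
qed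

lemma rel_H_lo:
  assumes "a \<in> {1..n + 1}" "i \<in> {1..n}"
  shows "\<exists>c. gen (Hgen a) * gen (lo s i) - (gen (lo s i) * gen (Hgen a) + c \<star> gen (lo s i)) \<in> rel_ideal n"
proof (cases s)
  case True
  then show ?thesis
    using rel_H_ff[OF assms]
    by (intro exI[of _ "- fps_const (alpha i a)"]) (simp add: lo_def algebra_simps del: fps_const_neg)
next
  case False
  then show ?thesis
    using rel_H_ee[OF assms] by (intro exI[of _ "fps_const (alpha i a)"]) (simp add: lo_def algebra_simps)
qed

lemma rel_hi_lo:
  assumes "i \<in> {1..n}" "j \<in> {1..n}"
  shows "gen (hi s i) * gen (lo s j) - (gen (lo s j) * gen (hi s i)
    + (if i = j then fps_const (sg s) \<star> qnum_cartan n (alpha i) else 0)) \<in> rel_ideal n"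
proof (cases s)
  case True
  then show ?thesis
    using rel_EF[OF assms] by (cases "i = j") (simp_all add: lo_def hi_def sg_def algebra_simps)
next
  case False
  have "- (ee j * ff i - ff i * ee j - (if j = i then qnum_cartan n (alpha j) else 0)) \<in> rel_ideal n"
    using rel_EF[OF assms(2,1)] by (rule hmodule_uminus[OF two_sided_hmodule[OF rel_ideal_ideal]])
  then show ?thesis
    using False by (cases "i = j") (simp_all add: lo_def hi_def sg_def algebra_simps fps_const_neg_smul)
qed

text \<open>The exponent of z_i / z_0: the shift caused by the root vector of weight minus
  \<open>beta i\<close> in the first module, plus \<open>beta i\<close> in the second.\<close>

definition bet :: "nat \<Rightarrow> lat" where
  "bet i = single i 1 - single 0 1"

lemma bet_Suc: "bet (Suc i) = bet i + del (Suc i)"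
  by (simp add: bet_def del_def)

lemma lookup_bet: "lookup (bet i) j = (if j = i then 1 else 0) - (if j = 0 then 1 else 0)"
  by (auto simp: bet_def lookup_minus lookup_single when_def simp del: single_one)

lemma cc_nonzero: "j \<noteq> 0 \<Longrightarrow> cc lam \<kappa> j = of_int (lookup \<kappa> j)"
  by (simp add: cc_def)

text \<open>The two orders in the outer bracket differ by [k + 1] - q^-1 [k] = q^k, where k is the
  exponent of the variable passed. The sum in the exponent of q collects these k.\<close>

lemma act_yv:
  assumes "1 \<le> i" "i \<le> n"
  shows "act s n lam (yv (\<lambda>i. gen (lo s i)) i) (bas \<kappa>)
    = (qnum (cc lam \<kappa> 0) * qpw (of_int (\<Sum>j=1..<i. lookup \<kappa> j))) \<star> bas (\<kappa> + bet i)"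
  using assms
proof (induction i arbitrary: \<kappa> rule: dec_induct)
  case base
  then show ?case by (simp add: act_lo opF_bas bet_def del_def)
next
  case (step i)
  let ?Y = "yv (\<lambda>i. gen (lo s i)) i" and ?k = "lookup \<kappa>"
  define c where "c = qnum (cc lam \<kappa> 0) * qpw (of_int (\<Sum>j=1..<i. ?k j))"
  have Y: "yv (\<lambda>i. gen (lo s i)) (Suc i) = qcomm (qpw (- 1)) (gen (lo s (Suc i))) ?Y"
    using step by simp
  have lo: "act s n lam (gen (lo s (Suc i))) t = opF lam (Suc i) t" for t
    using step by (intro act_lo) auto
  have 1: "cc lam (\<kappa> + bet i) i = of_int (?k i) + 1"
    using step by (simp add: cc_def lookup_add lookup_bet)
  have 2: "cc lam (\<kappa> + del (Suc i)) 0 = cc lam \<kappa> 0"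
    using step by (simp add: cc_del)
  have 3: "(\<Sum>j=1..<i. lookup (\<kappa> + del (Suc i)) j) = (\<Sum>j=1..<i. ?k j)"
    by (rule sum.cong) (auto simp: lookup_add lookup_del)
  have IH: "act s n lam ?Y (bas \<kappa>) = c \<star> bas (\<kappa> + bet i)"
    "act s n lam ?Y (bas (\<kappa> + del (Suc i))) = c \<star> bas (\<kappa> + del (Suc i) + bet i)"
    using step.IH[of \<kappa>] step.IH[of "\<kappa> + del (Suc i)"] step.prems unfolding 2 3 c_def by auto
  have p: "\<kappa> + bet i + del (Suc i) = \<kappa> + bet (Suc i)" "\<kappa> + del (Suc i) + bet i = \<kappa> + bet (Suc i)"
    by (simp_all add: bet_Suc algebra_simps)
  have k: "cc lam \<kappa> i = of_int (?k i)"
    using step by (intro cc_nonzero) auto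
  have "act s n lam (yv (\<lambda>i. gen (lo s i)) (Suc i)) (bas \<kappa>)
      = (c * qnum (of_int (?k i) + 1)) \<star> bas (\<kappa> + bet (Suc i))
        - (qpw (- 1) * (qnum (of_int (?k i)) * c)) \<star> bas (\<kappa> + bet (Suc i))"
    unfolding Y qcomm_conv act_diff_left act_smul_left act_mult lo IH
    by (simp add: op_smul opF_bas act_smul IH 1 p k)
  also have "\<dots> = (c * (qnum (of_int (?k i) + 1) - qpw (- 1) * qnum (of_int (?k i)))) \<star> bas (\<kappa> + bet (Suc i))"
    by (simp add: hs.scale_left_diff_distrib right_diff_distrib mult_ac)
  also have "qnum (of_int (?k i) + 1) - qpw (- 1) * qnum (of_int (?k i)) = qpw (of_int (?k i))"
    unfolding qnum_add_1' by simp
  also have "c * qpw (of_int (?k i)) = qnum (cc lam \<kappa> 0) * qpw (of_int (\<Sum>j=1..<Suc i. ?k j))"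
    using step(1) by (simp add: c_def mult.assoc qpw_mult)
  finally show ?case .
qed

section \<open>Ordered words of root vectors modulo the left ideal\<close>

locale osc_mod =
  fixes s :: bool and n :: nat and lam :: complex
  assumes lam: "lam \<notin> \<nat>"
begin

sublocale lo: serre_family "rel_ideal n" n "\<lambda>i. gen (lo s i)"
  by (rule serre_family_lo)

abbreviation "Y \<equiv> yv (\<lambda>i. gen (lo s i))"
abbreviation "A \<equiv> act s n lam"
abbreviation "J \<equiv> JJ s n lam"

definition kap :: "nat list \<Rightarrow> lat" where "kap ws = sum_list (map bet ws)"
definition yw :: "nat list \<Rightarrow> alg" where "yw ws = prod_list (map Y ws)"

lemma kap_simps [simp]: "kap [] = 0" "kap (i # ws) = bet i + kap ws"
  and yw_simps [simp]: "yw [] = 1" "yw (i # ws) = Y i * yw ws"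
  by (simp_all add: kap_def yw_def)

lemma lookup_kap:
  assumes "set ws \<subseteq> {1..n}"
  shows "lookup (kap ws) 0 = - int (length ws)"
    and "j \<noteq> 0 \<Longrightarrow> lookup (kap ws) j = int (count_list ws j)"
  using assms by (induction ws) (auto simp: lookup_add lookup_bet)

lemma kap_sorted_inj:
  assumes "sorted ws" "sorted ws'" "set ws \<subseteq> {1..n}" "set ws' \<subseteq> {1..n}" "kap ws = kap ws'"
  shows "ws = ws'"
proof -
  have "count_list ws j = count_list ws' j" for j
  proof (cases "j = 0")
    case True
    then have "j \<notin> set ws" "j \<notin> set ws'" using assms by auto
    then show ?thesis by (simp add: count_list_0_iff)
  next
    case False
    then show ?thesis using lookup_kap(2) assms by (metis of_nat_eq_iff)
  qed
  then have "mset ws = mset ws'" by (intro multiset_eqI) (simp add: count_mset)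
  then show ?thesis using assms(1,2) by (metis properties_for_sort)
qed

text \<open>A root vector applied after m others contributes [\<lambda> - m] times a power of q, a
  unit by the assumption on \<lambda>.\<close>

lemma act_yw:
  assumes "set ws \<subseteq> {1..n}"
  shows "\<exists>c. fps_nth c 0 \<noteq> 0 \<and> A (yw ws) (bas 0) = c \<star> bas (kap ws)"
  using assms
proof (induction ws)
  case Nil
  then show ?case by (intro exI[of _ 1]) (simp add: act_1)
next
  case (Cons i ws)
  then obtain c where c: "fps_nth c 0 \<noteq> 0" "A (yw ws) (bas 0) = c \<star> bas (kap ws)" by auto
  define d where "d = qnum (cc lam (kap ws) 0) * qpw (of_int (\<Sum>j=1..<i. lookup (kap ws) j))"
  have "cc lam (kap ws) 0 = lam - of_nat (length ws)"
    using Cons by (simp add: cc_def lookup_kap)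
  moreover have "lam \<noteq> of_nat (length ws)" using lam by (metis of_nat_in_Nats)
  ultimately have "fps_nth d 0 \<noteq> 0" by (simp add: d_def qnum_nth_0)
  moreover have "A (yw (i # ws)) (bas 0) = (c * d) \<star> bas (kap (i # ws))"
    using Cons by (simp add: act_mult c act_smul act_yv d_def add.commute)
  ultimately show ?case using c(1) by (intro exI[of _ "c * d"]) simp
qed

text \<open>Dividing by the coefficient, a unit, makes the ordered word act as the monomial itself.
  Exponents that no word reaches are sent to 0.\<close>

definition sec :: "lat \<Rightarrow> alg" where
  "sec \<kappa> = (if \<exists>ws. sorted ws \<and> set ws \<subseteq> {1..n} \<and> kap ws = \<kappa>
     then let ws = THE ws. sorted ws \<and> set ws \<subseteq> {1..n} \<and> kap ws = \<kappa>
       in inverse (coord \<kappa> (A (yw ws) (bas 0))) \<star> yw ws else 0)"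

lemma sec_kap:
  assumes "sorted ws" "set ws \<subseteq> {1..n}"
  obtains c where "fps_nth c 0 \<noteq> 0" "A (yw ws) (bas 0) = c \<star> bas (kap ws)" "sec (kap ws) = inverse c \<star> yw ws"
proof -
  obtain c where c: "fps_nth c 0 \<noteq> 0" "A (yw ws) (bas 0) = c \<star> bas (kap ws)"
    using act_yw assms by blast
  have "(THE ws'. sorted ws' \<and> set ws' \<subseteq> {1..n} \<and> kap ws' = kap ws) = ws"
    using assms kap_sorted_inj by (intro the_equality) auto
  then have "sec (kap ws) = inverse c \<star> yw ws"
    using assms c unfolding sec_def by (auto simp: Let_def coord_bas)
  with c show ?thesis using that by blast
qed

lemma sec_other: "\<nexists>ws. sorted ws \<and> set ws \<subseteq> {1..n} \<and> kap ws = \<kappa> \<Longrightarrow> sec \<kappa> = 0"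
  unfolding sec_def by (rule if_not_P)

text \<open>
  The map \<open>ext sec\<close> is a section of the action on the generator. \<open>good\<close> turns out to be everything,
  because it contains 1 and is stable under all generators.
\<close>

definition good :: "alg set" where
  "good = {u. u - ext sec (A u (bas 0)) \<in> J}"

lemma good_hmodule: "hmodule good" and good_closed: "closed good"
proof -
  have "hlin (\<lambda>u. u - ext sec (A u (bas 0)))"
    by (intro hlin_diff_fun hlin_id hlin_comp[OF hlin_ext hlin_act_left])
  then show "hmodule good" "closed good"
    unfolding good_def
    by (rule hmodule_vimage[OF _ JJ_hmodule], rule closed_vimage_hlin[OF _ JJ_closed])
qed

lemma good_J: "u \<in> J \<Longrightarrow> u \<in> good"
  by (simp add: good_def JJ_act hlin_0[OF hlin_ext])

lemma good_cong: "u - u' \<in> rel_ideal n \<Longrightarrow> u' \<in> good \<Longrightarrow> u \<in> good"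
  using hmodule_add[OF good_hmodule good_J[OF JJ_rel]] by fastforce

lemma good_sorted: "sorted ws \<Longrightarrow> set ws \<subseteq> {1..n} \<Longrightarrow> yw ws \<in> good"
proof -
  assume "sorted ws" "set ws \<subseteq> {1..n}"
  then obtain c where c: "fps_nth c 0 \<noteq> 0" "A (yw ws) (bas 0) = c \<star> bas (kap ws)"
    "sec (kap ws) = inverse c \<star> yw ws" by (rule sec_kap)
  have "c * inverse c = 1" using c(1) by (metis inverse_mult_eq_1 mult.commute)
  then show ?thesis
    using c by (simp add: good_def hlin_smul[OF hlin_ext] hmodule_0[OF JJ_hmodule])
qed

text \<open>Modulo J a good element equals \<open>ext sec\<close> of its value, a limit of
  combinations of ordered words. So stability under x need only be tested on ordered words.\<close>

lemma good_lmult: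
  assumes x: "\<And>ws. sorted ws \<Longrightarrow> set ws \<subseteq> {1..n} \<Longrightarrow> x * yw ws \<in> good" and u: "u \<in> good"
  shows "x * u \<in> good"
proof -
  let ?T = "{t. x * ext sec t \<in> good}"
  have l: "hlin (\<lambda>t. x * ext sec t)" by (rule hlin_comp[OF hlin_lmult hlin_ext])
  have "bas \<kappa> \<in> ?T" for \<kappa>
  proof (cases "\<exists>ws. sorted ws \<and> set ws \<subseteq> {1..n} \<and> kap ws = \<kappa>")
    case True
    then obtain ws where ws: "sorted ws" "set ws \<subseteq> {1..n}" "kap ws = \<kappa>" by blast
    then obtain c where "sec \<kappa> = inverse c \<star> yw ws" using sec_kap[OF ws(1,2)] by metis
    then show ?thesis using x[OF ws(1,2)] by (simp add: hmodule_smul[OF good_hmodule])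
  next
    case False
    then show ?thesis by (simp add: sec_other hmodule_0[OF good_hmodule])
  qed
  then have "A u (bas 0) \<in> ?T"
    by (rule closed_hmodule_UNIV[OF hmodule_vimage[OF l good_hmodule] closed_vimage_hlin[OF l good_closed]])
  moreover have "x * (u - ext sec (A u (bas 0))) \<in> good"
    using u by (intro good_J JJ_lmult) (simp add: good_def)
  ultimately show ?thesis
    using hmodule_add[OF good_hmodule] by (fastforce simp: right_diff_distrib)
qed

text \<open>Insertion sort by \<open>yv_qcomm\<close>: every exchange costs a factor q and produces
  no further terms.\<close>

lemma Y_insort:
  assumes "i \<in> {1..n}" "set ws \<subseteq> {1..n}"
  shows "\<exists>c. Y i * yw ws - c \<star> yw (insort i ws) \<in> rel_ideal n"
  using assms(2)
proof (induction ws)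
  case Nil
  then show ?case using lo.I_0 by (intro exI[of _ 1]) simp
next
  case (Cons x ws)
  show ?case
  proof (cases "i \<le> x")
    case True
    then show ?thesis using lo.I_0 by (intro exI[of _ 1]) simp
  next
    case False
    obtain c where c: "Y i * yw ws - c \<star> yw (insort i ws) \<in> rel_ideal n" using Cons by auto
    have r: "Y i * Y x - qpw 1 \<star> (Y x * Y i) \<in> rel_ideal n"
      using lo.yv_qcomm[of x i] False Cons assms by auto
    have "(Y i * Y x - qpw 1 \<star> (Y x * Y i)) * yw ws + qpw 1 \<star> (Y x * (Y i * yw ws - c \<star> yw (insort i ws))) \<in> rel_ideal n"
      by (intro lo.I_add lo.I_r r lo.I_smul lo.I_l c)
    then have "Y i * yw (x # ws) - (qpw 1 * c) \<star> yw (insort i (x # ws)) \<in> rel_ideal n"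
      using False by (simp add: algebra_simps hs.scale_right_diff_distrib)
    then show ?thesis by blast
  qed
qed

lemma good_Y: "i \<in> {1..n} \<Longrightarrow> u \<in> good \<Longrightarrow> Y i * u \<in> good"
proof (rule good_lmult)
  fix ws assume i: "i \<in> {1..n}" and ws: "sorted ws" "set ws \<subseteq> {1..n}"
  obtain c where c: "Y i * yw ws - c \<star> yw (insort i ws) \<in> rel_ideal n" using Y_insort i ws by blast
  have "yw (insort i ws) \<in> good"
    using i ws by (intro good_sorted) (auto simp: sorted_insort set_insort_key)
  then show "Y i * yw ws \<in> good"
    using good_cong[OF c] hmodule_smul[OF good_hmodule] by blast
qed

lemma good_1: "1 \<in> good"
  using good_sorted[of "[]"] by simp

lemma good_lo:
  assumes j: "j \<in> {1..n}" and u: "u \<in> good"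
  shows "gen (lo s j) * u \<in> good"
proof (rule good_lmult[OF _ u])
  fix ws assume "set ws \<subseteq> {1..n}"
  \<comment> \<open>Here b = 1: the lowering generators of index at least 2 lie in J, as they
    annihilate the generator of the module.\<close>
  then have "gen (lo s j) * (prod_list (map Y ws) * 1) \<in> good"
    by (intro lo.g_yv_word_mem[OF good_hmodule _ good_Y good_1 _ j])
      (auto simp: JJ_lo intro: good_J JJ_rel)
  then show "gen (lo s j) * yw ws \<in> good" by (simp add: yw_def)
qed

lemma Y_stable:
  assumes "hmodule S" "\<And>j u. j \<in> {1..n} \<Longrightarrow> u \<in> S \<Longrightarrow> gen (lo s j) * u \<in> S" "1 \<le> i" "i \<le> n" "u \<in> S"
  shows "Y i * u \<in> S"
  using assms(3-5)
proof (induction i arbitrary: u rule: dec_induct)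
  case base
  then show ?case using assms(2)[of 1 u] by simp
next
  case (step i)
  then show ?case
    unfolding lo.yv_step[OF step(1)] qcomm_conv left_diff_distrib smul_mult_left mult.assoc
    by (intro hmodule_diff[OF assms(1)] hmodule_smul[OF assms(1)] assms(2) step.IH) auto
qed

lemma yw_stable:
  assumes "hmodule S" "\<And>j u. j \<in> {1..n} \<Longrightarrow> u \<in> S \<Longrightarrow> gen (lo s j) * u \<in> S" "1 \<in> S" "set ws \<subseteq> {1..n}"
  shows "yw ws \<in> S"
  using assms(4) by (induction ws) (auto intro!: Y_stable[OF assms(1,2)] assms(3))

text \<open>The good elements that stay good after multiplication by the Cartan generator are stable
  under the lowering generators, since commuting costs only a multiple of the latter. Hence they
  contain all words of root vectors.\<close>

lemma good_H:
  assumes a: "a \<in> {1..n + 1}" and u: "u \<in> good"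
  shows "gen (Hgen a) * u \<in> good"
proof -
  let ?S = "{u \<in> good. gen (Hgen a) * u \<in> good}"
  have "hmodule ?S"
    by (rule hmoduleI) (auto simp: distrib_left intro: hmodule_0 hmodule_add hmodule_smul good_hmodule)
  moreover have "gen (lo s j) * v \<in> ?S" if j: "j \<in> {1..n}" and v: "v \<in> ?S" for j v
  proof -
    obtain c where c: "gen (Hgen a) * gen (lo s j) - (gen (lo s j) * gen (Hgen a) + c \<star> gen (lo s j)) \<in> rel_ideal n"
      using rel_H_lo[OF a j, of s] by blast
    have "gen (Hgen a) * (gen (lo s j) * v) \<in> good"
    proof (rule good_cong)
      show "gen (Hgen a) * (gen (lo s j) * v) - (gen (lo s j) * (gen (Hgen a) * v) + c \<star> (gen (lo s j) * v)) \<in> rel_ideal n"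
        using lo.I_r[OF c, of v] by (simp add: algebra_simps)
      show "gen (lo s j) * (gen (Hgen a) * v) + c \<star> (gen (lo s j) * v) \<in> good"
        using j v by (intro hmodule_add[OF good_hmodule] hmodule_smul[OF good_hmodule] good_lo) auto
    qed
    then show ?thesis using j v good_lo by blast
  qed
  moreover have "gen (Hgen a) \<in> good"
  proof -
    have "gen (Hgen a) - scal (fps_const (sg s * (lam * form n (eps a) (eps 1)))) \<in> good"
      using a by (intro good_J JJ_H)
    moreover have "scal (fps_const (sg s * (lam * form n (eps a) (eps 1)))) \<in> good"
      unfolding scal_conv by (intro hmodule_smul[OF good_hmodule] good_1)
    ultimately show ?thesis using hmodule_cong[OF good_hmodule] by blast
  qed
  then have "1 \<in> ?S" by (simp add: good_1)
  ultimately have "yw ws \<in> ?S" if "set ws \<subseteq> {1..n}" for ws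
    using yw_stable[of ?S ws] that by blast
  then have "gen (Hgen a) * yw ws \<in> good" if "set ws \<subseteq> {1..n}" for ws
    using that by blast
  then show ?thesis by (rule good_lmult[OF _ u])
qed

text \<open>In every order of h these elements are polynomials in Cartan generators, and
  \<open>good\<close> is closed under h-adic limits.\<close>

lemma good_cartan_stable:
  assumes "u \<in> good"
  shows "qcartan n \<mu> * u \<in> good" "qnum_cartan n \<mu> * u \<in> good"
proof -
  note m = hmodule_smul[OF good_hmodule]
  have c: "cartan n \<mu> * u \<in> good" if "u \<in> good" for u \<mu>
    unfolding cartan_conv sum_distrib_right smul_mult_left
    by (intro hmodule_sum[OF good_hmodule] m good_H that)
  have p: "cartan n \<mu> ^ k * u \<in> good" for k \<mu>
    using assms by (induction k) (simp_all add: mult.assoc c)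
  define S where "S = {v. v * u \<in> good}"
  have S: "hmodule S" "closed S"
    unfolding S_def
    by (rule hmodule_vimage[OF hlin_rmult good_hmodule]) (rule closed_vimage_hlin[OF hlin_rmult good_closed])
  have k: "fps_const (fps_nth (qcartan n \<mu>) k) \<in> S" for k \<mu>
    unfolding S_def qcartan_coeff by (simp add: m p)
  then have "qcartan n \<mu> \<in> S" using closed_hmodule_coeffI[OF S] by blast
  then show "qcartan n \<mu> * u \<in> good" by (simp add: S_def)
  have "fps_shift 1 (qcartan n \<mu> - qcartan n (\<lambda>a. - \<mu> a)) \<in> S"
  proof (rule closed_hmodule_coeffI[OF S])
    fix k
    have "fps_const (fps_nth (fps_shift 1 (qcartan n \<mu> - qcartan n (\<lambda>a. - \<mu> a))) k)
        = fps_const (fps_nth (qcartan n \<mu>) (k + 1)) - fps_const (fps_nth (qcartan n (\<lambda>a. - \<mu> a)) (k + 1))"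
      by simp
    then show "fps_const (fps_nth (fps_shift 1 (qcartan n \<mu> - qcartan n (\<lambda>a. - \<mu> a))) k) \<in> S"
      using hmodule_diff[OF S(1) k k] by metis
  qed
  then show "qnum_cartan n \<mu> * u \<in> good"
    unfolding qnum_cartan_def smul_def[symmetric] by (simp add: S_def m)
qed

text \<open>The closure argument of \<open>good_H\<close>. Commuting a raising past a lowering
  generator now leaves a Cartan term, whose stability was secured beforehand.\<close>

lemma good_hi:
  assumes i: "i \<in> {1..n}" and u: "u \<in> good"
  shows "gen (hi s i) * u \<in> good"
proof -
  let ?S = "{u \<in> good. gen (hi s i) * u \<in> good}"
  note m = hmodule_add[OF good_hmodule] hmodule_smul[OF good_hmodule]
  have "hmodule ?S"
    by (rule hmoduleI) (auto simp: distrib_left intro: hmodule_0 hmodule_add hmodule_smul good_hmodule)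
  moreover have "gen (lo s j) * v \<in> ?S" if "j \<in> {1..n}" "v \<in> ?S" for j v
  proof -
    let ?q = "if i = j then fps_const (sg s) \<star> qnum_cartan n (alpha i) else 0"
    have "gen (hi s i) * (gen (lo s j) * v) \<in> good"
    proof (rule good_cong)
      show "gen (hi s i) * (gen (lo s j) * v) - (gen (lo s j) * (gen (hi s i) * v) + ?q * v) \<in> rel_ideal n"
        using lo.I_r[OF rel_hi_lo[OF i that(1), of s], of v] by (simp add: algebra_simps)
      show "gen (lo s j) * (gen (hi s i) * v) + ?q * v \<in> good"
        using that by (intro m good_lo) (auto intro: m good_cartan_stable hmodule_0 good_hmodule)
    qed
    then show ?thesis using that good_lo by blast
  qed
  moreover have "1 \<in> ?S" using i by (simp add: good_1 good_J JJ_hi)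
  ultimately have "yw ws \<in> ?S" if "set ws \<subseteq> {1..n}" for ws
    using yw_stable[of ?S ws] that by blast
  then have "gen (hi s i) * yw ws \<in> good" if "set ws \<subseteq> {1..n}" for ws
    using that by blast
  then show ?thesis by (rule good_lmult[OF _ u])
qed

lemma good_gen:
  assumes "u \<in> good"
  shows "gen g * u \<in> good"
proof (cases "g \<in> gens n")
  case True
  then consider i where "g = lo s i" "i \<in> {1..n}" | i where "g = hi s i" "i \<in> {1..n}"
    | a where "g = Hgen a" "a \<in> {1..n + 1}"
    by (cases s) (auto simp: gens_def lo_def hi_def)
  then show ?thesis by cases (auto intro: good_lo good_hi good_H assms)
next
  case False
  then have "gen g \<in> relators n" unfolding relators_def by blast
  then have "gen g \<in> rel_ideal n" by (rule relators_rel_ideal)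
  then show ?thesis by (intro good_J JJ_rel lo.I_r)
qed

lemma good_UNIV: "u \<in> good"
proof (rule closed_hmodule_UNIV[OF good_hmodule good_closed])
  fix w :: word
  have "bas (Word gs) \<in> good" for gs
  proof (induction gs)
    case Nil
    then show ?case using good_1 by (simp add: bas_0 flip: zero_word_def)
  next
    case (Cons g gs)
    have "gen g * bas (Word gs) = bas (Word (g # gs))"
      by (simp add: gen_conv bas_mult plus_word_def)
    then show ?case using good_gen[OF Cons, of g] by simp
  qed
  then show "bas w \<in> good" by (cases w) simp
qed

text \<open>All elements are good, and for a good element of value 0 the correction by
  \<open>ext sec\<close> vanishes. Thus membership in the ideal is decided on a single
  monomial.\<close>

theorem JJ_eq_kernel: "u \<in> J \<longleftrightarrow> A u (bas 0) = 0"
proof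
  assume "A u (bas 0) = 0"
  then show "u \<in> J" using good_UNIV[of u] by (simp add: good_def hlin_0[OF hlin_ext])
qed (rule JJ_act)

end

section \<open>Weight bases\<close>

lemma hlin_mem:
  assumes "hlin f" "hmodule S" "closed S" "\<And>k. f (bas k) \<in> S"
  shows "f x \<in> S"
proof -
  have "bas k \<in> {x. f x \<in> S}" for k using assms(4) by simp
  then have "x \<in> {x. f x \<in> S}"
    by (rule closed_hmodule_UNIV[OF hmodule_vimage[OF assms(1,2)] closed_vimage_hlin[OF assms(1,3)]])
  then show ?thesis by simp
qed

text \<open>Exponents k_1, ..., k_n >= 0 for z_1, ..., z_n and minus their sum for z_0: the part of
  the lattice that is generated from exponent 0.\<close>

definition supp :: "nat \<Rightarrow> lat set" where
  "supp n = {\<kappa>. keys \<kappa> \<subseteq> {..n} \<and> (\<forall>j\<ge>1. 0 \<le> lookup \<kappa> j) \<and>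
     (\<Sum>j\<le>n. lookup \<kappa> j) = 0}"

definition supported :: "nat \<Rightarrow> osc \<Rightarrow> bool" where
  "supported n t \<longleftrightarrow> (\<forall>\<kappa>. \<kappa> \<notin> supp n \<longrightarrow> coord \<kappa> t = 0)"

text \<open>The coordinate projection to the supported series. It presents them as the kernel of a
  linear map, which makes them a closed submodule.\<close>

definition cut :: "nat \<Rightarrow> osc \<Rightarrow> osc" where
  "cut n = ext (\<lambda>\<kappa>. if \<kappa> \<in> supp n then bas \<kappa> else 0)"

text \<open>A scalar functional is multiplied by a basis vector, so that the principles for
  \<open>hlin\<close> maps apply to it. The same device returns for the counit and for the
  coefficient at exponent 0.\<close>

lemma hlin_coord: "hlin (\<lambda>t. coord \<kappa> t \<star> bas \<kappa>)"
  by (simp add: hlin_def hs.scale_left_distrib)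

lemma coord_cut: "coord \<kappa> (cut n t) = (if \<kappa> \<in> supp n then coord \<kappa> t else 0)"
proof -
  have "coord \<kappa> (cut n t) \<star> bas \<kappa> = (if \<kappa> \<in> supp n then coord \<kappa> t \<star> bas \<kappa> else 0)"
  proof (rule hlin_eqI[of "\<lambda>t. coord \<kappa> (cut n t) \<star> bas \<kappa>"])
    show "hlin (\<lambda>t. coord \<kappa> (cut n t) \<star> bas \<kappa>)"
      unfolding cut_def by (rule hlin_comp[OF hlin_coord hlin_ext])
    show "hlin (\<lambda>t. if \<kappa> \<in> supp n then coord \<kappa> t \<star> bas \<kappa> else 0)"
      by (cases "\<kappa> \<in> supp n") (simp_all add: hlin_coord hlin_zero_fun)
  qed (auto simp: cut_def coord_bas)
  then have "coord \<kappa> (coord \<kappa> (cut n t) \<star> bas \<kappa>) = coord \<kappa> (if \<kappa> \<in> supp n then coord \<kappa> t \<star> bas \<kappa> else 0)"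
    by simp
  then show ?thesis by (simp add: coord_bas split: if_splits)
qed

lemma supported_iff: "supported n t \<longleftrightarrow> cut n t = t"
proof
  assume "supported n t"
  then show "cut n t = t" by (intro hser_eqI) (simp add: coord_cut supported_def)
next
  assume "cut n t = t"
  then show "supported n t" by (metis coord_cut supported_def)
qed

lemma supported_hmodule: "hmodule {t. supported n t}" and supported_closed: "closed {t. supported n t}"
proof -
  have l: "hlin (\<lambda>t. cut n t - t)"
    unfolding cut_def by (intro hlin_diff_fun hlin_ext hlin_id)
  have e: "{t. supported n t} = {t. cut n t - t \<in> {0}}"
    by (simp add: supported_iff)
  show "hmodule {t. supported n t}" "closed {t. supported n t}"
    unfolding e by (rule hmodule_vimage[OF l hmodule_zero], rule closed_vimage_hlin[OF l closed_zero])
qed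

lemma supported_bas: "\<kappa> \<in> supp n \<Longrightarrow> supported n (bas \<kappa>)"
  by (auto simp: supported_def coord_bas)

lemma supported_smul: "supported n t \<Longrightarrow> supported n (c \<star> t)"
  by (simp add: supported_def)

lemma supported_0: "supported n 0"
  by (simp add: supported_def)

lemma hmodule_supported_induct:
  assumes "hlin f" "hmodule S" "closed S" "\<And>\<kappa>. \<kappa> \<in> supp n \<Longrightarrow> f (bas \<kappa>) \<in> S" "supported n t"
  shows "f t \<in> S"
proof -
  have l: "hlin (\<lambda>t. f (cut n t))"
    unfolding cut_def by (rule hlin_comp[OF assms(1) hlin_ext])
  have "f (cut n (bas \<kappa>)) \<in> S" for \<kappa>
    using assms(4) hmodule_0[OF assms(2)] by (cases "\<kappa> \<in> supp n") (simp_all add: cut_def hlin_0[OF assms(1)])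
  then have "f (cut n t) \<in> S" by (rule hlin_mem[OF l assms(2,3)])
  then show ?thesis using assms(5) by (simp add: supported_iff)
qed

lemma supported_hlin:
  assumes "hlin f" "\<And>\<kappa>. \<kappa> \<in> supp n \<Longrightarrow> supported n (f (bas \<kappa>))" "supported n t"
  shows "supported n (f t)"
  using hmodule_supported_induct[OF assms(1) supported_hmodule supported_closed _ assms(3)] assms(2) by simp

lemma supp_beyond: "\<kappa> \<in> supp n \<Longrightarrow> n < j \<Longrightarrow> lookup \<kappa> j = 0"
proof (rule ccontr)
  assume "\<kappa> \<in> supp n" "n < j" "lookup \<kappa> j \<noteq> 0"
  then have "j \<in> {..n}" by (auto simp: supp_def in_keys_iff subset_eq simp del: atMost_iff)
  then show False using \<open>n < j\<close> by simp
qed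

lemma supp_move:
  assumes "\<kappa> \<in> supp n" "i \<le> n" "j \<le> n" "i \<noteq> j" "j = 0 \<or> 1 \<le> lookup \<kappa> j"
  shows "\<kappa> + (single i 1 - single j 1) \<in> supp n"
proof -
  let ?d = "single i 1 - single j (1 :: int)"
  have l: "lookup ?d k = (if k = i then 1 else 0) - (if k = j then 1 else 0)" for k
    by (auto simp: lookup_minus lookup_single when_def simp del: single_one)
  have "keys (\<kappa> + ?d) \<subseteq> {..n}"
  proof
    fix k assume "k \<in> keys (\<kappa> + ?d)"
    then have "lookup \<kappa> k + ((if k = i then 1 else 0) - (if k = j then 1 else 0)) \<noteq> 0"
      unfolding in_keys_iff lookup_add l .
    then show "k \<in> {..n}" using supp_beyond[OF assms(1), of k] assms by (cases "n < k") (auto split: if_splits)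
  qed
  moreover have "(\<Sum>k\<le>n. lookup (\<kappa> + ?d) k) = 0"
    using assms by (simp add: supp_def lookup_add l sum.distrib sum_subtractf del: single_one)
  moreover have "0 \<le> lookup (\<kappa> + ?d) k" if "k \<ge> 1" for k
    using assms that by (auto simp: supp_def lookup_add l simp del: single_one)
  ultimately show ?thesis by (simp add: supp_def del: single_one)
qed

lemma zero_supp: "0 \<in> supp n"
  by (simp add: supp_def)

lemma supp_bet: "\<kappa> \<in> supp n \<Longrightarrow> 1 \<le> i \<Longrightarrow> i \<le> n \<Longrightarrow> \<kappa> + bet i \<in> supp n"
  unfolding bet_def by (rule supp_move) auto

lemma supp_minus_bet:
  assumes "\<kappa> \<in> supp n" "1 \<le> i" "i \<le> n" "1 \<le> lookup \<kappa> i"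
  shows "\<kappa> - bet i \<in> supp n"
  using supp_move[of \<kappa> n 0 i] assms by (simp add: bet_def diff_diff_eq2 algebra_simps del: single_one)

lemma supp_nonneg: "\<kappa> \<in> supp n \<Longrightarrow> 1 \<le> j \<Longrightarrow> 0 \<le> lookup \<kappa> j"
  by (simp add: supp_def)

text \<open>If a shift would make an exponent negative, that exponent is 0, and its quantum number
  kills the term.\<close>

lemma op_supported:
  assumes "\<kappa> \<in> supp n" "i \<in> {1..n}"
  shows "supported n (opE lam i (bas \<kappa>))" "supported n (opF lam i (bas \<kappa>))"
proof -
  show "supported n (opE lam i (bas \<kappa>))"
  proof (cases "lookup \<kappa> i = 0")
    case True
    then show ?thesis using assms by (simp add: opE_bas cc_nonzero supported_0)
  next
    case False
    then have "1 \<le> lookup \<kappa> i" using supp_nonneg[OF assms(1), of i] assms by simp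
    then have "\<kappa> + (single (i - 1) 1 - single i 1) \<in> supp n"
      using assms by (intro supp_move) auto
    then have "\<kappa> - del i \<in> supp n" by (simp add: del_def algebra_simps del: single_one)
    then show ?thesis by (simp add: opE_bas supported_smul supported_bas)
  qed
  show "supported n (opF lam i (bas \<kappa>))"
  proof (cases "i - 1 = 0 \<or> lookup \<kappa> (i - 1) \<noteq> 0")
    case True
    then have "i - 1 = 0 \<or> 1 \<le> lookup \<kappa> (i - 1)"
      using supp_nonneg[OF assms(1), of "i - 1"] by (cases "i - 1 = 0") linarith+
    then have "\<kappa> + del i \<in> supp n"
      unfolding del_def using assms by (intro supp_move) auto
    then show ?thesis by (simp add: opF_bas supported_smul supported_bas)
  next
    case False
    then show ?thesis using assms by (simp add: opF_bas cc_nonzero supported_0)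
  qed
qed

lemma rho_supported: "\<kappa> \<in> supp n \<Longrightarrow> supported n (rho s n lam g (bas \<kappa>))"
  by (cases g) (auto simp: op_supported supported_0 opH_bas intro!: supported_smul supported_bas)

lemma act_supported:
  assumes "supported n t"
  shows "supported n (act s n lam u t)"
proof -
  have "supported n (foldr (rho s n lam) gs t)" for gs
    by (induction gs) (auto intro: assms supported_hlin[OF hlin_rho rho_supported])
  then have "act s n lam (bas w) t \<in> {t. supported n t}" for w
    by (simp add: act_bas)
  then have "act s n lam u t \<in> {t. supported n t}"
    by (rule hlin_mem[OF hlin_act_left supported_hmodule supported_closed])
  then show ?thesis by simp
qed

text \<open>The number of root vectors leading from exponent 0 to the monomial. On
  \<open>supp\<close> the exponent of z_0 is minus this number, so \<open>nat\<close> loses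
  nothing.\<close>

definition lev :: "lat \<Rightarrow> nat" where
  "lev \<kappa> = nat (- lookup \<kappa> 0)"

lemma supp_sum:
  assumes "\<kappa> \<in> supp n"
  shows "(\<Sum>j=1..n. lookup \<kappa> j) = - lookup \<kappa> 0"
proof -
  have "(\<Sum>j\<le>n. lookup \<kappa> j) = lookup \<kappa> 0 + (\<Sum>j=1..n. lookup \<kappa> j)"
    unfolding atMost_atLeast0 by (simp add: sum.atLeast_Suc_atMost)
  then show ?thesis using assms by (simp add: supp_def)
qed

lemma lookup_0_lev: "\<kappa> \<in> supp n \<Longrightarrow> lookup \<kappa> 0 = - int (lev \<kappa>)"
proof -
  assume k: "\<kappa> \<in> supp n"
  have "0 \<le> (\<Sum>j=1..n. lookup \<kappa> j)"
    by (rule sum_nonneg) (use k supp_nonneg in auto)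
  then show ?thesis using supp_sum[OF k] by (simp add: lev_def)
qed

lemma lookup_le_lev:
  assumes "\<kappa> \<in> supp n" "1 \<le> j" "j \<le> n"
  shows "lookup \<kappa> j \<le> int (lev \<kappa>)"
proof -
  have "lookup \<kappa> j \<le> (\<Sum>j=1..n. lookup \<kappa> j)"
    by (rule member_le_sum) (use assms supp_nonneg in auto)
  then show ?thesis using supp_sum[OF assms(1)] lookup_0_lev[OF assms(1)] by simp
qed

lemma lev_bet: "\<kappa> \<in> supp n \<Longrightarrow> 1 \<le> i \<Longrightarrow> i \<le> n \<Longrightarrow> lev (\<kappa> + bet i) = Suc (lev \<kappa>)"
  using lookup_0_lev[of \<kappa> n] lookup_0_lev[OF supp_bet, of \<kappa> n i] by (simp add: lookup_add lookup_bet)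

lemma lev_0: "\<kappa> \<in> supp n \<Longrightarrow> lev \<kappa> = 0 \<longleftrightarrow> \<kappa> = 0"
proof
  assume k: "\<kappa> \<in> supp n" and "lev \<kappa> = 0"
  then have "lookup \<kappa> j = 0" for j
    using lookup_0_lev[OF k] lookup_le_lev[OF k, of j] supp_nonneg[OF k, of j] supp_beyond[OF k, of j]
    by (cases "j = 0"; cases "j \<le> n") simp_all
  then show "\<kappa> = 0" by (intro poly_mapping_eqI) simp
qed (simp add: lev_def)

lemma cc_0_lev: "\<kappa> \<in> supp n \<Longrightarrow> cc lam \<kappa> 0 = lam - of_nat (lev \<kappa>)"
  by (simp add: cc_def lookup_0_lev)

lemma cc_0_nonzero: "\<kappa> \<in> supp n \<Longrightarrow> lam \<notin> \<nat> \<Longrightarrow> cc lam \<kappa> 0 \<noteq> 0"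
  by (auto simp: cc_0_lev)

lemma supp_inj_lookup:
  assumes "\<kappa> \<in> supp n" "\<kappa>' \<in> supp n" "\<And>j. j \<le> n \<Longrightarrow> lookup \<kappa> j = lookup \<kappa>' j"
  shows "\<kappa> = \<kappa>'"
proof (rule poly_mapping_eqI)
  fix j
  show "lookup \<kappa> j = lookup \<kappa>' j"
    using assms supp_beyond[OF assms(1), of j] supp_beyond[OF assms(2), of j] by (cases "j \<le> n") auto
qed

lemma finite_supp_lev: "finite {\<kappa> \<in> supp n. lev \<kappa> \<le> d}"
proof (rule finite_imageD)
  let ?f = "\<lambda>\<kappa>. map (lookup \<kappa>) [0..<Suc n]"
  have "?f ` {\<kappa> \<in> supp n. lev \<kappa> \<le> d} \<subseteq> {xs. set xs \<subseteq> {- int d..int d} \<and> length xs = Suc n}"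
  proof safe
    fix \<kappa> x assume k: "\<kappa> \<in> supp n" "lev \<kappa> \<le> d" and x: "x \<in> set (?f \<kappa>)"
    then obtain j where "j \<in> set [0..<Suc n]" "x = lookup \<kappa> j" unfolding set_map by blast
    then have "j \<le> n" "x = lookup \<kappa> j" by (simp_all only: set_upt atLeastLessThan_iff less_Suc_eq_le)
    then show "x \<in> {- int d..int d}"
      using lookup_0_lev[OF k(1)] lookup_le_lev[OF k(1), of j] supp_nonneg[OF k(1), of j] k(2)
      by (cases "j = 0") auto
  qed simp
  then show "finite (?f ` {\<kappa> \<in> supp n. lev \<kappa> \<le> d})"
    using finite_lists_length_eq[of "{- int d..int d}" "Suc n"] finite_subset by auto
  show "inj_on ?f {\<kappa> \<in> supp n. lev \<kappa> \<le> d}"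
  proof (rule inj_onI)
    fix \<kappa> \<kappa>' assume k: "\<kappa> \<in> {\<kappa> \<in> supp n. lev \<kappa> \<le> d}" "\<kappa>' \<in> {\<kappa> \<in> supp n. lev \<kappa> \<le> d}" and e: "?f \<kappa> = ?f \<kappa>'"
    have "lookup \<kappa> j = lookup \<kappa>' j" if "j \<le> n" for j
      using e that by (auto simp del: upt_Suc)
    then show "\<kappa> = \<kappa>'" using k by (intro supp_inj_lookup) auto
  qed
qed

text \<open>A basis in the sense of \<open>is_basis\<close> is numbered by all naturals, so the
  exponents must be countably infinite: each level is finite, and for n >= 1 every level
  occurs.\<close>

lemma supp_enum:
  assumes "n \<ge> 1"
  obtains kk :: "nat \<Rightarrow> lat" where "bij_betw kk UNIV (supp n)"
proof -
  have e: "supp n = (\<Union>d. {\<kappa> \<in> supp n. lev \<kappa> \<le> d})" by auto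
  have "countable (\<Union>d. {\<kappa> \<in> supp n. lev \<kappa> \<le> d})"
    by (rule countable_UN) (simp_all add: countable_finite[OF finite_supp_lev])
  then have "countable (supp n)" using e by simp
  moreover have "infinite (supp n)"
  proof
    assume fin: "finite (supp n)"
    have "\<exists>\<kappa>\<in>supp n. lev \<kappa> = m" for m
    proof (induction m)
      case 0
      then show ?case using zero_supp lev_0 by blast
    next
      case (Suc m)
      then show ?case using supp_bet[of _ n 1] lev_bet[of _ n 1] assms by (metis le_refl)
    qed
    then have "m \<in> lev ` supp n" for m by (metis image_iff)
    then have "(UNIV :: nat set) \<subseteq> lev ` supp n" by blast
    then have "finite (UNIV :: nat set)" by (rule finite_subset) (rule finite_imageI[OF fin])
    then show False by simp
  qed
  ultimately show ?thesis
    using bij_betw_from_nat_into that by blast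
qed

section \<open>Reaching monomials by words in the simple generators\<close>

definition lw :: "bool \<Rightarrow> nat list \<Rightarrow> alg" where
  "lw s gs = prod_list (map (\<lambda>i. gen (lo s i)) gs)"

text \<open>The first generator to act contributes [\<lambda> - level]; every later one meets a
  variable whose exponent has just been raised to k + 1 with k >= 0. All factors are units. The list
  is reversed because a word acts from its right end.\<close>

lemma act_lw_chain:
  assumes "lam \<notin> \<nat>" "\<kappa> \<in> supp n" "1 \<le> i" "i \<le> n"
  shows "\<exists>c. fps_nth c 0 \<noteq> 0 \<and> act s n lam (lw s (rev [1..<Suc i])) (bas \<kappa>) = c \<star> bas (\<kappa> + bet i)"
  using assms(3,4)
proof (induction i rule: dec_induct)
  case base
  then show ?case
    using cc_0_nonzero[OF assms(2,1)]
    by (intro exI[of _ "qnum (cc lam \<kappa> 0)"]) (simp add: lw_def act_lo opF_bas qnum_nth_0 bet_def del_def)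
next
  case (step i)
  then obtain c where c: "fps_nth c 0 \<noteq> 0"
    "act s n lam (lw s (rev [1..<Suc i])) (bas \<kappa>) = c \<star> bas (\<kappa> + bet i)" by auto
  have "cc lam (\<kappa> + bet i) i = of_int (lookup \<kappa> i + 1)"
    using step by (simp add: cc_def lookup_add lookup_bet)
  moreover have "lookup \<kappa> i + 1 \<noteq> 0" using supp_nonneg[OF assms(2) step(1)] by simp
  ultimately have "fps_nth (qnum (cc lam (\<kappa> + bet i) i)) 0 \<noteq> 0"
    unfolding qnum_nth_0 by (metis of_int_eq_0_iff)
  moreover have "lw s (rev [1..<Suc (Suc i)]) = gen (lo s (Suc i)) * lw s (rev [1..<Suc i])"
    using step by (simp add: lw_def)
  then have "act s n lam (lw s (rev [1..<Suc (Suc i)])) (bas \<kappa>)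
      = (c * qnum (cc lam (\<kappa> + bet i) i)) \<star> bas (\<kappa> + bet (Suc i))"
    using step c by (simp add: act_mult act_smul act_lo opF_bas bet_Suc add.assoc del: upt_Suc)
  ultimately show ?case using c(1) by (intro exI[of _ "c * qnum (cc lam (\<kappa> + bet i) i)"]) simp
qed

lemma lw_append: "lw s (gs @ hs) = lw s gs * lw s hs"
  by (simp add: lw_def)

text \<open>A variable of positive exponent can be removed by undoing one chain, which lowers the
  level. Simple generators are used instead of root vectors because the antipode is evaluated on
  them.\<close>

lemma act_lw_ex:
  assumes "lam \<notin> \<nat>" "\<kappa> \<in> supp n"
  shows "\<exists>gs c. set gs \<subseteq> {1..n} \<and> fps_nth c 0 \<noteq> 0 \<and> act s n lam (lw s gs) (bas 0) = c \<star> bas \<kappa>"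
  using assms(2)
proof (induction "lev \<kappa>" arbitrary: \<kappa>)
  case 0
  then show ?case using lev_0[of \<kappa> n] by (intro exI[of _ "[]"] exI[of _ 1]) (simp add: lw_def act_1)
next
  case (Suc m)
  have "\<exists>i\<in>{1..n}. lookup \<kappa> i \<noteq> 0"
  proof (rule ccontr)
    assume "\<not> ?thesis"
    then have "(\<Sum>j=1..n. lookup \<kappa> j) = 0" by (intro sum.neutral) auto
    then show False using supp_sum[OF Suc(3)] lookup_0_lev[OF Suc(3)] Suc(2) by simp
  qed
  then obtain i where i: "i \<in> {1..n}" "1 \<le> lookup \<kappa> i"
    using supp_nonneg[OF Suc(3)] by force
  let ?k = "\<kappa> - bet i"
  have k: "?k \<in> supp n" using i Suc by (intro supp_minus_bet) auto
  moreover have "lev ?k = m" using lev_bet[OF k, of i] i Suc(2) by simp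
  ultimately obtain gs c where g: "set gs \<subseteq> {1..n}" "fps_nth c 0 \<noteq> 0" "act s n lam (lw s gs) (bas 0) = c \<star> bas ?k"
    using Suc(1)[of ?k] by blast
  obtain d where d: "fps_nth d 0 \<noteq> 0" "act s n lam (lw s (rev [1..<Suc i])) (bas ?k) = d \<star> bas (?k + bet i)"
    using act_lw_chain[OF assms(1) k, of i s] i by auto
  have "act s n lam (lw s (rev [1..<Suc i] @ gs)) (bas 0) = (c * d) \<star> bas \<kappa>"
    using g d by (simp add: lw_append act_mult act_smul del: upt_Suc)
  moreover have "set (rev [1..<Suc i] @ gs) \<subseteq> {1..n}" using g i by auto
  ultimately show ?case using g(2) d(1)
    by (intro exI[of _ "rev [1..<Suc i] @ gs"] exI[of _ "c * d"]) simp
qed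

lemma fps_inverse_unit: "fps_nth c 0 \<noteq> 0 \<Longrightarrow> inverse c * c = (1 :: complex fps)"
  by (rule inverse_mult_eq_1)

section \<open>Convergent expansions and topological bases\<close>

lemma tendsto_hserD:
  assumes "X \<longlonglongrightarrow> (x :: ('k::monoid_add) hser)"
  shows "\<forall>\<^sub>F k in sequentially. \<exists>r. x = X k + hX ^ d \<star> r"
proof -
  have "\<forall>\<^sub>F k in sequentially. \<forall>i\<in>{..<d}. fps_nth (X k) i = fps_nth x i"
    using assms unfolding tendsto_fps_iff by (subst eventually_ball_finite_distrib) auto
  then show ?thesis
  proof (rule eventually_mono)
    fix k assume "\<forall>i\<in>{..<d}. fps_nth (X k) i = fps_nth x i"
    then have "\<forall>i<d. fps_nth (x - X k) i = 0" by simp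
    then obtain r where "x - X k = hX ^ d \<star> r" by (metis hX_power_smul_iff)
    then show "\<exists>r. x = X k + hX ^ d \<star> r" by (intro exI[of _ r]) (simp add: algebra_simps)
  qed
qed

lemma tendsto_hserI:
  assumes "\<And>d. \<forall>\<^sub>F k in sequentially. \<exists>r. x = X k + hX ^ d \<star> r"
  shows "X \<longlonglongrightarrow> (x :: ('k::monoid_add) hser)"
  unfolding tendsto_fps_iff
proof
  fix m
  show "\<forall>\<^sub>F k in sequentially. fps_nth (X k) m = fps_nth x m"
    using assms[of "Suc m"] by (rule eventually_mono) (auto simp: hX_power_smul_nth simp del: power_Suc)
qed

context
  fixes n :: nat and kk :: "nat \<Rightarrow> lat"
  assumes kk: "bij_betw kk UNIV (supp n)"
begin

lemma kk_inj: "kk i = kk j \<longleftrightarrow> i = j"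
  using kk by (auto simp: bij_betw_def inj_eq)

lemma kk_supp: "kk i \<in> supp n"
  using kk by (auto simp: bij_betw_def)

lemma eventually_kk:
  assumes "finite K"
  shows "\<forall>\<^sub>F k in sequentially. \<forall>i. kk i \<in> K \<longrightarrow> i < k"
proof -
  have "finite (kk -` K)" using assms kk by (auto simp: bij_betw_def intro: finite_vimageI)
  then obtain m where "\<forall>i\<in>kk -` K. i < m" using finite_nat_set_iff_bounded by blast
  then show ?thesis
    unfolding eventually_sequentially by (intro exI[of _ m]) (auto intro: less_le_trans)
qed

lemma supported_expansion:
  assumes "supported n t"
  shows "(\<lambda>k. \<Sum>i<k. coord (kk i) t \<star> bas (kk i)) \<longlonglongrightarrow> t"
  unfolding tendsto_fps_iff
proof
  fix m
  have "\<forall>\<^sub>F k in sequentially. \<forall>i. kk i \<in> keys (fps_nth t m) \<longrightarrow> i < k"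
    by (rule eventually_kk) simp
  then show "\<forall>\<^sub>F k in sequentially. fps_nth (\<Sum>i<k. coord (kk i) t \<star> bas (kk i)) m = fps_nth t m"
  proof (rule eventually_mono)
    fix k assume k: "\<forall>i. kk i \<in> keys (fps_nth t m) \<longrightarrow> i < k"
    show "fps_nth (\<Sum>i<k. coord (kk i) t \<star> bas (kk i)) m = fps_nth t m"
    proof (rule poly_mapping_eqI)
      fix \<kappa>
      have "lookup (fps_nth (\<Sum>i<k. coord (kk i) t \<star> bas (kk i)) m) \<kappa>
          = fps_nth (\<Sum>i<k. if \<kappa> = kk i then coord (kk i) t else 0) m"
        unfolding coord_nth[symmetric] coord_sum coord_smul coord_bas
        by (simp add: if_distrib cong: if_cong)
      also have "\<dots> = lookup (fps_nth t m) \<kappa>"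
      proof (cases "\<exists>j<k. \<kappa> = kk j")
        case True
        then show ?thesis by (auto simp: kk_inj)
      next
        case False
        have "lookup (fps_nth t m) \<kappa> = 0"
        proof (rule ccontr)
          assume nz: "lookup (fps_nth t m) \<kappa> \<noteq> 0"
          then have "coord \<kappa> t \<noteq> 0" by (metis coord_nth fps_zero_nth)
          then have "\<kappa> \<in> supp n" using assms by (auto simp: supported_def)
          then obtain i where "\<kappa> = kk i" using kk by (auto simp: bij_betw_def)
          then show False using k nz False by (auto simp: in_keys_iff)
        qed
        moreover have "(\<Sum>i<k. if \<kappa> = kk i then coord (kk i) t else 0) = 0"
          using False by (intro sum.neutral) auto
        ultimately show ?thesis by simp
      qed
      finally show "lookup (fps_nth (\<Sum>i<k. coord (kk i) t \<star> bas (kk i)) m) \<kappa>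
        = lookup (fps_nth t m) \<kappa>" .
    qed
  qed
qed

lemma coord_tendsto_0:
  "(\<lambda>i. coord (kk i) t) \<longlonglongrightarrow> 0"
  unfolding tendsto_fps_iff
proof
  fix m
  have "\<forall>\<^sub>F k in sequentially. \<forall>i. kk i \<in> keys (fps_nth t m) \<longrightarrow> i < k"
    by (rule eventually_kk) simp
  then show "\<forall>\<^sub>F k in sequentially. fps_nth (coord (kk k) t) m = fps_nth 0 m"
    by (rule eventually_mono) (auto simp: in_keys_iff)
qed

text \<open>By \<open>JJ_eq_kernel\<close> the quotient module embeds into the oscillator space with
  the supported series as image. There the vectors are unit multiples of the monomials.\<close>

lemma is_basis_osc:
  assumes "lam \<notin> \<nat>"
    and a: "\<And>i. act s n lam (a i) (bas 0) = d i \<star> bas (kk i)" and d: "\<And>i. fps_nth (d i) 0 \<noteq> 0"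
  shows "is_basis (JJ s n lam) a"
proof -
  interpret osc_mod s n lam by unfold_locales (rule assms(1))
  \<comment> \<open>\<open>f\<close> takes monomial number i back to
    \<open>inverse (d i) \<star> a i\<close>. As a linear map over C[[h]] it carries convergent
    expansions to convergent ones.\<close>
  define f where "f = ext (\<lambda>\<kappa>. if \<kappa> \<in> supp n then inverse (d (inv kk \<kappa>)) \<star> a (inv kk \<kappa>) else 0)"
  have inv: "inv kk (kk i) = i" for i
    using kk by (simp add: bij_betw_def)
  have f: "hlin f" by (simp add: f_def hlin_ext)
  have f_kk: "f (bas (kk i)) = inverse (d i) \<star> a i" for i
    by (simp add: f_def kk_supp inv)
  have Af: "A (f t) (bas 0) = cut n t" for t
  proof (rule hlin_eqI[where f = "\<lambda>t. A (f t) (bas 0)"])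
    show "hlin (\<lambda>t. A (f t) (bas 0))" by (rule hlin_comp[OF hlin_act_left f])
    show "hlin (cut n)" by (simp add: cut_def hlin_ext)
    fix \<kappa>
    show "A (f (bas \<kappa>)) (bas 0) = cut n (bas \<kappa>)"
    proof (cases "\<kappa> \<in> supp n")
      case True
      then obtain i where "\<kappa> = kk i" using kk by (auto simp: bij_betw_def)
      then show ?thesis
        by (simp add: f_kk act_smul_left a cut_def kk_supp fps_inverse_unit[OF d])
    next
      case False
      then show ?thesis by (simp add: f_def cut_def act_0_left)
    qed
  qed
  show ?thesis
    unfolding is_basis_def smul_def[symmetric]
  proof (intro allI ex1I)
    fix u
    define t where "t = A u (bas 0)"
    have t: "supported n t"
      unfolding t_def by (rule act_supported) (rule supported_bas[OF zero_supp])
    let ?c = "\<lambda>i. coord (kk i) t * inverse (d i)"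
    show "?c \<longlonglongrightarrow> 0 \<and> (\<exists>s. (\<lambda>k. \<Sum>i<k. ?c i \<star> a i) \<longlonglongrightarrow> s \<and> u - s \<in> J)"
    proof (intro conjI exI[of _ "f t"])
      show "?c \<longlonglongrightarrow> 0"
        unfolding tendsto_fps_iff
      proof
        fix m
        have "\<forall>\<^sub>F k in sequentially. \<forall>j\<in>{..m}. fps_nth (coord (kk k) t) j = 0"
          using coord_tendsto_0[of t] unfolding tendsto_fps_iff
          by (subst eventually_ball_finite_distrib) auto
        then show "\<forall>\<^sub>F k in sequentially. fps_nth (coord (kk k) t * inverse (d k)) m = fps_nth 0 m"
          by (rule eventually_mono) (simp add: fps_mult_nth del: coord_nth)
      qed
      show "(\<lambda>k. \<Sum>i<k. ?c i \<star> a i) \<longlonglongrightarrow> f t"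
      proof (rule tendsto_hserI)
        fix D
        show "\<forall>\<^sub>F k in sequentially. \<exists>r. f t = (\<Sum>i<k. ?c i \<star> a i) + hX ^ D \<star> r"
          using tendsto_hserD[OF supported_expansion[OF t], of D]
        proof (rule eventually_mono)
          fix k assume "\<exists>r. t = (\<Sum>i<k. coord (kk i) t \<star> bas (kk i)) + hX ^ D \<star> r"
          then obtain r where r: "t = (\<Sum>i<k. coord (kk i) t \<star> bas (kk i)) + hX ^ D \<star> r" ..
          have "f t = f ((\<Sum>i<k. coord (kk i) t \<star> bas (kk i)) + hX ^ D \<star> r)"
            using r by (rule arg_cong)
          also have "\<dots> = (\<Sum>i<k. ?c i \<star> a i) + hX ^ D \<star> f r"
            by (simp add: hlin_add[OF f] hlin_sum[OF f] hlin_smul[OF f] f_kk)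
          finally show "\<exists>r. f t = (\<Sum>i<k. ?c i \<star> a i) + hX ^ D \<star> r" by blast
        qed
      qed
      show "u - f t \<in> J"
        unfolding JJ_eq_kernel act_diff_left Af using t by (simp add: supported_iff t_def)
    qed
    fix c assume "c \<longlonglongrightarrow> 0 \<and> (\<exists>s. (\<lambda>k. \<Sum>i<k. c i \<star> a i) \<longlonglongrightarrow> s \<and> u - s \<in> J)"
    then obtain w where w: "(\<lambda>k. \<Sum>i<k. c i \<star> a i) \<longlonglongrightarrow> w" "u - w \<in> J" by blast
    have Aw: "A w (bas 0) = t"
      using w(2) unfolding JJ_eq_kernel act_diff_left t_def by simp
    \<comment> \<open>The coefficient of order m is read off a partial sum that contains index i and
      agrees with w modulo h^(m+1).\<close>
    have "c i * d i = coord (kk i) t" for i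
    proof (rule fps_ext)
      fix m
      have "\<forall>\<^sub>F k in sequentially. i < k" by (rule eventually_gt_at_top)
      then have "\<forall>\<^sub>F k in sequentially. i < k \<and> (\<exists>r. w = (\<Sum>i<k. c i \<star> a i) + hX ^ Suc m \<star> r)"
        using tendsto_hserD[OF w(1), of "Suc m"] by (rule eventually_conj)
      then obtain k r where k: "i < k" and r: "w = (\<Sum>i<k. c i \<star> a i) + hX ^ Suc m \<star> r"
        using eventually_happens trivial_limit_sequentially by blast
      have "t = (\<Sum>i<k. (c i * d i) \<star> bas (kk i)) + hX ^ Suc m \<star> A r (bas 0)"
        unfolding Aw[symmetric] r by (simp add: act_add_left act_sum_left act_smul_left a del: power_Suc)
      then have "coord (kk i) t = (\<Sum>j<k. if j = i then c j * d j else 0) + hX ^ Suc m * coord (kk i) (A r (bas 0))"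
        by (simp add: coord_sum coord_bas kk_inj if_distrib eq_commute cong: if_cong del: power_Suc)
      also have "\<dots> = c i * d i + hX ^ Suc m * coord (kk i) (A r (bas 0))"
        using k by simp
      finally show "fps_nth (c i * d i) m = fps_nth (coord (kk i) t) m"
        by (simp add: fps_X_power_mult_nth del: power_Suc coord_nth)
    qed
    then have "c i = ?c i" for i
      using fps_inverse_unit[OF d[of i]] by (metis mult.assoc mult.commute mult.right_neutral)
    then show "c = ?c" by blast
  qed
qed

end

section \<open>The pairing as a matrix coefficient\<close>

lemma hull_hmodule_induct [consumes 1, case_names base zero add smul]:
  assumes "x \<in> hmodule hull B" "\<And>x. x \<in> B \<Longrightarrow> P x" "P 0"
    "\<And>x y. P x \<Longrightarrow> P y \<Longrightarrow> P (x + y)" "\<And>c x. P x \<Longrightarrow> P (c \<star> x)"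
  shows "P x"
proof -
  have "hmodule {x. P x}" by (rule hmoduleI) (use assms in simp_all)
  then show ?thesis using hull_induct[of x hmodule B P] assms(1,2) by blast
qed

lemma hull_hmodule_hlin:
  assumes "x \<in> hmodule hull B" "hlin f" "hmodule S" "\<And>x. x \<in> B \<Longrightarrow> f x \<in> S"
  shows "f x \<in> S"
  using assms(1)
  by (induction rule: hull_hmodule_induct)
    (auto simp: hlin_0 hlin_add hlin_smul assms intro: hmodule_0 hmodule_add hmodule_smul)

section \<open>Closed subalgebras and closed spans\<close>

lemma subalgebraI:
  assumes "hmodule S" "1 \<in> S" "\<And>x y. x \<in> S \<Longrightarrow> y \<in> S \<Longrightarrow> x * y \<in> S"
  shows "subalgebra S"
  using assms by (simp add: subalgebra_def)

lemma gen_subalgebra_subset: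
  "subalgebra S \<Longrightarrow> closed S \<Longrightarrow> G \<subseteq> S \<Longrightarrow> rel_ideal n \<subseteq> S \<Longrightarrow> gen_subalgebra n G \<subseteq> S"
  unfolding gen_subalgebra_def by (rule hull_minimal) auto

lemma gen_subalgebra_subalgebra: "subalgebra (gen_subalgebra n G)"
  and gen_subalgebra_closed: "closed (gen_subalgebra n G)"
proof -
  have "subalgebra (gen_subalgebra n G) \<and> closed (gen_subalgebra n G)"
    unfolding gen_subalgebra_def
  proof (rule hull_in)
    fix T assume T: "Ball T (\<lambda>S. subalgebra S \<and> closed S)"
    have "hmodule (\<Inter>T)" by (rule hmodule_Inter) (use T in \<open>auto simp: subalgebra_def\<close>)
    then have "subalgebra (\<Inter>T)" using T by (intro subalgebraI) (auto simp: subalgebra_def)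
    then show "subalgebra (\<Inter>T) \<and> closed (\<Inter>T)" using T by (auto intro: closed_Inter)
  qed
  then show "subalgebra (gen_subalgebra n G)" "closed (gen_subalgebra n G)" by blast+
qed

lemma gen_subalgebra_gen: "x \<in> G \<Longrightarrow> x \<in> gen_subalgebra n G"
  and gen_subalgebra_rel: "x \<in> rel_ideal n \<Longrightarrow> x \<in> gen_subalgebra n G"
  unfolding gen_subalgebra_def by (auto intro: hull_inc)

lemma subalgebra_hmodule: "subalgebra S \<Longrightarrow> hmodule S"
  and subalgebra_1: "subalgebra S \<Longrightarrow> 1 \<in> S"
  and subalgebra_mult: "subalgebra S \<Longrightarrow> x \<in> S \<Longrightarrow> y \<in> S \<Longrightarrow> x * y \<in> S"
  by (simp_all add: subalgebra_def)

lemma U_l_subalgebra: "subalgebra (U_l n)" and U_l_closed: "closed (U_l n)"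
  and U_n_plus_subalgebra: "subalgebra (U_n_plus n)" and U_n_minus_subalgebra: "subalgebra (U_n_minus n)"
  by (simp_all add: U_l_def U_n_plus_def U_n_minus_def gen_subalgebra_subalgebra gen_subalgebra_closed)

lemma U_l_gens:
  "i \<in> {2..n} \<Longrightarrow> ee i \<in> U_l n" "i \<in> {2..n} \<Longrightarrow> ff i \<in> U_l n" "a \<in> {1..n + 1} \<Longrightarrow> gen (Hgen a) \<in> U_l n"
  by (auto simp: U_l_def intro!: gen_subalgebra_gen)

lemma U_rel: "x \<in> rel_ideal n \<Longrightarrow> x \<in> U_l n" "x \<in> rel_ideal n \<Longrightarrow> x \<in> U_n_plus n" "x \<in> rel_ideal n \<Longrightarrow> x \<in> U_n_minus n"
  by (auto simp: U_l_def U_n_plus_def U_n_minus_def intro: gen_subalgebra_rel)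

lemma U_n_gens: "i \<in> {1..n} \<Longrightarrow> xroot i \<in> U_n_plus n" "i \<in> {1..n} \<Longrightarrow> yroot i \<in> U_n_minus n"
  by (auto simp: U_n_plus_def U_n_minus_def intro!: gen_subalgebra_gen)

lemma closed_span_hmodule: "hmodule (closed_span B)" and closed_span_closed: "closed (closed_span B)"
proof -
  have "hmodule (closed_span B) \<and> closed (closed_span B)"
    unfolding closed_span_def by (rule hull_in) (auto intro: hmodule_Inter closed_Inter)
  then show "hmodule (closed_span B)" "closed (closed_span B)" by blast+
qed

lemma closed_span_inc: "x \<in> B \<Longrightarrow> x \<in> closed_span B"
  unfolding closed_span_def by (rule hull_inc)

lemma closed_span_subset: "hmodule S \<Longrightarrow> closed S \<Longrightarrow> B \<subseteq> S \<Longrightarrow> closed_span B \<subseteq> S"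
  unfolding closed_span_def by (rule hull_minimal) auto

lemma closed_span_hlin:
  assumes "x \<in> closed_span B" "hlin f" "hmodule S" "closed S" "\<And>x. x \<in> B \<Longrightarrow> f x \<in> S"
  shows "f x \<in> S"
  using closed_span_subset[OF hmodule_vimage[OF assms(2,3)] closed_vimage_hlin[OF assms(2,4)], of B] assms(1,5)
  by auto

subsection \<open>The counit\<close>

lemma counit_coord: "counit u = coord 0 u"
  by (simp add: counit_def coord_def)

lemma word_add_eq_0: "v + w = (0 :: word) \<longleftrightarrow> v = 0 \<and> w = 0"
  by (cases v; cases w) (auto simp: plus_word_def zero_word_def)

lemma hlin_coord_smul: "hlin f \<Longrightarrow> hlin (\<lambda>u. (coord k (f u) * c) \<star> b)"
  by (rule hlinI) (simp_all add: hlin_add hlin_smul distrib_right hs.scale_left_distrib mult.assoc)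

lemma smul_1_inj: "a \<star> (1 :: alg) = b \<star> 1 \<Longrightarrow> a = b"
  by (metis bas_0 coord_bas coord_smul mult.right_neutral)

text \<open>The empty word is a product of two words only if both are empty.\<close>

lemma counit_mult: "counit (u * v) = counit u * counit v"
proof -
  have "(coord 0 (u * v) * 1) \<star> (1 :: alg) = (coord 0 u * counit v) \<star> 1"
  proof (rule hlin_eqI[where f = "\<lambda>u. (coord 0 (u * v) * 1) \<star> (1 :: alg)"])
    show "hlin (\<lambda>u. (coord 0 (u * v) * 1) \<star> (1 :: alg))" by (rule hlin_coord_smul[OF hlin_rmult])
    show "hlin (\<lambda>u. (coord 0 u * counit v) \<star> (1 :: alg))" by (rule hlin_coord_smul[OF hlin_id])
    fix w
    have "(coord 0 (bas w * v) * 1) \<star> (1 :: alg) = (coord 0 v * (if w = 0 then 1 else 0)) \<star> 1"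
    proof (rule hlin_eqI[where f = "\<lambda>v. (coord 0 (bas w * v) * 1) \<star> (1 :: alg)"])
      show "hlin (\<lambda>v. (coord 0 (bas w * v) * 1) \<star> (1 :: alg))" by (rule hlin_coord_smul[OF hlin_lmult])
      show "hlin (\<lambda>v. (coord 0 v * (if w = 0 then 1 else 0)) \<star> (1 :: alg))" by (rule hlin_coord_smul[OF hlin_id])
    qed (auto simp: bas_mult coord_bas word_add_eq_0 eq_commute[of 0])
    then show "(coord 0 (bas w * v) * 1) \<star> (1 :: alg) = (coord 0 (bas w) * counit v) \<star> 1"
      by (simp add: counit_coord coord_bas eq_commute[of 0] mult.commute)
  qed
  then show ?thesis using smul_1_inj by (simp add: counit_coord)
qed

lemma counit_simps [simp]:
  "counit (x + y) = counit x + counit y" "counit (x - y) = counit x - counit y"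
  "counit (c \<star> x) = c * counit x" "counit 0 = 0" "counit 1 = 1" "counit (gen g) = 0" "counit (scal c) = c"
proof -
  show "counit 1 = 1" by (simp add: counit_coord coord_bas flip: bas_0)
  then show "counit (scal c) = c" by (simp add: counit_coord scal_conv)
  show "counit (gen g) = 0"
    by (simp add: counit_coord gen_conv coord_bas zero_word_def)
qed (simp_all add: counit_coord)

lemma counit_sum: "counit (sum f A) = (\<Sum>i\<in>A. counit (f i))"
  by (simp add: counit_coord coord_sum)

lemma counit_power: "counit (x ^ k) = counit x ^ k"
  by (induction k) (simp_all add: counit_mult)

lemma counit_qcartan: "counit (qcartan n \<mu>) = 1"
proof (rule fps_ext)
  fix m
  have c: "counit (cartan n \<mu>) = 0"
    by (simp add: cartan_conv counit_sum del: sum.cl_ivl_Suc)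
  have "fps_nth (counit (qcartan n \<mu>)) m = fps_nth (counit (fps_const (fps_nth (qcartan n \<mu>) m))) 0"
    by (simp add: counit_coord)
  also have "\<dots> = fps_nth 1 m"
    unfolding qcartan_coeff by (cases m) (simp_all add: counit_mult counit_power c)
  finally show "fps_nth (counit (qcartan n \<mu>)) m = fps_nth 1 m" .
qed

lemma counit_qnum_cartan: "counit (qnum_cartan n \<mu>) = 0"
proof -
  have "(qpw 1 - qpw (- 1)) * counit (qnum_cartan n \<mu>) = counit ((qpw 1 - qpw (- 1)) \<star> qnum_cartan n \<mu>)"
    by (simp only: counit_simps)
  also have "\<dots> = 0" unfolding qnum_cartan_eq by (simp add: counit_qcartan)
  finally show ?thesis using qpw_diff_nonzero by simp
qed

lemma counit_relator: "r \<in> relators n \<Longrightarrow> counit r = 0"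
  unfolding relators_def
  by (elim UnE CollectE exE conjE)
    (simp_all add: counit_mult counit_qnum_cartan serre_conv del: hs.scale_scale)

lemma counit_rel: "u \<in> rel_ideal n \<Longrightarrow> counit u = 0"
proof -
  let ?Z = "{u. counit u = 0}"
  have "?Z = {u. (coord 0 u * 1) \<star> (1 :: alg) \<in> {0}}"
    using smul_1_inj[of _ 0] by (auto simp: counit_coord)
  then have "closed ?Z" using closed_vimage_hlin[OF hlin_coord_smul[OF hlin_id] closed_zero] by metis
  moreover have "two_sided_ideal ?Z"
    by (simp add: two_sided_ideal_def left_ideal_def additive_def counit_mult)
  ultimately have "rel_ideal n \<subseteq> ?Z"
    unfolding rel_ideal_def by (intro hull_minimal) (auto simp: counit_relator)
  then show "u \<in> rel_ideal n \<Longrightarrow> counit u = 0" by auto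
qed

lemma counit_xroot: "counit (xroot i) = 0"
proof -
  have "counit (foldr (\<lambda>j z. qcomm (qpw (- 1)) (ee j) z) js (ee i)) = 0" for js
    by (cases js) (simp_all add: qcomm_conv counit_mult)
  then show ?thesis by (simp add: xroot_def counit_mult)
qed

lemma counit_yroot: "counit (yroot i) = 0"
proof -
  have "counit (foldr (\<lambda>j z. qcomm (qpw (- 1)) (ff j) z) js (ff 1)) = 0" for js
    by (cases js) (simp_all add: qcomm_conv counit_mult)
  then show ?thesis unfolding yroot_def .
qed

subsection \<open>The value of the character on the projection\<close>

lemma act_ee_v: "i \<in> {1..n} \<Longrightarrow> act True n lam (ee i) (bas 0) = 0"
  and act_ff_v: "i \<in> {2..n} \<Longrightarrow> act True n lam (ff i) (bas 0) = 0"
  by (auto simp: act_gen opE_bas opF_bas cc_0)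

lemma closed_hlin_eq: "hlin f \<Longrightarrow> hlin g \<Longrightarrow> closed {u. f u = g u} \<and> hmodule {u. f u = g u}"
proof -
  assume l: "hlin f" "hlin g"
  have "{u. f u = g u} = {u. f u - g u \<in> {0}}" by auto
  then show ?thesis
    using hmodule_vimage[OF hlin_diff_fun[OF l] hmodule_zero] closed_vimage_hlin[OF hlin_diff_fun[OF l] closed_zero]
    by metis
qed

lemma U_l_act:
  assumes "l \<in> U_l n"
  shows "act True n lam l (bas 0) = coord 0 (act True n lam l (bas 0)) \<star> bas 0"
proof -
  let ?S = "{l. act True n lam l (bas 0) = (coord 0 (act True n lam l (bas 0)) * 1) \<star> bas 0}"
  have S: "closed ?S" "hmodule ?S"
    using closed_hlin_eq[OF hlin_act_left hlin_coord_smul[OF hlin_act_left]] by blast+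
  have m: "x * y \<in> ?S" if x: "x \<in> ?S" and y: "y \<in> ?S" for x y
  proof -
    obtain c where "act True n lam x (bas 0) = c \<star> bas 0" using x by blast
    moreover obtain d where "act True n lam y (bas 0) = d \<star> bas 0" using y by blast
    ultimately show ?thesis by (simp add: act_mult act_smul coord_bas)
  qed
  have "U_l n \<subseteq> ?S"
    unfolding U_l_def
    by (rule gen_subalgebra_subset[OF subalgebraI[OF S(2) _ m] S(1)])
      (auto simp: act_1 coord_bas act_ee_v act_ff_v rel_ideal_act act_H[unfolded One_nat_def] simp del: rho.simps)
  then show ?thesis using assms by auto
qed

lemma U_n_plus_act:
  assumes "c \<in> U_n_plus n"
  shows "act True n lam c (bas 0) = counit c \<star> bas 0"
proof -
  let ?S = "{c. act True n lam c (bas 0) = (coord 0 c * 1) \<star> bas 0}"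
  have S: "closed ?S" "hmodule ?S"
    using closed_hlin_eq[OF hlin_act_left hlin_coord_smul[OF hlin_id]] by blast+
  have x: "xroot i \<in> ?S" if "i \<in> {1..n}" for i
  proof -
    have "act True n lam (foldr (\<lambda>j z. qcomm (qpw (- 1)) (ee j) z) js (ee i)) (bas 0) = 0" if "set js \<subseteq> {1..n}" for js
      using that \<open>i \<in> {1..n}\<close>
      by (induction js) (simp_all add: act_ee_v[unfolded One_nat_def] qcomm_conv act_diff_left act_smul_left act_mult act_0)
    moreover have "set [1..<i] \<subseteq> {1..n}" using that by auto
    ultimately have "act True n lam (xroot i) (bas 0) = 0"
      unfolding xroot_def smul_def[symmetric] act_smul_left by (metis hs.scale_zero_right)
    then show ?thesis using counit_xroot[of i] by (simp add: counit_coord)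
  qed
  have "U_n_plus n \<subseteq> ?S"
    unfolding U_n_plus_def
  proof (rule gen_subalgebra_subset[OF subalgebraI[OF S(2)] S(1)])
    show "1 \<in> ?S" using counit_simps(5) by (simp add: act_1 counit_coord)
    show "x * y \<in> ?S" if "x \<in> ?S" "y \<in> ?S" for x y
      using that counit_mult[of x y] by (simp add: act_mult act_smul counit_coord mult.commute)
    show "rel_ideal n \<subseteq> ?S" using counit_rel by (auto simp: rel_ideal_act counit_coord)
  qed (use x in auto)
  then show ?thesis using assms by (auto simp: counit_coord)
qed

text \<open>Dual to \<open>U_n_plus_act\<close>: a lowering root vector raises the exponent of some
  z_i with i >= 1, so it maps no supported monomial to exponent 0. The set \<open>?S\<close> ranges
  over all supported t in order to be closed under products.\<close>

lemma U_n_minus_act: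
  assumes "a \<in> U_n_minus n" "supported n t"
  shows "coord 0 (act True n lam a t) = counit a * coord 0 t"
proof -
  let ?S = "\<Inter>t\<in>{t. supported n t}. {a. (coord 0 (act True n lam a t) * 1) \<star> bas 0 = (coord 0 a * coord 0 t) \<star> (bas 0 :: osc)}"
  have S': "closed {a. (coord 0 (act True n lam a t) * 1) \<star> bas 0 = (coord 0 a * coord 0 t) \<star> (bas 0 :: osc)}"
    "hmodule {a. (coord 0 (act True n lam a t) * 1) \<star> bas 0 = (coord 0 a * coord 0 t) \<star> (bas 0 :: osc)}" for t
    using closed_hlin_eq[OF hlin_coord_smul[OF hlin_act_left] hlin_coord_smul[OF hlin_id]] by blast+
  have S: "closed ?S" "hmodule ?S"
    by (rule closed_INT, use S' in blast) (rule hmodule_Inter, use S' in blast)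
  have inj: "c \<star> (bas 0 :: osc) = d \<star> bas 0 \<longleftrightarrow> c = d" for c d
    by (metis coord_bas coord_smul mult.right_neutral)
  have mem: "a \<in> ?S \<longleftrightarrow> (\<forall>t. supported n t \<longrightarrow> coord 0 (act True n lam a t) = counit a * coord 0 t)" for a
    by (simp add: inj counit_coord)
  have y: "yroot i \<in> ?S" if i: "i \<in> {1..n}" for i
    unfolding mem
  proof (intro allI impI)
    fix t assume t: "supported n t"
    have "(coord 0 (act True n lam (yroot i) t) * 1) \<star> (bas 0 :: osc) \<in> {0}"
    proof (rule hmodule_supported_induct[OF hlin_coord_smul[OF hlin_act] hmodule_zero closed_zero _ t])
      fix \<kappa> assume k: "\<kappa> \<in> supp n"
      have y: "yroot i = yv (\<lambda>i. gen (lo True i)) i" using i by (simp add: yroot_conv lo_def)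
      have "0 \<noteq> \<kappa> + bet i"
      proof
        assume e: "0 = \<kappa> + bet i"
        have "lookup (\<kappa> + bet i) i = 0" unfolding e[symmetric] by simp
        then show False using supp_nonneg[OF k, of i] i by (simp add: lookup_add lookup_bet)
      qed
      then show "(coord 0 (act True n lam (yroot i) (bas \<kappa>)) * 1) \<star> (bas 0 :: osc) \<in> {0}"
        using i unfolding y by (subst act_yv) (auto simp: coord_bas)
    qed
    then show "coord 0 (act True n lam (yroot i) t) = counit (yroot i) * coord 0 t"
      using inj[of _ 0] by (simp add: counit_yroot)
  qed
  have "U_n_minus n \<subseteq> ?S"
    unfolding U_n_minus_def
  proof (rule gen_subalgebra_subset[OF subalgebraI[OF S(2)] S(1)])
    show "1 \<in> ?S" unfolding mem by (simp add: act_1)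
    show "x * y \<in> ?S" if "x \<in> ?S" "y \<in> ?S" for x y
      using that unfolding mem by (simp add: act_mult act_supported counit_mult mult.assoc)
    show "rel_ideal n \<subseteq> ?S" unfolding mem subset_eq by (simp add: rel_ideal_act counit_rel)
  qed (use y in blast)
  then have "a \<in> ?S" using assms(1) by blast
  then show ?thesis using assms(2) unfolding mem by blast
qed

text \<open>A right factor of counit 0 kills the generator, and a left factor of counit 0 kills the
  coefficient at exponent 0.\<close>

lemma proj_l_kernel_coord:
  assumes "u \<in> proj_l_kernel n"
  shows "coord 0 (act True n lam u (bas 0)) = 0"
proof -
  have "(coord 0 (act True n lam u (bas 0)) * 1) \<star> (bas 0 :: osc) \<in> {0}"
    using assms unfolding proj_l_kernel_def
  proof (rule closed_span_hlin[OF _ hlin_coord_smul[OF hlin_act_left] hmodule_zero closed_zero])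
    fix u assume "u \<in> {a * b * c |a b c. a \<in> U_n_minus n \<and> b \<in> U_l n \<and> c \<in> U_n_plus n \<and> (counit a = 0 \<or> counit c = 0)}"
    then obtain a b c where u: "u = a * b * c" "a \<in> U_n_minus n" "b \<in> U_l n" "c \<in> U_n_plus n" "counit a = 0 \<or> counit c = 0"
      by blast
    have "supported n (act True n lam b (bas 0))"
      by (rule act_supported) (rule supported_bas[OF zero_supp])
    then have "coord 0 (act True n lam u (bas 0)) = counit c * (counit a * coord 0 (act True n lam b (bas 0)))"
      by (simp add: u(1) act_mult U_n_plus_act[OF u(4)] act_smul U_n_minus_act[OF u(2)])
    then show "(coord 0 (act True n lam u (bas 0)) * 1) \<star> (bas 0 :: osc) \<in> {0}" using u(5) by auto
  qed
  then show ?thesis by (metis coord_0 coord_bas coord_smul mult.right_neutral singletonD)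
qed

definition decomposable :: "nat \<Rightarrow> alg set" where
  "decomposable n = {u. \<exists>l\<in>U_l n. u - l \<in> proj_l_kernel n}"

text \<open>Whatever element \<open>proj_l\<close> chooses, it has the same coefficient at exponent
  0 as u. An element of \<open>U_l\<close> acts on the generator by this coefficient, so it is
  congruent to that scalar modulo the left ideal.\<close>

lemma character_proj_l:
  assumes "lam \<notin> \<nat>" "u \<in> decomposable n"
  shows "character n lam (proj_l n u) = coord 0 (act True n lam u (bas 0))"
proof -
  interpret osc_mod True n lam by unfold_locales (rule assms(1))
  define l where "l = proj_l n u"
  have "l \<in> U_l n \<and> u - l \<in> proj_l_kernel n"
    unfolding l_def proj_l_def using assms(2)
    by (intro someI_ex[where P = "\<lambda>l. l \<in> U_l n \<and> u - l \<in> proj_l_kernel n"]) (auto simp: decomposable_def)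
  then have l: "l \<in> U_l n" "u - l \<in> proj_l_kernel n" by blast+
  have e: "coord 0 (act True n lam u (bas 0)) = coord 0 (act True n lam l (bas 0))"
    using proj_l_kernel_coord[OF l(2), of lam] by (simp add: act_diff_left)
  have J: "J_plus n lam = JJ True n lam" by (simp add: JJ_def)
  have "l - scal c \<in> J_plus n lam \<longleftrightarrow> c = coord 0 (act True n lam l (bas 0))" for c
  proof -
    have "l - scal c \<in> J_plus n lam \<longleftrightarrow> act True n lam l (bas 0) = c \<star> bas 0"
      unfolding J JJ_eq_kernel by (simp add: act_diff_left act_scal)
    also have "\<dots> \<longleftrightarrow> c = coord 0 (act True n lam l (bas 0))"
      using U_l_act[OF l(1), of lam] by (metis coord_bas coord_smul mult.right_neutral)
    finally show ?thesis .
  qed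
  then show ?thesis unfolding character_def l_def[symmetric] e by simp
qed

subsection \<open>Triangular decomposition\<close>

interpretation rel: ideal "rel_ideal n" for n
  by unfold_locales (rule rel_ideal_ideal)

lemma proj_l_kernel_hmodule: "hmodule (proj_l_kernel n)"
  unfolding proj_l_kernel_def by (rule closed_span_hmodule)

lemma decomposable_hmodule: "hmodule (decomposable n)"
proof (rule hmoduleI)
  note K = proj_l_kernel_hmodule[of n] and U = subalgebra_hmodule[OF U_l_subalgebra[of n]]
  show "0 \<in> decomposable n"
    unfolding decomposable_def using hmodule_0[OF K] hmodule_0[OF U] by force
  show "x + y \<in> decomposable n" if x: "x \<in> decomposable n" and y: "y \<in> decomposable n" for x y
  proof -
    obtain l where l: "l \<in> U_l n" "x - l \<in> proj_l_kernel n" using x by (auto simp: decomposable_def)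
    obtain m where m: "m \<in> U_l n" "y - m \<in> proj_l_kernel n" using y by (auto simp: decomposable_def)
    have "(x + y) - (l + m) \<in> proj_l_kernel n"
      using hmodule_add[OF K l(2) m(2)] by (simp add: algebra_simps)
    then show ?thesis unfolding decomposable_def using hmodule_add[OF U l(1) m(1)] by blast
  qed
  show "c \<star> x \<in> decomposable n" if x: "x \<in> decomposable n" for c x
  proof -
    obtain l where l: "l \<in> U_l n" "x - l \<in> proj_l_kernel n" using x by (auto simp: decomposable_def)
    have "c \<star> x - c \<star> l \<in> proj_l_kernel n"
      using hmodule_smul[OF K l(2), of c] by (simp add: hs.scale_right_diff_distrib)
    then show ?thesis unfolding decomposable_def using hmodule_smul[OF U l(1)] by blast
  qed
qed

lemma minus_counit_mem: "subalgebra S \<Longrightarrow> x \<in> S \<Longrightarrow> x - scal (counit x) \<in> S"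
  unfolding scal_conv
  by (intro hmodule_diff hmodule_smul subalgebra_hmodule subalgebra_1)

text \<open>Split a and c into their counits and remainders of counit 0: every term containing a
  remainder lies in the kernel.\<close>

lemma triangular_decomposable:
  assumes "a \<in> U_n_minus n" "b \<in> U_l n" "c \<in> U_n_plus n"
  shows "a * b * c \<in> decomposable n"
proof -
  let ?l = "(counit a * counit c) \<star> b"
  have k: "a' * b' * c' \<in> proj_l_kernel n"
    if "a' \<in> U_n_minus n" "b' \<in> U_l n" "c' \<in> U_n_plus n" "counit a' = 0 \<or> counit c' = 0" for a' b' c'
    unfolding proj_l_kernel_def by (rule closed_span_inc) (use that in blast)
  have "(a - scal (counit a)) * b * c \<in> proj_l_kernel n"
    by (rule k) (auto intro!: minus_counit_mem U_n_minus_subalgebra assms)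
  moreover have "1 * b * (c - scal (counit c)) \<in> proj_l_kernel n"
    by (rule k) (auto intro!: minus_counit_mem U_n_plus_subalgebra subalgebra_1 U_n_minus_subalgebra assms)
  ultimately have "(a - scal (counit a)) * b * c + counit a \<star> (1 * b * (c - scal (counit c))) \<in> proj_l_kernel n"
    by (intro hmodule_add[OF proj_l_kernel_hmodule] hmodule_smul[OF proj_l_kernel_hmodule])
  then have "a * b * c - ?l \<in> proj_l_kernel n"
    by (simp add: scal_conv left_diff_distrib right_diff_distrib hs.scale_right_diff_distrib mult.assoc)
  moreover have "?l \<in> U_l n" by (intro hmodule_smul subalgebra_hmodule U_l_subalgebra assms)
  ultimately show ?thesis unfolding decomposable_def by blast
qed

lemma rel_decomposable: "r \<in> rel_ideal n \<Longrightarrow> r \<in> decomposable n"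
  using triangular_decomposable[of r n 1 1] U_rel(3)[of r n]
    subalgebra_1[OF U_l_subalgebra] subalgebra_1[OF U_n_plus_subalgebra] by simp

text \<open>Polynomials in the Cartan generators inside the free algebra. Membership is imposed on
  each coefficient of h, so that \<open>Cart\<close> contains q^H and can be moved past weight
  vectors order by order.\<close>

inductive_set CP :: "nat \<Rightarrow> (word \<Rightarrow>\<^sub>0 complex) set" for n where
  const: "single 0 a \<in> CP n"
| H: "p \<in> CP n \<Longrightarrow> a \<in> {1..n + 1} \<Longrightarrow> single (Word [Hgen a]) 1 * p \<in> CP n"
| add: "p \<in> CP n \<Longrightarrow> r \<in> CP n \<Longrightarrow> p + r \<in> CP n"

definition Cart :: "nat \<Rightarrow> alg set" where
  "Cart n = {u. \<forall>m. fps_nth u m \<in> CP n}"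

lemma CP_0: "0 \<in> CP n" and CP_1: "1 \<in> CP n"
  using CP.const[of 0 n] CP.const[of 1 n] by simp_all

lemma CP_smult: "p \<in> CP n \<Longrightarrow> single 0 a * p \<in> CP n"
proof (induction p rule: CP.induct)
  case (const b)
  then show ?case by (simp add: mult_single CP.const)
next
  case (H p b)
  have "single 0 a * (single (Word [Hgen b]) 1 * p)
      = single (Word [Hgen b]) 1 * (single 0 a * p)"
    by (simp add: mult.assoc[symmetric] single_0_central)
  then show ?case using H by (simp add: CP.H)
qed (simp add: distrib_left CP.add)

lemma CP_mult: "p \<in> CP n \<Longrightarrow> r \<in> CP n \<Longrightarrow> p * r \<in> CP n"
  by (induction p rule: CP.induct) (simp_all add: CP_smult CP.H CP.add distrib_right mult.assoc)

lemma CP_sum: "(\<And>i. i \<in> A \<Longrightarrow> f i \<in> CP n) \<Longrightarrow> sum f A \<in> CP n"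
  by (induction A rule: infinite_finite_induct) (simp_all add: CP_0 CP.add)

lemma Cart_subalgebra: "subalgebra (Cart n)"
proof (rule subalgebraI)
  have m: "x * y \<in> Cart n" if "x \<in> Cart n" "y \<in> Cart n" for x y
    using that by (simp add: Cart_def fps_mult_nth CP_sum CP_mult)
  moreover have "scal c \<in> Cart n" for c by (simp add: Cart_def CP.const)
  ultimately show "hmodule (Cart n)"
    by (intro hmoduleI) (auto simp: smul_def, auto simp: Cart_def CP_0 CP.add)
  show "1 \<in> Cart n" by (simp add: Cart_def CP_0 CP_1)
qed (simp add: Cart_def fps_mult_nth CP_sum CP_mult)

lemmas Cart_hmodule = subalgebra_hmodule[OF Cart_subalgebra]

lemma qcartan_Cart: "qcartan n \<mu> \<in> Cart n"
proof -
  have "single (Word [Hgen a]) (\<mu> a) \<in> CP n" if "a \<in> {1..n + 1}" for a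
    using CP_smult[OF CP.H[OF CP_1 that], of "\<mu> a"] by (simp add: mult_single)
  then have "cartan0 n \<mu> \<in> CP n" unfolding cartan0_def by (rule CP_sum)
  then have "cartan0 n \<mu> ^ k \<in> CP n" for k by (induction k) (simp_all add: CP_1 CP_mult)
  then show ?thesis by (simp add: Cart_def qcartan_def CP_smult)
qed

lemma qnum_cartan_Cart: "qnum_cartan n \<mu> \<in> Cart n"
proof -
  have "fps_shift 1 (qcartan n \<mu> - qcartan n (\<lambda>a. - \<mu> a)) \<in> Cart n"
    using hmodule_diff[OF Cart_hmodule qcartan_Cart qcartan_Cart] by (simp add: Cart_def)
  then show ?thesis
    unfolding qnum_cartan_def smul_def[symmetric] by (rule hmodule_smul[OF Cart_hmodule])
qed

lemma CP_U_l: "p \<in> CP n \<Longrightarrow> fps_const p \<in> U_l n"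
proof (induction p rule: CP.induct)
  case (const a)
  have "fps_const (single 0 a) = fps_const a \<star> (1 :: alg)"
    by (rule fps_ext) (simp add: smul_const_nth)
  then show ?case
    using hmodule_smul[OF subalgebra_hmodule subalgebra_1, OF U_l_subalgebra U_l_subalgebra] by metis
next
  case (H p a)
  have "fps_const (single (Word [Hgen a]) 1 * p) = gen (Hgen a) * fps_const p"
    by (simp add: gen_def)
  then show ?case using H subalgebra_mult[OF U_l_subalgebra] U_l_gens(3) by metis
next
  case (add p r)
  then show ?case
    using hmodule_add[OF subalgebra_hmodule[OF U_l_subalgebra]] by (metis fps_const_add)
qed

lemma Cart_U_l: "u \<in> Cart n \<Longrightarrow> u \<in> U_l n"
  by (rule closed_hmodule_coeffI[OF subalgebra_hmodule[OF U_l_subalgebra] U_l_closed])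
    (simp add: Cart_def CP_U_l)

definition h_eigen :: "nat \<Rightarrow> alg \<Rightarrow> bool" where
  "h_eigen n x \<longleftrightarrow> (\<forall>a\<in>{1..n + 1}. \<exists>c. gen (Hgen a) * x - (x * gen (Hgen a) + fps_const c \<star> x) \<in> rel_ideal n)"

lemma h_eigen_gens: "i \<in> {1..n} \<Longrightarrow> h_eigen n (ee i)" "i \<in> {1..n} \<Longrightarrow> h_eigen n (ff i)"
  unfolding h_eigen_def
proof safe
  fix a assume i: "i \<in> {1..n}" and a: "a \<in> {1..n + 1}"
  show "\<exists>c. gen (Hgen a) * ee i - (ee i * gen (Hgen a) + fps_const c \<star> ee i) \<in> rel_ideal n"
    using rel_H_ee[OF a i] by (intro exI[of _ "alpha i a"]) (simp add: algebra_simps)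
  have "gen (Hgen a) * ff i - (ff i * gen (Hgen a) + fps_const (- alpha i a) \<star> ff i)
      = gen (Hgen a) * ff i - ff i * gen (Hgen a) + fps_const (alpha i a) \<star> ff i"
    unfolding fps_const_neg_smul by (simp add: algebra_simps)
  then show "\<exists>c. gen (Hgen a) * ff i - (ff i * gen (Hgen a) + fps_const c \<star> ff i) \<in> rel_ideal n"
    using rel_H_ff[OF a i] by metis
qed

text \<open>Passing a weight vector replaces each H by H plus or minus a constant, which is again a
  polynomial of this kind.\<close>

lemma CP_shift:
  assumes x: "h_eigen n x" and p: "p \<in> CP n"
  shows "\<exists>r\<in>CP n. fps_const p * x - x * fps_const r \<in> rel_ideal n"
    and "\<exists>r\<in>CP n. x * fps_const p - fps_const r * x \<in> rel_ideal n"
proof -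
  have gH: "fps_const (single (Word [Hgen a]) 1 * r) = gen (Hgen a) * fps_const r" for a r
    by (simp add: gen_def)
  have sH: "fps_const (single 0 c * r) = fps_const c \<star> fps_const r" for c and r :: "word \<Rightarrow>\<^sub>0 complex"
    by (rule fps_ext) (simp add: smul_const_nth)
  have "(\<exists>r\<in>CP n. fps_const p * x - x * fps_const r \<in> rel_ideal n) \<and>
      (\<exists>r\<in>CP n. x * fps_const p - fps_const r * x \<in> rel_ideal n)"
    using p
  proof (induction p rule: CP.induct)
    case (const a)
    have "fps_const (single 0 a) * x = x * fps_const (single 0 a)"
      using sH[of a 1] by simp
    then show ?case using CP.const[of a n] rel.I_0 by (metis cancel_comm_monoid_add_class.diff_cancel)
  next
    case (H p a)
    obtain c where c: "gen (Hgen a) * x - (x * gen (Hgen a) + fps_const c \<star> x) \<in> rel_ideal n"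
      using x H(2) unfolding h_eigen_def by blast
    obtain r where r: "r \<in> CP n" "fps_const p * x - x * fps_const r \<in> rel_ideal n" using H(3) by blast
    obtain r' where r': "r' \<in> CP n" "x * fps_const p - fps_const r' * x \<in> rel_ideal n" using H(3) by blast
    let ?h = "single (Word [Hgen a]) (1 :: complex)"
    have "gen (Hgen a) * (fps_const p * x - x * fps_const r)
        + (gen (Hgen a) * x - (x * gen (Hgen a) + fps_const c \<star> x)) * fps_const r \<in> rel_ideal n"
      by (intro rel.I_add rel.I_l rel.I_r r c)
    then have "fps_const (?h * p) * x - x * fps_const (?h * r + single 0 c * r) \<in> rel_ideal n"
      unfolding gH fps_const_add[symmetric] sH by (simp add: algebra_simps)
    moreover have "?h * r + single 0 c * r \<in> CP n"
      using r(1) H(2) by (intro CP.add CP.H CP_smult)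
    moreover have "gen (Hgen a) * (x * fps_const p - fps_const r' * x) - fps_const c \<star> (x * fps_const p - fps_const r' * x)
        - (gen (Hgen a) * x - (x * gen (Hgen a) + fps_const c \<star> x)) * fps_const p \<in> rel_ideal n"
      by (intro rel.I_diff rel.I_smul rel.I_l rel.I_r r' c)
    then have "x * fps_const (?h * p) - fps_const (?h * r' + single 0 (- c) * r') * x \<in> rel_ideal n"
      unfolding gH fps_const_add[symmetric] sH fps_const_neg_smul
      by (simp add: algebra_simps hs.scale_right_diff_distrib)
    moreover have "?h * r' + single 0 (- c) * r' \<in> CP n"
      using r'(1) H(2) by (intro CP.add CP.H CP_smult)
    ultimately show ?case by blast
  next
    case (add p q)
    obtain r1 r2 where r: "r1 \<in> CP n" "fps_const p * x - x * fps_const r1 \<in> rel_ideal n"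
      "r2 \<in> CP n" "fps_const q * x - x * fps_const r2 \<in> rel_ideal n" using add by blast
    obtain s1 s2 where s: "s1 \<in> CP n" "x * fps_const p - fps_const s1 * x \<in> rel_ideal n"
      "s2 \<in> CP n" "x * fps_const q - fps_const s2 * x \<in> rel_ideal n" using add by blast
    have "fps_const (p + q) * x - x * fps_const (r1 + r2) \<in> rel_ideal n"
      using rel.I_add[OF r(2,4)] unfolding fps_const_add[symmetric] by (simp add: algebra_simps del: fps_const_add)
    moreover have "x * fps_const (p + q) - fps_const (s1 + s2) * x \<in> rel_ideal n"
      using rel.I_add[OF s(2,4)] unfolding fps_const_add[symmetric] by (simp add: algebra_simps del: fps_const_add)
    ultimately show ?case using r s CP.add by blast
  qed
  then show "\<exists>r\<in>CP n. fps_const p * x - x * fps_const r \<in> rel_ideal n"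
    "\<exists>r\<in>CP n. x * fps_const p - fps_const r * x \<in> rel_ideal n" by blast+
qed

text \<open>Since the relation ideal is closed, infinitely many rewritings, one for each order of h,
  may be combined into one.\<close>

lemma coeffwise_rel:
  assumes "hlin f" "hlin g" "\<And>m. f (fps_const (fps_nth u m)) - g (fps_const (fps_nth v m)) \<in> rel_ideal n"
  shows "f u - g v \<in> rel_ideal n"
proof (rule closed_hserD[OF rel_ideal_closed])
  fix d
  have "f u = (\<Sum>i<d. hX ^ i \<star> f (fps_const (fps_nth u i))) + hX ^ d \<star> f (fps_shift d u)"
    by (subst hser_expand[of u d]) (simp only: hlin_add[OF assms(1)] hlin_sum[OF assms(1)] hlin_smul[OF assms(1)])
  moreover have "g v = (\<Sum>i<d. hX ^ i \<star> g (fps_const (fps_nth v i))) + hX ^ d \<star> g (fps_shift d v)"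
    by (subst hser_expand[of v d]) (simp only: hlin_add[OF assms(2)] hlin_sum[OF assms(2)] hlin_smul[OF assms(2)])
  ultimately have "f u - g v = (\<Sum>i<d. hX ^ i \<star> (f (fps_const (fps_nth u i)) - g (fps_const (fps_nth v i))))
      + hX ^ d \<star> (f (fps_shift d u) - g (fps_shift d v))"
    by (simp add: sum_subtractf hs.scale_right_diff_distrib)
  moreover have "(\<Sum>i<d. hX ^ i \<star> (f (fps_const (fps_nth u i)) - g (fps_const (fps_nth v i)))) \<in> rel_ideal n"
    by (intro hmodule_sum[OF rel.hmod] rel.I_smul assms(3))
  ultimately show "\<exists>y\<in>rel_ideal n. \<exists>z. f u - g v = y + hX ^ d \<star> z" by blast
qed

lemma Cart_shift:
  assumes x: "h_eigen n x" and u: "u \<in> Cart n"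
  shows "\<exists>v\<in>Cart n. u * x - x * v \<in> rel_ideal n" and "\<exists>v\<in>Cart n. x * u - v * x \<in> rel_ideal n"
proof -
  have u: "fps_nth u m \<in> CP n" for m using u by (simp add: Cart_def)
  obtain r where r: "\<And>m. r m \<in> CP n" "\<And>m. fps_const (fps_nth u m) * x - x * fps_const (r m) \<in> rel_ideal n"
    using CP_shift(1)[OF x u] by metis
  have "u * x - x * Abs_fps r \<in> rel_ideal n"
    by (rule coeffwise_rel[OF hlin_rmult hlin_lmult]) (simp add: r)
  then show "\<exists>v\<in>Cart n. u * x - x * v \<in> rel_ideal n" using r(1) by (intro bexI[of _ "Abs_fps r"]) (auto simp: Cart_def)
  obtain s where s: "\<And>m. s m \<in> CP n" "\<And>m. x * fps_const (fps_nth u m) - fps_const (s m) * x \<in> rel_ideal n"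
    using CP_shift(2)[OF x u] by metis
  have "x * u - Abs_fps s * x \<in> rel_ideal n"
    by (rule coeffwise_rel[OF hlin_lmult hlin_rmult]) (simp add: s)
  then show "\<exists>v\<in>Cart n. x * u - v * x \<in> rel_ideal n" using s(1) by (intro bexI[of _ "Abs_fps s"]) (auto simp: Cart_def)
qed

section \<open>Ordering words: lowering, Cartan, raising\<close>

lemma lw_simps: "lw s [] = 1" "lw s (i # gs) = gen (lo s i) * lw s gs"
  by (simp_all add: lw_def)

lemma lo_simps: "lo True i = Fgen i" "lo False i = Egen i"
  by (simp_all add: lo_def)

lemma Cart_shift_lw:
  assumes "u \<in> Cart n" "set gs \<subseteq> {1..n}"
  shows "\<exists>v\<in>Cart n. u * lw True gs - lw True gs * v \<in> rel_ideal n"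
  using assms(2,1)
proof (induction gs arbitrary: u)
  case Nil
  then show ?case using rel.I_0 by (intro bexI[of _ u]) (auto simp: lw_simps)
next
  case (Cons i gs)
  obtain v where v: "v \<in> Cart n" "u * ff i - ff i * v \<in> rel_ideal n"
    using Cart_shift(1)[OF h_eigen_gens(2), of i n u] Cons by auto
  obtain w where w: "w \<in> Cart n" "v * lw True gs - lw True gs * w \<in> rel_ideal n"
    using Cons v by auto
  have "(u * ff i - ff i * v) * lw True gs + ff i * (v * lw True gs - lw True gs * w) \<in> rel_ideal n"
    by (intro rel.I_add rel.I_l rel.I_r v w)
  then have "u * lw True (i # gs) - lw True (i # gs) * w \<in> rel_ideal n"
    by (simp add: lw_simps lo_simps algebra_simps)
  then show ?case using w(1) by blast
qed

text \<open>The span is taken without closure to match \<open>decomposable\<close>: along a limit of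
  decomposable elements the chosen projections would have to converge as well.\<close>

definition mspan :: "nat \<Rightarrow> alg set \<Rightarrow> alg set" where
  "mspan n B = hmodule hull (B \<union> rel_ideal n)"

lemma mspan_hmodule: "hmodule (mspan n B)"
  unfolding mspan_def by (rule hmodule_hull)

lemma mspan_base: "x \<in> B \<Longrightarrow> x \<in> mspan n B" and mspan_rel: "x \<in> rel_ideal n \<Longrightarrow> x \<in> mspan n B"
  unfolding mspan_def by (auto intro: hull_inc)

lemma mspan_lmult:
  assumes "x \<in> mspan n B" "hmodule S" "rel_ideal n \<subseteq> S" "\<And>x. x \<in> B \<Longrightarrow> u * x \<in> S"
  shows "u * x \<in> S"
  using assms(1) unfolding mspan_def
  by (rule hull_hmodule_hlin[OF _ hlin_lmult assms(2)]) (use assms(3,4) rel.I_l in blast)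

lemma mspan_rmult:
  assumes "x \<in> mspan n B" "hmodule S" "rel_ideal n \<subseteq> S" "\<And>x. x \<in> B \<Longrightarrow> x * u \<in> S"
  shows "x * u \<in> S"
  using assms(1) unfolding mspan_def
  by (rule hull_hmodule_hlin[OF _ hlin_rmult assms(2)]) (use assms(3,4) rel.I_r in blast)

lemma mspan_subset: "rel_ideal n \<subseteq> mspan n B"
  using mspan_rel by blast

definition FC :: "nat \<Rightarrow> alg set" where
  "FC n = mspan n {lw True gs * c |gs c. set gs \<subseteq> {1..n} \<and> c \<in> Cart n}"

definition FCE :: "nat \<Rightarrow> alg set" where
  "FCE n = mspan n {lw True gs * c * lw False hs |gs c hs.
     set gs \<subseteq> {1..n} \<and> c \<in> Cart n \<and> set hs \<subseteq> {1..n}}"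

lemma FC_hmodule: "hmodule (FC n)" and FCE_hmodule: "hmodule (FCE n)"
  by (simp_all add: FC_def FCE_def mspan_hmodule)

lemma FC_gen: "set gs \<subseteq> {1..n} \<Longrightarrow> c \<in> Cart n \<Longrightarrow> lw True gs * c \<in> FC n"
  and FC_rel: "r \<in> rel_ideal n \<Longrightarrow> r \<in> FC n"
  and FCE_gen: "set gs \<subseteq> {1..n} \<Longrightarrow> c \<in> Cart n \<Longrightarrow> set hs \<subseteq> {1..n} \<Longrightarrow> lw True gs * c * lw False hs \<in> FCE n"
  and FCE_rel: "r \<in> rel_ideal n \<Longrightarrow> r \<in> FCE n"
  unfolding FC_def FCE_def by (auto intro: mspan_base mspan_rel)

lemma FC_ff:
  assumes "i \<in> {1..n}" "u \<in> FC n"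
  shows "ff i * u \<in> FC n"
  using assms(2) unfolding FC_def
proof (rule mspan_lmult[OF _ mspan_hmodule mspan_subset], fold FC_def, elim CollectE exE conjE)
  fix x gs c assume "x = lw True gs * c" "set gs \<subseteq> {1..n}" "c \<in> Cart n"
  then show "ff i * x \<in> FC n"
    using assms(1) FC_gen[of "i # gs" n c] by (simp add: lw_simps lo_simps mult.assoc)
qed

lemma FC_FCE:
  assumes "u \<in> FC n" "c \<in> Cart n" "set hs \<subseteq> {1..n}"
  shows "u * (c * lw False hs) \<in> FCE n"
  using assms(1) unfolding FC_def FCE_def
proof (rule mspan_rmult[OF _ mspan_hmodule mspan_subset], fold FCE_def, elim CollectE exE conjE)
  fix x gs c' assume "x = lw True gs * c'" "set gs \<subseteq> {1..n}" "c' \<in> Cart n"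
  then show "x * (c * lw False hs) \<in> FCE n"
    using FCE_gen[of gs n "c' * c" hs] subalgebra_mult[OF Cart_subalgebra] assms by (simp add: mult.assoc)
qed

text \<open>Every f passed leaves a Cartan term, which \<open>Cart_shift_lw\<close> moves to the
  right end of the word.\<close>

lemma ee_lw_comm:
  assumes "i \<in> {1..n}" "set gs \<subseteq> {1..n}"
  shows "ee i * lw True gs - lw True gs * ee i \<in> FC n"
  using assms(2)
proof (induction gs)
  case Nil
  then show ?case by (simp add: lw_simps hmodule_0[OF FC_hmodule])
next
  case (Cons j gs)
  define D where "D = (if i = j then qnum_cartan n (alpha i) else 0)"
  have D: "ee i * ff j - ff j * ee i - D \<in> rel_ideal n"
    unfolding D_def using rel_EF[of i n j] assms Cons by auto
  have DC: "D \<in> Cart n" by (simp add: D_def qnum_cartan_Cart hmodule_0[OF Cart_hmodule])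
  then obtain v where v: "v \<in> Cart n" "D * lw True gs - lw True gs * v \<in> rel_ideal n"
    using Cart_shift_lw[of D n gs] Cons by auto
  have "lw True gs * v \<in> FC n" using Cons v by (intro FC_gen) auto
  moreover have "ff j * (ee i * lw True gs - lw True gs * ee i) \<in> FC n" using Cons by (intro FC_ff) auto
  ultimately have "(ee i * ff j - ff j * ee i - D) * lw True gs + (D * lw True gs - lw True gs * v)
      + lw True gs * v + ff j * (ee i * lw True gs - lw True gs * ee i) \<in> FC n"
    by (intro hmodule_add[OF FC_hmodule] FC_rel[OF rel.I_r[OF D]] FC_rel[OF v(2)])
  then show ?case by (simp add: lw_simps lo_simps algebra_simps)
qed

lemma FCE_stable:
  assumes "u \<in> FCE n"
  shows "i \<in> {1..n} \<Longrightarrow> ee i * u \<in> FCE n" and "d \<in> Cart n \<Longrightarrow> d * u \<in> FCE n"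
proof -
  have ind: "v * u \<in> FCE n"
    if "\<And>gs c hs. set gs \<subseteq> {1..n} \<Longrightarrow> c \<in> Cart n \<Longrightarrow> set hs \<subseteq> {1..n} \<Longrightarrow> v * (lw True gs * c * lw False hs) \<in> FCE n" for v
    using assms unfolding FCE_def
    by (rule mspan_lmult[OF _ mspan_hmodule mspan_subset]) (use that in \<open>auto simp: FCE_def\<close>)
  show "ee i * u \<in> FCE n" if i: "i \<in> {1..n}"
  proof (rule ind)
    fix gs c hs assume x: "set gs \<subseteq> {1..n}" "c \<in> Cart n" "set hs \<subseteq> {1..n}"
    obtain v where v: "v \<in> Cart n" "ee i * c - v * ee i \<in> rel_ideal n"
      using Cart_shift(2)[OF h_eigen_gens(1)[OF i] x(2)] by blast
    have "(ee i * lw True gs - lw True gs * ee i) * (c * lw False hs)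
        + lw True gs * ((ee i * c - v * ee i) * lw False hs) + lw True gs * v * lw False (i # hs) \<in> FCE n"
      using x i v by (intro hmodule_add[OF FCE_hmodule] FC_FCE ee_lw_comm FCE_rel rel.I_l rel.I_r FCE_gen) auto
    then show "ee i * (lw True gs * c * lw False hs) \<in> FCE n" by (simp add: lw_simps lo_simps algebra_simps)
  qed
  show "d * u \<in> FCE n" if d: "d \<in> Cart n"
  proof (rule ind)
    fix gs c hs assume x: "set gs \<subseteq> {1..n}" "c \<in> Cart n" "set hs \<subseteq> {1..n}"
    obtain v where v: "v \<in> Cart n" "d * lw True gs - lw True gs * v \<in> rel_ideal n"
      using Cart_shift_lw[OF d x(1)] by blast
    have "(d * lw True gs - lw True gs * v) * (c * lw False hs) + lw True gs * (v * c) * lw False hs \<in> FCE n"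
      using x v by (intro hmodule_add[OF FCE_hmodule] FCE_rel rel.I_r FCE_gen subalgebra_mult[OF Cart_subalgebra]) auto
    then show "d * (lw True gs * c * lw False hs) \<in> FCE n" by (simp add: algebra_simps)
  qed
qed

section \<open>From words in simple generators to triangular form\<close>

definition yws :: "nat list \<Rightarrow> alg" where "yws ws = prod_list (map (yv ff) ws)"
definition xws :: "nat list \<Rightarrow> alg" where "xws ws = prod_list (map (xv ee) ws)"

text \<open>Words in the f's are brought to this form from the left, words in the e's to the form of
  \<open>LX\<close> from the right. In an ordered word the two factors from \<open>U_l\<close> then
  meet around the Cartan factor.\<close>

definition YL :: "nat \<Rightarrow> alg set" where
  "YL n = mspan n {yws ws * b |ws b. set ws \<subseteq> {1..n} \<and> b \<in> U_l n}"

definition LX :: "nat \<Rightarrow> alg set" where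
  "LX n = mspan n {b * xws ws |ws b. set ws \<subseteq> {1..n} \<and> b \<in> U_l n}"

lemma YL_hmodule: "hmodule (YL n)" and LX_hmodule: "hmodule (LX n)"
  by (simp_all add: YL_def LX_def mspan_hmodule)

lemma YL_gen: "set ws \<subseteq> {1..n} \<Longrightarrow> b \<in> U_l n \<Longrightarrow> yws ws * b \<in> YL n"
  and LX_gen: "set ws \<subseteq> {1..n} \<Longrightarrow> b \<in> U_l n \<Longrightarrow> b * xws ws \<in> LX n"
  and LX_rel: "r \<in> rel_ideal n \<Longrightarrow> r \<in> LX n"
  unfolding YL_def LX_def by (auto intro: mspan_base mspan_rel)

lemma LX_cong: "u - v \<in> rel_ideal n \<Longrightarrow> v \<in> LX n \<Longrightarrow> u \<in> LX n"
  using hmodule_cong[OF LX_hmodule LX_rel] by blast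

lemma YL_lmult:
  assumes "\<And>ws b. set ws \<subseteq> {1..n} \<Longrightarrow> b \<in> U_l n \<Longrightarrow> v * (yws ws * b) \<in> YL n" "u \<in> YL n"
  shows "v * u \<in> YL n"
  using assms(2) unfolding YL_def
  by (rule mspan_lmult[OF _ mspan_hmodule mspan_subset]) (use assms(1) in \<open>auto simp: YL_def\<close>)

lemma LX_rmult:
  assumes "\<And>ws b. set ws \<subseteq> {1..n} \<Longrightarrow> b \<in> U_l n \<Longrightarrow> b * xws ws * v \<in> LX n" "u \<in> LX n"
  shows "u * v \<in> LX n"
  using assms(2) unfolding LX_def
  by (rule mspan_rmult[OF _ mspan_hmodule mspan_subset]) (use assms(1) in \<open>auto simp: LX_def\<close>)

lemma YL_yv: "i \<in> {1..n} \<Longrightarrow> u \<in> YL n \<Longrightarrow> yv ff i * u \<in> YL n"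
proof (rule YL_lmult)
  fix ws b assume "i \<in> {1..n}" "set ws \<subseteq> {1..n}" "b \<in> U_l n"
  then show "yv ff i * (yws ws * b) \<in> YL n" using YL_gen[of "i # ws" n b] by (simp add: yws_def mult.assoc)
qed

lemma LX_xv: "i \<in> {1..n} \<Longrightarrow> u \<in> LX n \<Longrightarrow> u * xv ee i \<in> LX n"
proof (rule LX_rmult)
  fix ws b assume "i \<in> {1..n}" "set ws \<subseteq> {1..n}" "b \<in> U_l n"
  then show "b * xws ws * xv ee i \<in> LX n" using LX_gen[of "ws @ [i]" n b] by (simp add: xws_def mult.assoc)
qed

lemma YL_ff:
  assumes j: "j \<in> {1..n}" and u: "u \<in> YL n"
  shows "ff j * u \<in> YL n"
proof (rule YL_lmult[OF _ u])
  interpret f: serre_family "rel_ideal n" n ff by (rule serre_family_ff)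
  fix ws b assume ws: "set ws \<subseteq> {1..n}" and b: "b \<in> U_l n"
  have m: "c \<in> YL n" if "c \<in> U_l n" for c using YL_gen[of "[]" n c] that by (simp add: yws_def)
  show "ff j * (yws ws * b) \<in> YL n"
    unfolding yws_def
    by (rule f.g_yv_word_mem[OF YL_hmodule _ YL_yv m[OF b] m j ws])
      (auto simp: YL_def b U_l_gens intro: mspan_rel subalgebra_mult[OF U_l_subalgebra])
qed

text \<open>Mirror image of \<open>g_yv_word_mem\<close>: the generator moves to the left until
  \<open>U_l\<close> absorbs it, while for j = 1 it is itself a root vector.\<close>

lemma LX_xws_ee:
  assumes j: "j \<in> {1..n}" and b: "b \<in> U_l n" and ws: "set ws \<subseteq> {1..n}"
  shows "b * xws ws * ee j \<in> LX n"
proof (cases "j = 1")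
  case True
  then show ?thesis using LX_gen[of "ws @ [j]" n b] j b ws by (simp add: xws_def mult.assoc)
next
  case False
  interpret e: serre_family "rel_ideal n" n ee by (rule serre_family_ee)
  show ?thesis
    using ws
  proof (induction ws rule: rev_induct)
    case Nil
    have "ee j \<in> U_l n" using j False by (intro U_l_gens) auto
    then show ?case using LX_gen[of "[]" n "b * ee j"] b subalgebra_mult[OF U_l_subalgebra] by (simp add: xws_def)
  next
    case (snoc i ws)
    then have i: "i \<in> {1..n}" by simp
    let ?u = "b * xws ws"
    have IH: "?u * ee j * xv ee i \<in> LX n" using snoc i by (intro LX_xv) auto
    have c: "b * xws (ws @ [i]) * ee j \<in> LX n" if "xv ee i * ee j - v \<in> rel_ideal n" "?u * v \<in> LX n" for v
      using LX_cong[of "b * xws (ws @ [i]) * ee j" "?u * v"] rel.I_l[OF that(1), of "?u"] that(2)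
      by (simp add: xws_def right_diff_distrib mult.assoc)
    consider "j = i" | "j = Suc i" | "j < i" | "Suc i < j" by linarith
    then show ?case
    proof cases
      case 1
      then show ?thesis using e.top_comm(2)[of i] i False IH
        by (intro c[of "qpw 1 \<star> (ee j * xv ee i)"]) (auto simp: mult.assoc intro: hmodule_smul[OF LX_hmodule])
    next
      case 2
      have "xv ee i * ee j - (xv ee (Suc i) + qpw (- 1) \<star> (ee j * xv ee i)) \<in> rel_ideal n"
        using e.xv_step[of i] i 2 rel.I_0 by (simp add: qcomm_conv)
      moreover have "?u * xv ee (Suc i) \<in> LX n"
        using 2 j snoc b by (intro LX_xv LX_gen) auto
      ultimately show ?thesis
        using IH by (intro c[of "xv ee (Suc i) + qpw (- 1) \<star> (ee j * xv ee i)"])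
          (auto simp: distrib_left mult.assoc intro!: hmodule_add[OF LX_hmodule] hmodule_smul[OF LX_hmodule]
            simp del: xv.simps)
    next
      case 3
      then show ?thesis using rel.cong_sym[OF e.inner_comm(2)[of j i]] i j False IH
        by (intro c[of "ee j * xv ee i"]) (auto simp: mult.assoc)
    next
      case 4
      then show ?thesis using rel.cong_sym[OF e.far_comm(2)[of i j]] i j False IH
        by (intro c[of "ee j * xv ee i"]) (auto simp: mult.assoc)
    qed
  qed
qed

lemma LX_ee: "j \<in> {1..n} \<Longrightarrow> u \<in> LX n \<Longrightarrow> u * ee j \<in> LX n"
  by (rule LX_rmult[OF LX_xws_ee])

lemma lw_YL: "set gs \<subseteq> {1..n} \<Longrightarrow> lw True gs \<in> YL n"
proof (induction gs)
  case Nil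
  then show ?case using YL_gen[of "[]" n 1] subalgebra_1[OF U_l_subalgebra] by (simp add: lw_simps yws_def)
qed (simp add: lw_simps lo_simps YL_ff)

lemma lw_LX: "set gs \<subseteq> {1..n} \<Longrightarrow> lw False gs \<in> LX n"
proof (induction gs rule: rev_induct)
  case Nil
  then show ?case using LX_gen[of "[]" n 1] subalgebra_1[OF U_l_subalgebra] by (simp add: lw_simps xws_def)
qed (simp add: lw_append lw_simps lo_simps LX_ee)

lemma yws_U_n_minus: "set ws \<subseteq> {1..n} \<Longrightarrow> yws ws \<in> U_n_minus n"
proof (induction ws)
  case Nil
  then show ?case by (simp add: yws_def subalgebra_1[OF U_n_minus_subalgebra])
next
  case (Cons i ws)
  then have "yv ff i \<in> U_n_minus n" using U_n_gens(2)[of i n] yroot_conv[of i] by simp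
  then show ?case using Cons subalgebra_mult[OF U_n_minus_subalgebra] by (simp add: yws_def)
qed

text \<open>The normalizing power of q in \<open>xroot\<close> is a unit and can be divided
  out.\<close>

lemma xv_U_n_plus: "i \<in> {1..n} \<Longrightarrow> xv ee i \<in> U_n_plus n"
proof -
  assume i: "i \<in> {1..n}"
  let ?c = "qpw (2 * (of_nat i - 1))"
  note h = subalgebra_hmodule[OF U_n_plus_subalgebra[of n]]
  have "xroot i - ?c \<star> xv ee i \<in> U_n_plus n"
    using xroot_conv[of i n] i by (intro U_rel) auto
  then have "xroot i - (xroot i - ?c \<star> xv ee i) \<in> U_n_plus n"
    by (rule hmodule_diff[OF h U_n_gens(1)[OF i]])
  then have "?c \<star> xv ee i \<in> U_n_plus n" by simp
  then have "inverse ?c \<star> ?c \<star> xv ee i \<in> U_n_plus n"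
    by (rule hmodule_smul[OF h])
  moreover have "inverse ?c * ?c = 1" by (rule fps_inverse_unit) simp
  ultimately show ?thesis unfolding hs.scale_scale by simp
qed

lemma xws_U_n_plus: "set ws \<subseteq> {1..n} \<Longrightarrow> xws ws \<in> U_n_plus n"
proof (induction ws)
  case Nil
  then show ?case by (simp add: xws_def subalgebra_1[OF U_n_plus_subalgebra])
next
  case (Cons i ws)
  then show ?case using subalgebra_mult[OF U_n_plus_subalgebra] xv_U_n_plus[of i n] by (simp add: xws_def)
qed

lemma FCE_decomposable: "FCE n \<subseteq> decomposable n"
proof -
  have R: "rel_ideal n \<subseteq> decomposable n" using rel_decomposable by blast
  have "\<phi> * (c * \<epsilon>) \<in> decomposable n" if c: "c \<in> Cart n" and e: "\<epsilon> \<in> LX n" and f: "\<phi> \<in> YL n" for c \<phi> \<epsilon>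
    using f unfolding YL_def
  proof (rule mspan_rmult[OF _ decomposable_hmodule R], elim CollectE exE conjE)
    fix \<phi> ws b assume p: "\<phi> = yws ws * b" "set ws \<subseteq> {1..n}" "b \<in> U_l n"
    have "\<phi> * c * \<epsilon> \<in> decomposable n"
      using e unfolding LX_def
    proof (rule mspan_lmult[OF _ decomposable_hmodule R], elim CollectE exE conjE)
      fix \<epsilon> vs b' assume q: "\<epsilon> = b' * xws vs" "set vs \<subseteq> {1..n}" "b' \<in> U_l n"
      have "yws ws * (b * c * b') * xws vs \<in> decomposable n"
        using p q Cart_U_l[OF c]
        by (intro triangular_decomposable yws_U_n_minus xws_U_n_plus subalgebra_mult[OF U_l_subalgebra])
      then show "\<phi> * c * \<epsilon> \<in> decomposable n" by (simp add: p(1) q(1) mult.assoc)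
    qed
    then show "\<phi> * (c * \<epsilon>) \<in> decomposable n" by (simp add: mult.assoc)
  qed
  then show ?thesis
    unfolding FCE_def mspan_def using R lw_YL lw_LX
    by (intro hull_minimal decomposable_hmodule) (auto simp: mult.assoc)
qed

subsection \<open>The antipode\<close>

lemma antipode_ext: "antipode n u = ext (\<lambda>w. prod_list (rev (map (antipode_gen n) (letters w)))) u"
proof (rule fps_ext)
  fix m
  have "fps_nth (antipode0 n p) j = (\<Sum>w\<in>keys p. single 0 (lookup p w)
      * fps_nth (prod_list (rev (map (antipode_gen n) (letters w)))) j)" for p j
    unfolding antipode0_def smul_def[symmetric] by (simp add: fps_sum_nth smul_const_nth)
  then show "fps_nth (antipode n u) m = fps_nth (ext (\<lambda>w. prod_list (rev (map (antipode_gen n) (letters w)))) u) m"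
    by (simp add: antipode_def ext_def)
qed

lemma lw_bas: "lw s gs = bas (Word (map (lo s) gs))"
proof (induction gs)
  case Nil
  then show ?case by (simp add: lw_simps bas_0 flip: zero_word_def)
next
  case (Cons i gs)
  then show ?case by (simp add: lw_simps gen_conv bas_mult plus_word_def)
qed

lemma antipode_lw:
  "antipode n (c \<star> lw False gs) = c \<star> prod_list (rev (map (\<lambda>i. antipode_gen n (Egen i)) gs))"
  by (simp add: antipode_ext hlin_smul[OF hlin_ext] lw_bas lo_simps comp_def)

text \<open>The antipode turns a word in the e's into a product of factors -q^-H e. Each of them
  preserves \<open>FCE\<close>, which contains the words in the f's.\<close>

lemma antipode_decomposable:
  assumes "set gs \<subseteq> {1..n}" "set hs \<subseteq> {1..n}"
  shows "antipode n (c \<star> lw False gs) * (d \<star> lw True hs) \<in> decomposable n"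
proof -
  have st: "antipode_gen n (Egen i) * u \<in> FCE n" if "i \<in> {1..n}" "u \<in> FCE n" for i u
    using that by (simp add: mult.assoc FCE_stable qcartan_Cart hmodule_uminus[OF FCE_hmodule])
  have "prod_list (map (\<lambda>i. antipode_gen n (Egen i)) js) * lw True hs \<in> FCE n" if "set js \<subseteq> {1..n}" for js
    using that
  proof (induction js)
    case Nil
    then show ?case
      using FCE_gen[OF assms(2), of 1 "[]"] subalgebra_1[OF Cart_subalgebra] by (simp add: lw_simps)
  next
    case (Cons j js)
    then show ?case using st[of j] by (simp add: mult.assoc del: antipode_gen.simps)
  qed
  from this[of "rev gs"] assms(1)
  have "prod_list (rev (map (\<lambda>i. antipode_gen n (Egen i)) gs)) * lw True hs \<in> decomposable n"
    using FCE_decomposable by (auto simp: rev_map)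
  then show ?thesis
    unfolding antipode_lw smul_mult_left smul_mult_right by (intro hmodule_smul[OF decomposable_hmodule])
qed

theorem pairing_eq_coord:
  assumes "lam \<notin> \<nat>" "set gs \<subseteq> {1..n}" "set hs \<subseteq> {1..n}"
  shows "pairing n lam (c \<star> lw False gs) (d \<star> lw True hs)
    = coord 0 (act True n lam (antipode n (c \<star> lw False gs) * (d \<star> lw True hs)) (bas 0))"
  unfolding pairing_def by (rule character_proj_l[OF assms(1) antipode_decomposable[OF assms(2,3)]])

section \<open>The tensor product\<close>

lemma tensor0_nth:
  "tensor0 p r = (\<Sum>v\<in>keys p. single 0 (lookup p v) *
     (\<Sum>w\<in>keys r. single 0 (lookup r w) * single (v, w) 1))"
  by (simp add: tensor0_def sum_distrib_left mult_single)

text \<open>In this form bilinearity and compatibility with products reduce to basis words.\<close>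

lemma tensor_ext: "X \<otimes>\<^sub>h Y = ext (\<lambda>v. ext (\<lambda>w. bas (v, w)) Y) X"
proof (rule fps_ext)
  fix k
  have "fps_nth (ext (\<lambda>w. bas (v, w)) Y) m
      = (\<Sum>w\<in>keys (fps_nth Y m). single 0 (lookup (fps_nth Y m) w) * single (v, w) 1)"
    for v :: word and m
  proof -
    have "fps_nth (ext (\<lambda>w. bas (v, w)) Y) m = (\<Sum>i\<le>m. if i = m then
        (\<Sum>w\<in>keys (fps_nth Y m). single 0 (lookup (fps_nth Y m) w) * single (v, w) 1) else 0)"
      unfolding ext_def fps_nth_Abs_fps by (rule sum.cong) (auto simp: bas_def)
    then show ?thesis by simp
  qed
  then show "fps_nth (X \<otimes>\<^sub>h Y) k = fps_nth (ext (\<lambda>v. ext (\<lambda>w. bas (v, w)) Y) X) k"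
    by (simp add: tensor_def tensor0_nth ext_def)
qed

lemma hlin_tensor_left: "hlin (\<lambda>X. X \<otimes>\<^sub>h Y)"
  by (simp add: tensor_ext hlin_ext)

lemma tensor_bas: "bas v \<otimes>\<^sub>h bas w = bas (v, w)"
  by (simp add: tensor_ext)

lemma hlin_tensor_right: "hlin (\<lambda>Y. X \<otimes>\<^sub>h Y)"
proof (rule hlinI)
  show "X \<otimes>\<^sub>h (Y + Z) = X \<otimes>\<^sub>h Y + X \<otimes>\<^sub>h Z" for Y Z
    by (rule hlin_eqI[OF hlin_tensor_left hlin_add_fun[OF hlin_tensor_left hlin_tensor_left]])
      (simp add: tensor_ext hlin_add[OF hlin_ext])
  show "X \<otimes>\<^sub>h (c \<star> Y) = c \<star> (X \<otimes>\<^sub>h Y)" for c Y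
    by (rule hlin_eqI[OF hlin_tensor_left hlin_smul_fun[OF hlin_tensor_left]])
      (simp add: tensor_ext hlin_smul[OF hlin_ext])
qed

lemma tensor_mult: "(X \<otimes>\<^sub>h Y) * (Z \<otimes>\<^sub>h W) = (X * Z) \<otimes>\<^sub>h (Y * W)"
proof (rule hlin_eqI[where x = X])
  show "hlin (\<lambda>X. (X \<otimes>\<^sub>h Y) * (Z \<otimes>\<^sub>h W))" by (rule hlin_comp[OF hlin_rmult hlin_tensor_left])
  show "hlin (\<lambda>X. (X * Z) \<otimes>\<^sub>h (Y * W))" by (rule hlin_comp[OF hlin_tensor_left hlin_rmult])
  fix x
  show "(bas x \<otimes>\<^sub>h Y) * (Z \<otimes>\<^sub>h W) = (bas x * Z) \<otimes>\<^sub>h (Y * W)"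
  proof (rule hlin_eqI[where x = Y])
    show "hlin (\<lambda>Y. (bas x \<otimes>\<^sub>h Y) * (Z \<otimes>\<^sub>h W))" by (rule hlin_comp[OF hlin_rmult hlin_tensor_right])
    show "hlin (\<lambda>Y. (bas x * Z) \<otimes>\<^sub>h (Y * W))" by (rule hlin_comp[OF hlin_tensor_right hlin_rmult])
    fix y
    show "(bas x \<otimes>\<^sub>h bas y) * (Z \<otimes>\<^sub>h W) = (bas x * Z) \<otimes>\<^sub>h (bas y * W)"
    proof (rule hlin_eqI[where x = Z])
      show "hlin (\<lambda>Z. (bas x \<otimes>\<^sub>h bas y) * (Z \<otimes>\<^sub>h W))" by (rule hlin_comp[OF hlin_lmult hlin_tensor_left])
      show "hlin (\<lambda>Z. (bas x * Z) \<otimes>\<^sub>h (bas y * W))" by (rule hlin_comp[OF hlin_tensor_left hlin_lmult])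
      fix z
      show "(bas x \<otimes>\<^sub>h bas y) * (bas z \<otimes>\<^sub>h W) = (bas x * bas z) \<otimes>\<^sub>h (bas y * W)"
      proof (rule hlin_eqI[where x = W])
        show "hlin (\<lambda>W. (bas x \<otimes>\<^sub>h bas y) * (bas z \<otimes>\<^sub>h W))" by (rule hlin_comp[OF hlin_lmult hlin_tensor_right])
        show "hlin (\<lambda>W. (bas x * bas z) \<otimes>\<^sub>h (bas y * W))" by (rule hlin_comp[OF hlin_tensor_right hlin_lmult])
      qed (simp add: tensor_bas bas_mult)
    qed
  qed
qed

lemma tensor_1: "1 \<otimes>\<^sub>h 1 = 1"
proof -
  have "1 \<otimes>\<^sub>h 1 = bas (0, 0)" by (simp add: tensor_bas flip: bas_0)
  then show ?thesis by (simp add: bas_0 flip: zero_prod_def)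
qed

lemmas tensor_smul_left = hlin_smul[OF hlin_tensor_left] and tensor_smul_right = hlin_smul[OF hlin_tensor_right]
  and tensor_diff_left = hlin_diff[OF hlin_tensor_left] and tensor_diff_right = hlin_diff[OF hlin_tensor_right]

subsection \<open>Membership of the series in the completed parabolic tensor product\<close>

lemma U_p_plus_1: "1 \<in> U_p_plus n"
proof -
  have "1 * 1 \<in> U_p_plus n" unfolding U_p_plus_def
    by (rule closed_span_inc) (use subalgebra_1[OF U_l_subalgebra] subalgebra_1[OF U_n_plus_subalgebra] in blast)
  then show ?thesis by simp
qed

lemma U_p_minus_1: "1 \<in> U_p_minus n"
proof -
  have "1 * 1 \<in> U_p_minus n" unfolding U_p_minus_def
    by (rule closed_span_inc) (use subalgebra_1[OF U_l_subalgebra] subalgebra_1[OF U_n_minus_subalgebra] in blast)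
  then show ?thesis by simp
qed

lemma U_p_plus_mult:
  assumes "u \<in> U_p_plus n" "v \<in> U_n_plus n"
  shows "u * v \<in> U_p_plus n"
  using assms(1) unfolding U_p_plus_def
proof (rule closed_span_hlin[OF _ hlin_rmult closed_span_hmodule closed_span_closed])
  fix x assume "x \<in> {b * c |b c. b \<in> U_l n \<and> c \<in> U_n_plus n}"
  then obtain b c where x: "x = b * c" "b \<in> U_l n" "c \<in> U_n_plus n" by blast
  then have "b * (c * v) \<in> closed_span {b * c |b c. b \<in> U_l n \<and> c \<in> U_n_plus n}"
    using subalgebra_mult[OF U_n_plus_subalgebra x(3) assms(2)] by (intro closed_span_inc) blast
  then show "x * v \<in> closed_span {b * c |b c. b \<in> U_l n \<and> c \<in> U_n_plus n}"
    by (simp add: x(1) mult.assoc)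
qed

lemma U_p_minus_gen: "b \<in> U_l n \<Longrightarrow> a \<in> U_n_minus n \<Longrightarrow> b * a \<in> U_p_minus n"
  unfolding U_p_minus_def by (rule closed_span_inc) blast

lemma U_p_minus_hmodule: "hmodule (U_p_minus n)" and U_p_minus_closed: "closed (U_p_minus n)"
  unfolding U_p_minus_def by (rule closed_span_hmodule closed_span_closed)+

lemma U_p_minus_rmult:
  assumes "\<And>b a. b \<in> U_l n \<Longrightarrow> a \<in> U_n_minus n \<Longrightarrow> b * a * v \<in> U_p_minus n" "u \<in> U_p_minus n"
  shows "u * v \<in> U_p_minus n"
  using assms(2) unfolding U_p_minus_def[of n]
proof (elim closed_span_hlin[OF _ hlin_rmult closed_span_hmodule closed_span_closed], fold U_p_minus_def)
  fix x assume "x \<in> {b * a |b a. b \<in> U_l n \<and> a \<in> U_n_minus n}"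
  then show "x * v \<in> U_p_minus n" using assms(1) by blast
qed

lemma U_p_minus_mult: "u \<in> U_p_minus n \<Longrightarrow> v \<in> U_n_minus n \<Longrightarrow> u * v \<in> U_p_minus n"
  by (rule U_p_minus_rmult)
    (simp_all add: mult.assoc U_p_minus_gen subalgebra_mult[OF U_n_minus_subalgebra])

lemma h_eigen_mult:
  assumes "gen (Hgen a) * x - (x * gen (Hgen a) + fps_const c \<star> x) \<in> rel_ideal n"
    "gen (Hgen a) * y - (y * gen (Hgen a) + fps_const d \<star> y) \<in> rel_ideal n"
  shows "gen (Hgen a) * (x * y) - (x * y * gen (Hgen a) + fps_const (c + d) \<star> (x * y)) \<in> rel_ideal n"
proof -
  have "(gen (Hgen a) * x - (x * gen (Hgen a) + fps_const c \<star> x)) * y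
      + x * (gen (Hgen a) * y - (y * gen (Hgen a) + fps_const d \<star> y)) \<in> rel_ideal n"
    by (intro rel.I_add rel.I_l rel.I_r assms)
  then show ?thesis
    by (simp add: algebra_simps hs.scale_left_distrib del: fps_const_add flip: fps_const_add)
qed

lemma h_eigen_qcomm:
  assumes "gen (Hgen a) * x - (x * gen (Hgen a) + fps_const c \<star> x) \<in> rel_ideal n"
    "gen (Hgen a) * y - (y * gen (Hgen a) + fps_const d \<star> y) \<in> rel_ideal n"
  shows "gen (Hgen a) * qcomm p x y - (qcomm p x y * gen (Hgen a) + fps_const (c + d) \<star> qcomm p x y) \<in> rel_ideal n"
proof -
  have "(gen (Hgen a) * (x * y) - (x * y * gen (Hgen a) + fps_const (c + d) \<star> (x * y)))
      - p \<star> (gen (Hgen a) * (y * x) - (y * x * gen (Hgen a) + fps_const (d + c) \<star> (y * x))) \<in> rel_ideal n"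
    by (intro rel.I_diff rel.I_smul h_eigen_mult assms)
  then show ?thesis
    by (simp add: qcomm_conv algebra_simps hs.scale_right_diff_distrib hs.scale_right_distrib add.commute[of d])
qed

lemma h_eigen_yroot:
  assumes "i \<in> {1..n}" "a \<in> {1..n + 1}"
  shows "\<exists>c. gen (Hgen a) * yroot i - (yroot i * gen (Hgen a) + fps_const c \<star> yroot i) \<in> rel_ideal n"
proof -
  have "\<exists>c. gen (Hgen a) * yv ff i - (yv ff i * gen (Hgen a) + fps_const c \<star> yv ff i) \<in> rel_ideal n"
    if "1 \<le> i" "i \<le> n" for i
    using that
  proof (induction i rule: dec_induct)
    case base
    then show ?case using h_eigen_gens(2)[of 1 n] assms(2) by (auto simp: h_eigen_def)
  next
    case (step i)
    then obtain c where c: "gen (Hgen a) * yv ff i - (yv ff i * gen (Hgen a) + fps_const c \<star> yv ff i) \<in> rel_ideal n" by auto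
    have "h_eigen n (ff (Suc i))" using step by (intro h_eigen_gens) auto
    then obtain d where "gen (Hgen a) * ff (Suc i) - (ff (Suc i) * gen (Hgen a) + fps_const d \<star> ff (Suc i)) \<in> rel_ideal n"
      using assms(2) unfolding h_eigen_def by blast
    from h_eigen_qcomm[OF this c, of "qpw (- 1)"] show ?case using step by auto
  qed
  then show ?thesis using assms by (simp add: yroot_conv)
qed

text \<open>In \<open>U_p_minus\<close> the factor from \<open>U_l\<close> stands on the left, but
  \<open>yroot'\<close> ends with a Cartan factor. It can be carried across because the adjoint
  action of H preserves \<open>U_n_minus\<close>.\<close>

lemma U_n_minus_ad_H:
  assumes a: "a \<in> {1..n + 1}" and u: "u \<in> U_n_minus n"
  shows "gen (Hgen a) * u - u * gen (Hgen a) \<in> U_n_minus n"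
proof -
  let ?N = "U_n_minus n"
  let ?S = "?N \<inter> {u. gen (Hgen a) * u - u * gen (Hgen a) \<in> ?N}"
  note h = subalgebra_hmodule[OF U_n_minus_subalgebra[of n]] and m = subalgebra_mult[OF U_n_minus_subalgebra[of n]]
  have cl: "closed ?N" by (simp add: U_n_minus_def gen_subalgebra_closed)
  have l: "hlin (\<lambda>u. gen (Hgen a) * u - u * gen (Hgen a))"
    by (intro hlin_diff_fun hlin_lmult hlin_rmult)
  have "hmodule (\<Inter>{?N, {u. gen (Hgen a) * u - u * gen (Hgen a) \<in> ?N}})"
    by (rule hmodule_Inter) (use hmodule_vimage[OF l h] h in auto)
  then have S: "hmodule ?S" by simp
  have "subalgebra ?S"
  proof (rule subalgebraI[OF S])
    show "1 \<in> ?S" using subalgebra_1[OF U_n_minus_subalgebra] hmodule_0[OF h] by simp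
    show "x * y \<in> ?S" if "x \<in> ?S" "y \<in> ?S" for x y
    proof -
      have "(gen (Hgen a) * x - x * gen (Hgen a)) * y + x * (gen (Hgen a) * y - y * gen (Hgen a)) \<in> ?N"
        using that by (intro hmodule_add[OF h] m) auto
      then show ?thesis using that by (simp add: m algebra_simps)
    qed
  qed
  moreover have "closed ?S" by (intro closed_Int cl closed_vimage_hlin[OF l cl])
  moreover have "yroot i \<in> ?S" if i: "i \<in> {1..n}" for i
  proof -
    obtain c where "gen (Hgen a) * yroot i - (yroot i * gen (Hgen a) + fps_const c \<star> yroot i) \<in> rel_ideal n"
      using h_eigen_yroot[OF i a] by blast
    then have "gen (Hgen a) * yroot i - (yroot i * gen (Hgen a) + fps_const c \<star> yroot i) + fps_const c \<star> yroot i \<in> ?N"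
      by (intro hmodule_add[OF h] hmodule_smul[OF h] U_n_gens i U_rel)
    then show ?thesis using U_n_gens(2)[OF i] by simp
  qed
  moreover have "rel_ideal n \<subseteq> ?S" using U_rel(3) by (auto intro!: rel.I_diff rel.I_l rel.I_r)
  ultimately have "?N \<subseteq> ?S"
    unfolding U_n_minus_def[of n] by (intro gen_subalgebra_subset) auto
  then show ?thesis using u by blast
qed

lemma U_p_minus_H:
  assumes a: "a \<in> {1..n + 1}" and u: "u \<in> U_p_minus n"
  shows "u * gen (Hgen a) \<in> U_p_minus n"
proof (rule U_p_minus_rmult[OF _ u])
  fix b x assume b: "b \<in> U_l n" and x: "x \<in> U_n_minus n"
  have "(b * gen (Hgen a)) * x - b * (gen (Hgen a) * x - x * gen (Hgen a)) \<in> U_p_minus n"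
    using b x a
    by (intro hmodule_diff[OF U_p_minus_hmodule] U_p_minus_gen U_n_minus_ad_H subalgebra_mult[OF U_l_subalgebra] U_l_gens)
  then show "b * x * gen (Hgen a) \<in> U_p_minus n" by (simp add: algebra_simps)
qed

lemma U_p_minus_qcartan:
  assumes u: "u \<in> U_p_minus n"
  shows "u * qcartan n \<mu> \<in> U_p_minus n"
proof -
  note h = U_p_minus_hmodule[of n]
  have c: "u * cartan n \<mu> \<in> U_p_minus n" if "u \<in> U_p_minus n" for u
    unfolding cartan_conv sum_distrib_left smul_mult_right
    by (intro hmodule_sum[OF h] hmodule_smul[OF h] U_p_minus_H that)
  have p: "u * cartan n \<mu> ^ k \<in> U_p_minus n" for k
    by (induction k) (simp_all add: u c power_Suc2 flip: mult.assoc del: power_Suc)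
  have "fps_const (fps_nth (qcartan n \<mu>) k) \<in> {v. u * v \<in> U_p_minus n}" for k
    unfolding qcartan_coeff by (simp add: p hmodule_smul[OF h])
  then have "qcartan n \<mu> \<in> {v. u * v \<in> U_p_minus n}"
    by (rule closed_hmodule_coeffI[OF hmodule_vimage[OF hlin_lmult h] closed_vimage_hlin[OF hlin_lmult U_p_minus_closed]])
  then show ?thesis by simp
qed

lemma U_p_minus_yroot':
  assumes "u \<in> U_p_minus n" "i \<in> {1..n}"
  shows "u * yroot' n lam i \<in> U_p_minus n"
  unfolding yroot'_def smul_def[symmetric] smul_mult_left smul_mult_right mult.assoc[symmetric]
  by (intro hmodule_smul[OF U_p_minus_hmodule] U_p_minus_qcartan U_p_minus_mult U_n_gens assms)

text \<open>Among the e's only e_1 has non-zero weight under \<open>Hgen 1\<close>, and it occurs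
  exactly once in the bracket.\<close>

lemma xroot_degree:
  assumes "i \<in> {1..n}"
  shows "gen (Hgen 1) * xroot i - (xroot i * gen (Hgen 1) + fps_const 1 \<star> xroot i) \<in> rel_ideal n"
proof -
  define N where "N a = foldr (\<lambda>j z. qcomm (qpw (- 1)) (ee j) z) [a..<i] (ee i)" for a
  have e: "gen (Hgen 1) * ee j - (ee j * gen (Hgen 1) + fps_const (if j = 1 then 1 else 0) \<star> ee j) \<in> rel_ideal n"
    if "1 \<le> j" "j \<le> n" for j
  proof -
    have "alpha j 1 = (if j = 1 then 1 else 0)" using that by (auto simp: alpha_def eps_def)
    then show ?thesis using rel_H_ee[of 1 n j] that by (auto simp: algebra_simps)
  qed
  have "gen (Hgen 1) * N a - (N a * gen (Hgen 1) + fps_const (if a = 1 then 1 else 0) \<star> N a) \<in> rel_ideal n"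
    if "a \<le> i" "1 \<le> a" for a
    using that
  proof (induction a rule: inc_induct)
    case base
    then show ?case using e[of i] assms by (simp add: N_def)
  next
    case (step a)
    then have IH: "gen (Hgen 1) * N (Suc a) - (N (Suc a) * gen (Hgen 1) + fps_const 0 \<star> N (Suc a)) \<in> rel_ideal n"
      by simp
    have "N a = qcomm (qpw (- 1)) (ee a) (N (Suc a))" using step by (simp add: N_def upt_conv_Cons)
    then show ?case using h_eigen_qcomm[OF e IH, of a "qpw (- 1)"] step assms by simp
  qed
  from rel.I_smul[OF this[of 1], of "qpw (2 * (of_nat i - 1))"] assms
  show ?thesis
    unfolding xroot_def smul_def[symmetric] N_def by (simp add: hs.scale_right_diff_distrib hs.scale_right_distrib)
qed

text \<open>The filtration asks for high degree in one of the two factors; here the degree is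
  tracked in the second.\<close>

definition UU :: "nat \<Rightarrow> nat \<Rightarrow> alg2 set" where
  "UU n m = hmodule hull {x \<otimes>\<^sub>h y |x y. x \<in> U_p_minus n \<and> y \<in> deg_U_p_plus n m}"

lemma deg_U_p_plus_iff:
  "y \<in> deg_U_p_plus n m \<longleftrightarrow> y \<in> U_p_plus n \<and>
     gen (Hgen 1) * y - (y * gen (Hgen 1) + fps_const (of_nat m) \<star> y) \<in> rel_ideal n"
  by (simp add: deg_U_p_plus_def smul_def fps_of_nat diff_diff_eq)

lemma yx_power_UU: "yx n lam ^ m \<in> UU n m"
proof (induction m)
  case 0
  have "1 \<in> deg_U_p_plus n 0"
    unfolding deg_U_p_plus_iff using U_p_plus_1 rel.I_0 by simp
  then have "1 \<otimes>\<^sub>h 1 \<in> UU n 0"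
    unfolding UU_def using U_p_minus_1 by (intro hull_inc) blast
  then show ?case by (simp add: tensor_1)
next
  case (Suc m)
  have "t * (yroot' n lam i \<otimes>\<^sub>h xroot i) \<in> UU n (Suc m)" if i: "i \<in> {1..n}" and t: "t \<in> UU n m" for i t
    using t unfolding UU_def[of n m]
  proof (rule hull_hmodule_hlin[OF _ hlin_rmult])
    show "hmodule (UU n (Suc m))" by (simp add: UU_def hmodule_hull)
    fix t assume "t \<in> {x \<otimes>\<^sub>h y |x y. x \<in> U_p_minus n \<and> y \<in> deg_U_p_plus n m}"
    then obtain x y where t: "t = x \<otimes>\<^sub>h y" "x \<in> U_p_minus n" "y \<in> deg_U_p_plus n m" by blast
    have "y * xroot i \<in> U_p_plus n"
      using t(3) i by (intro U_p_plus_mult U_n_gens) (auto simp: deg_U_p_plus_iff)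
    moreover have "gen (Hgen 1) * (y * xroot i) - (y * xroot i * gen (Hgen 1) + fps_const (of_nat m + 1) \<star> (y * xroot i)) \<in> rel_ideal n"
      using t(3) i by (intro h_eigen_mult xroot_degree) (auto simp: deg_U_p_plus_iff)
    ultimately have "y * xroot i \<in> deg_U_p_plus n (Suc m)"
      by (simp add: deg_U_p_plus_iff add.commute)
    then show "t * (yroot' n lam i \<otimes>\<^sub>h xroot i) \<in> UU n (Suc m)"
      unfolding t(1) tensor_mult UU_def by (intro hull_inc) (use U_p_minus_yroot'[OF t(2) i] in blast)
  qed
  then show ?case
    using Suc unfolding power_Suc2 yx_def sum_distrib_left
    by (intro hmodule_sum) (auto simp: UU_def hmodule_hull)
qed

lemma UU_U_p_tensor: "UU n m \<subseteq> U_p_tensor n"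
  unfolding UU_def U_p_tensor_def
  by (rule hull_minimal) (auto simp: closed_span_hmodule deg_U_p_plus_def intro!: closed_span_inc)

lemma UU_U_p_filt: "d \<le> m \<Longrightarrow> UU n m \<subseteq> U_p_filt n d"
  unfolding UU_def U_p_filt_def
proof (rule hull_mono)
  assume "d \<le> m"
  show "{x \<otimes>\<^sub>h y |x y. x \<in> U_p_minus n \<and> y \<in> deg_U_p_plus n m} \<subseteq>
    {x \<otimes>\<^sub>h y |x y. x \<in> rel_ideal n \<or> y \<in> rel_ideal n} \<union>
    {x \<otimes>\<^sub>h y |x y. x \<in> U_p_minus n \<and> y \<in> U_p_plus n \<and>
      (\<exists>j\<ge>d. x \<in> deg_U_p_minus n j \<or> y \<in> deg_U_p_plus n j)} \<union>
    {fps_X ^ d * t |t. t \<in> U_p_tensor n}"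
  proof
    fix t assume "t \<in> {x \<otimes>\<^sub>h y |x y. x \<in> U_p_minus n \<and> y \<in> deg_U_p_plus n m}"
    then obtain x y where "t = x \<otimes>\<^sub>h y" "x \<in> U_p_minus n" "y \<in> deg_U_p_plus n m" by blast
    moreover have "y \<in> U_p_plus n" using \<open>y \<in> deg_U_p_plus n m\<close> by (simp add: deg_U_p_plus_def)
    ultimately show "t \<in> {x \<otimes>\<^sub>h y |x y. x \<in> rel_ideal n \<or> y \<in> rel_ideal n} \<union>
    {x \<otimes>\<^sub>h y |x y. x \<in> U_p_minus n \<and> y \<in> U_p_plus n \<and>
      (\<exists>j\<ge>d. x \<in> deg_U_p_minus n j \<or> y \<in> deg_U_p_plus n j)} \<union>
    {fps_X ^ d * t |t. t \<in> U_p_tensor n}" using \<open>d \<le> m\<close> by blast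
  qed
qed

lemma U_p_filt_hmodule: "hmodule (U_p_filt n d)"
  unfolding U_p_filt_def by (rule hmodule_hull)

lemma cauchy_partial_sums:
  assumes N: "\<And>d. hmodule (N d)" and f: "\<And>d m. d \<le> m \<Longrightarrow> f m \<in> N d"
  shows "cauchy_seq N (\<lambda>k. \<Sum>m<k. f m)"
  unfolding cauchy_seq_def
proof (intro allI exI impI)
  fix d k l :: nat
  have *: "(\<Sum>m<l. f m) - (\<Sum>m<k. f m) \<in> N d" if "d \<le> k" "k \<le> l" for k l
  proof -
    have "(\<Sum>m<l. f m) - (\<Sum>m<k. f m) = (\<Sum>m=k..<l. f m)"
      using that sum_diff_nat_ivl[of 0 k l f] by (simp add: atLeast0LessThan)
    also have "\<dots> \<in> N d" using that by (intro hmodule_sum[OF N] f) auto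
    finally show ?thesis .
  qed
  assume kl: "d \<le> k" "d \<le> l"
  show "(\<Sum>m<k. f m) - (\<Sum>m<l. f m) \<in> N d"
  proof (cases "k \<le> l")
    case True
    then show ?thesis using hmodule_uminus[OF N *[of k l]] kl by simp
  qed (use *[of l k] kl in auto)
qed

section \<open>Matrix coefficients of the root vectors\<close>

lemma form_beta:
  assumes "j \<in> {1..n}"
  shows "form n \<mu> (beta j) = \<mu> 1 - \<mu> (j + 1)"
proof -
  have "form n \<mu> (beta j) = (\<Sum>a = 1..n + 1. eps 1 a * \<mu> a) - (\<Sum>a = 1..n + 1. eps (j + 1) a * \<mu> a)"
    by (simp add: form_def beta_eq right_diff_distrib sum_subtractf mult.commute del: sum.cl_ivl_Suc)
  also have "\<dots> = \<mu> 1 - \<mu> (j + 1)"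
    using assms by (subst (1 2) sum_eps) auto
  finally show ?thesis .
qed

lemma eta_diff: "j \<in> {1..n} \<Longrightarrow> eta n i 1 - eta n i (j + 1) = (if i < j then 2 else 0)"
proof -
  assume j: "j \<in> {1..n}"
  have "\<forall>j\<in>{1..n}. form n (eta n i) (beta j) = (if i < j then 2 else 0)"
    using theI'[OF eta_ex1[of n i]] unfolding eta_def[symmetric] by blast
  then show ?thesis using form_beta[OF j, of "eta n i"] j by simp
qed

definition tail :: "nat \<Rightarrow> nat \<Rightarrow> lat \<Rightarrow> int" where
  "tail n i \<kappa> = (\<Sum>j=i+1..n. lookup \<kappa> j)"

lemma tail_step: "1 \<le> i \<Longrightarrow> i \<le> n \<Longrightarrow> tail n (i - 1) \<kappa> = tail n i \<kappa> + lookup \<kappa> i"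
  unfolding tail_def by (simp add: sum.atLeast_Suc_atMost)

text \<open>On the support the exponent of z_0 is minus the sum of the others, so apart from
  \<lambda> only the differences \<open>eta n i 1 - eta n i (j + 1)\<close> enter. By the choice of
  \<open>eta\<close> they are 2 for j > i and 0 otherwise.\<close>

lemma cartan_weight_eta:
  assumes "\<kappa> \<in> supp n" "i \<in> {1..n}"
  shows "cartan_weight True n lam \<kappa> (\<lambda>b. - eta n i b) = 2 * of_int (tail n i \<kappa>) - lam * eta n i 1"
proof -
  let ?e = "eta n i" and ?k = "\<lambda>j. of_int (lookup \<kappa> j) :: complex"
  have k0: "?k 0 = - (\<Sum>j=1..n. ?k j)"
    using supp_sum[OF assms(1)] by (metis of_int_minus of_int_sum minus_minus)
  have "(\<Sum>a = 1..n + 1. ?e a * cc lam \<kappa> (a - 1)) = (\<Sum>j = 0..n. ?e (j + 1) * cc lam \<kappa> j)"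
    by (rule sum.reindex_bij_witness[of _ "\<lambda>j. j + 1" "\<lambda>a. a - 1"]) auto
  also have "\<dots> = ?e 1 * cc lam \<kappa> 0 + (\<Sum>j = 1..n. ?e (j + 1) * ?k j)"
  proof -
    have "(\<Sum>j = 1..n. ?e (j + 1) * cc lam \<kappa> j) = (\<Sum>j = 1..n. ?e (j + 1) * ?k j)"
      by (rule sum.cong) (auto simp: cc_nonzero)
    then show ?thesis by (simp add: sum.atLeast_Suc_atMost)
  qed
  also have "\<dots> = lam * ?e 1 - (\<Sum>j = 1..n. (?e 1 - ?e (j + 1)) * ?k j)"
    by (simp add: cc_def k0 algebra_simps sum_subtractf sum_distrib_left)
  also have "(\<Sum>j = 1..n. (?e 1 - ?e (j + 1)) * ?k j) = (\<Sum>j = 1..n. if i < j then 2 * ?k j else 0)"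
    by (rule sum.cong) (simp_all only: eta_diff, auto)
  also have "\<dots> = (\<Sum>j \<in> {1..n} \<inter> {j. i < j}. 2 * ?k j)"
    by (simp add: sum.inter_restrict)
  also have "{1..n} \<inter> {j. i < j} = {i+1..n}" using assms by auto
  also have "(\<Sum>j \<in> {i+1..n}. 2 * ?k j) = 2 * of_int (tail n i \<kappa>)"
    by (simp add: tail_def sum_distrib_left)
  finally show ?thesis
    by (simp add: cartan_weight_def sg_def sum_negf del: sum.cl_ivl_Suc)
qed

definition head :: "nat \<Rightarrow> lat \<Rightarrow> int" where
  "head i \<kappa> = (\<Sum>j=1..<i. lookup \<kappa> j)"

text \<open>The scalar in front of \<open>yroot'\<close> cancels the part of the Cartan weight that
  depends on \<lambda>. The effect of the modification is the factor q^(2 tail) alone, which later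
  makes the coefficients multinomial.\<close>

lemma act_yroot':
  assumes "\<kappa> \<in> supp n" "i \<in> {1..n}"
  shows "act True n lam (yroot' n lam i) (bas \<kappa>)
    = (qnum (cc lam \<kappa> 0) * qpw (of_int (head i \<kappa>)) * qpw (2 * of_int (tail n i \<kappa>))) \<star> bas (\<kappa> + bet i)"
proof -
  have y: "yroot i = yv (\<lambda>i. gen (lo True i)) i" using assms by (simp add: yroot_conv lo_def)
  have f: "form n (eta n i) (\<lambda>b. lam * eps 1 b) = lam * eta n i 1"
  proof -
    have "form n (eta n i) (\<lambda>b. lam * eps 1 b) = lam * (\<Sum>a = 1..n + 1. eps 1 a * eta n i a)"
      unfolding form_def sum_distrib_left by (rule sum.cong) (simp_all add: mult_ac)
    also have "\<dots> = lam * eta n i 1" by (subst sum_eps) auto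
    finally show ?thesis .
  qed
  have 1: "act True n lam (yroot i) (bas \<kappa>)
      = (qnum (cc lam \<kappa> 0) * qpw (of_int (head i \<kappa>))) \<star> bas (\<kappa> + bet i)"
    unfolding y head_def using assms by (intro act_yv) auto
  have 2: "act True n lam (qcartan n (\<lambda>b. - eta n i b)) (bas \<kappa>) =
      qpw (2 * of_int (tail n i \<kappa>) - lam * eta n i 1) \<star> bas \<kappa>"
    unfolding act_cartan_bas cartan_weight_eta[OF assms] ..
  have "qpw (lam * eta n i 1) * qpw (2 * of_int (tail n i \<kappa>) - lam * eta n i 1) = qpw (2 * of_int (tail n i \<kappa>))"
    unfolding qpw_mult by simp
  then have 3: "qpw (lam * eta n i 1) * (qpw (2 * of_int (tail n i \<kappa>) - lam * eta n i 1) * (c * d)) = c * d * qpw (2 * of_int (tail n i \<kappa>))" for c d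
    by (metis mult.assoc mult.commute)
  show ?thesis
    unfolding yroot'_def smul_def[symmetric] f smul_mult_left act_smul_left act_mult 2 act_smul 1 hs.scale_scale 3 ..
qed

lemma qnum_sub: "qnum x - qpw (- 1) * qnum (x + 1) = - qpw (- x - 1)"
proof -
  have "qpw (- 1) * qnum (x + 1) = qpw (- 1) * qpw 1 * qnum x + qpw (- 1) * qpw (- x)"
    unfolding qnum_add_1 by (simp add: algebra_simps)
  then show ?thesis by (simp add: qpw_mult algebra_simps)
qed

text \<open>Each bracket contributes -q^(-k-1), k being the exponent of the variable passed. The i -
  1 brackets give the sign, q^-head and q^(1-i), and the normalization q^(2(i-1)) turns the last
  into q^(i-1).\<close>

lemma act_xroot:
  assumes "i \<in> {1..n}"
  shows "act False n lam (xroot i) (bas \<kappa>)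
    = ((- 1) ^ (i - 1) * qpw (of_nat (i - 1)) * qpw (- of_int (head i \<kappa>)) * qnum (cc lam \<kappa> 0)) \<star> bas (\<kappa> + bet i)"
proof -
  define N where "N a = foldr (\<lambda>j z. qcomm (qpw (- 1)) (ee j) z) [a..<i] (ee i)" for a
  define hd where "hd a \<kappa> = (\<Sum>j=a..<i. lookup \<kappa> j + 1)" for a and \<kappa> :: lat
  have F: "act False n lam (ee j) t = opF lam j t" if "1 \<le> j" "j \<le> n" for j t
    using that by (simp add: act_EF)
  have "act False n lam (N a) (bas \<kappa>)
      = ((- 1) ^ (i - a) * qpw (- of_int (hd a \<kappa>)) * qnum (cc lam \<kappa> (a - 1)))
        \<star> bas (\<kappa> + (single i 1 - single (a - 1) 1))" if "a \<le> i" "1 \<le> a" for a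
    using that
  proof (induction a arbitrary: \<kappa> rule: inc_induct)
    case base
    then show ?case using assms by (simp add: N_def hd_def F opF_bas del_def del: single_one)
  next
    case (step a)
    then have a: "1 \<le> a" "a < i" "a \<le> n" using assms by auto
    let ?s = "single i 1 - single a (1 :: int)"
    let ?C = "(- 1) ^ (i - Suc a) * qpw (- of_int (hd (Suc a) \<kappa>))"
    have N: "N a = qcomm (qpw (- 1)) (ee a) (N (Suc a))" using a by (simp add: N_def upt_conv_Cons)
    have h: "hd (Suc a) (\<kappa> + del a) = hd (Suc a) \<kappa>"
      unfolding hd_def by (rule sum.cong) (use a in \<open>auto simp: lookup_add lookup_del\<close>)
    have e: "act False n lam (N (Suc a)) (bas \<kappa>) = (?C * qnum (cc lam \<kappa> a)) \<star> bas (\<kappa> + ?s)"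
      "act False n lam (N (Suc a)) (bas (\<kappa> + del a)) = (?C * qnum (cc lam \<kappa> a + 1)) \<star> bas (\<kappa> + del a + ?s)"
      using step.IH[of \<kappa>] step.IH[of "\<kappa> + del a"] a unfolding h by (auto simp: cc_del)
    have c: "cc lam (\<kappa> + ?s) (a - 1) = cc lam \<kappa> (a - 1)"
      using a by (auto simp: cc_def lookup_add lookup_minus lookup_single when_def simp del: single_one)
    have b: "\<kappa> + ?s + del a = \<kappa> + (single i 1 - single (a - 1) 1)"
      "\<kappa> + del a + ?s = \<kappa> + (single i 1 - single (a - 1) 1)"
      by (simp_all add: del_def algebra_simps del: single_one)
    have ka: "cc lam \<kappa> a = of_int (lookup \<kappa> a)" using a by (simp add: cc_def)
    have "act False n lam (N a) (bas \<kappa>)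
        = (?C * qnum (cc lam \<kappa> a) * qnum (cc lam \<kappa> (a - 1))) \<star> bas (\<kappa> + ?s + del a)
          - (qpw (- 1) * (qnum (cc lam \<kappa> (a - 1)) * (?C * qnum (cc lam \<kappa> a + 1)))) \<star> bas (\<kappa> + del a + ?s)"
      unfolding N qcomm_conv act_diff_left act_smul_left act_mult F[OF a(1,3)] e opF_bas op_smul act_smul c
      by simp
    also have "\<dots> = (?C * qnum (cc lam \<kappa> (a - 1)) * (qnum (cc lam \<kappa> a) - qpw (- 1) * qnum (cc lam \<kappa> a + 1)))
        \<star> bas (\<kappa> + (single i 1 - single (a - 1) 1))"
      unfolding b by (simp add: algebra_simps hs.scale_left_diff_distrib)
    also have "?C * qnum (cc lam \<kappa> (a - 1)) * (qnum (cc lam \<kappa> a) - qpw (- 1) * qnum (cc lam \<kappa> a + 1))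
        = (- 1) ^ (i - a) * qpw (- of_int (hd a \<kappa>)) * qnum (cc lam \<kappa> (a - 1))"
    proof -
      have p: "(- 1 :: complex fps) ^ (i - a) = - ((- 1) ^ (i - Suc a))"
        using a by (metis Suc_diff_Suc mult_minus1 power_Suc)
      have "hd a \<kappa> = lookup \<kappa> a + 1 + hd (Suc a) \<kappa>"
        unfolding hd_def using a by (simp add: sum.atLeast_Suc_lessThan)
      then have "qpw (- of_int (hd a \<kappa>)) = qpw (- of_int (hd (Suc a) \<kappa>)) * qpw (- cc lam \<kappa> a - 1)"
        by (simp add: qpw_mult ka algebra_simps)
      then show ?thesis unfolding qnum_sub p by (simp add: mult_ac)
    qed
    finally show ?case .
  qed
  from this[of 1] have n1: "act False n lam (N 1) (bas \<kappa>)
      = ((- 1) ^ (i - 1) * qpw (- of_int (hd 1 \<kappa>)) * qnum (cc lam \<kappa> 0)) \<star> bas (\<kappa> + bet i)"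
    using assms by (simp add: bet_def del: single_one)
  have i: "of_nat (i - 1) = (of_nat i - 1 :: complex)" using assms by (simp add: of_nat_diff)
  have "hd 1 \<kappa> = head i \<kappa> + int (i - 1)"
    using assms by (simp add: hd_def head_def sum.distrib)
  then have "qpw (2 * (of_nat i - 1)) * qpw (- of_int (hd 1 \<kappa>)) = qpw (of_nat (i - 1)) * qpw (- of_int (head i \<kappa>))"
    by (simp add: qpw_mult i[unfolded One_nat_def] algebra_simps)
  then have "qpw (2 * (of_nat i - 1)) * ((- 1) ^ (i - 1) * qpw (- of_int (hd 1 \<kappa>)) * qnum (cc lam \<kappa> 0))
      = (- 1) ^ (i - 1) * qpw (of_nat (i - 1)) * qpw (- of_int (head i \<kappa>)) * qnum (cc lam \<kappa> 0)"
    by (simp add: mult_ac)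
  then show ?thesis
    unfolding xroot_def smul_def[symmetric] act_smul_left N_def[symmetric] n1 hs.scale_scale by (simp only:)
qed

section \<open>Coefficients of the canonical element\<close>

text \<open>The part of the coefficient in \<open>act_xroot\<close> that depends on i alone.\<close>

definition sgn_q :: "nat \<Rightarrow> complex fps" where
  "sgn_q i = (- 1) ^ (i - 1) * qpw (of_nat (i - 1))"

definition wt :: "nat \<Rightarrow> nat \<Rightarrow> complex fps" where
  "wt j k = sgn_q j ^ k * qpw (- (of_nat k * (of_nat k - 1) / 2)) * inverse (qfact k)"

definition Wt :: "nat \<Rightarrow> lat \<Rightarrow> complex fps" where
  "Wt n \<kappa> = (\<Prod>j=1..n. wt j (nat (lookup \<kappa> j)))"

definition Pq :: "complex \<Rightarrow> nat \<Rightarrow> complex fps" where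
  "Pq lam m = (\<Prod>j<m. qnum (lam - of_nat j))"

text \<open>As q^(k-1) [k] = 1 + q^2 + ... + q^(2k-2), this is the factorial in the parameter q^2.
  Apart from \<open>sgn_q\<close>, \<open>wt j k\<close> is its inverse.\<close>

definition Qf :: "nat \<Rightarrow> complex fps" where
  "Qf m = qpw (of_nat m * (of_nat m - 1) / 2) * qfact m"

text \<open>
  \<open>Cf\<close> is the coefficient with which the tensor product of the two monomials of exponent \<open>\<kappa>\<close>
  occurs in the power of \<open>yx\<close> of exponent \<open>lev \<kappa>\<close>. Up to units it is a multinomial coefficient
  in the squared parameter, and \<open>Cf_rec\<close> is the corresponding Pascal rule.
\<close>

definition Cf :: "complex \<Rightarrow> nat \<Rightarrow> lat \<Rightarrow> complex fps" where
  "Cf lam n \<kappa> = (Pq lam (lev \<kappa>))\<^sup>2 * Qf (lev \<kappa>) * Wt n \<kappa>"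

text \<open>The coefficient in the whole series. By \<open>pairing_zv\<close> it is the inverse of
  the diagonal entry of the Gram matrix.\<close>

definition Gc :: "complex \<Rightarrow> nat \<Rightarrow> lat \<Rightarrow> complex fps" where
  "Gc lam n \<kappa> = lift_coeff lam (lev \<kappa>) * Cf lam n \<kappa>"

section \<open>Units and recursions among the coefficients\<close>

lemma qfact_Suc: "qfact (Suc k) = qfact k * qnum (of_nat (Suc k))"
  by (simp add: qfact_def)

lemma qfact_nth_0: "fps_nth (qfact k) 0 \<noteq> 0"
proof (induction k)
  case 0
  then show ?case by (simp add: qfact_def)
next
  case (Suc k)
  have "(1 :: complex) + of_nat k \<noteq> 0" by (metis of_nat_Suc of_nat_eq_0_iff nat.distinct(1))
  then show ?case using Suc by (simp add: qfact_Suc qnum_nth_0)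
qed

lemma Pq_nth_0: "lam \<notin> \<nat> \<Longrightarrow> fps_nth (Pq lam m) 0 \<noteq> 0"
proof (induction m)
  case (Suc m)
  then have "lam \<noteq> of_nat m" by auto
  then show ?case using Suc by (simp add: Pq_def qnum_nth_0)
qed (simp add: Pq_def)

lemma sgn_q_nth_0: "fps_nth (sgn_q i) 0 \<noteq> 0"
  by (simp add: sgn_q_def fps_power_zeroth)

lemma wt_nth_0: "fps_nth (wt j k) 0 \<noteq> 0"
  using qfact_nth_0[of k] sgn_q_nth_0[of j] by (simp add: wt_def fps_power_zeroth)

lemma Wt_nth_0: "fps_nth (Wt n \<kappa>) 0 \<noteq> 0"
proof -
  have "fps_nth (\<Prod>j\<in>A. wt j (nat (lookup \<kappa> j))) 0 \<noteq> 0" for A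
    by (induction A rule: infinite_finite_induct) (simp_all add: wt_nth_0)
  then show ?thesis by (simp add: Wt_def)
qed

lemma wt_Suc:
  "wt j (Suc k) * (qpw (of_nat k) * qnum (of_nat (Suc k))) = sgn_q j * wt j k"
proof -
  have "fps_nth (qnum (of_nat (Suc k))) 0 \<noteq> 0"
    unfolding qnum_nth_0 by (metis of_nat_eq_0_iff nat.distinct(1))
  then have u: "inverse (qnum (of_nat (Suc k))) * qnum (of_nat (Suc k)) = 1"
    by (rule fps_inverse_unit)
  have f: "inverse (qfact (Suc k)) = inverse (qfact k) * inverse (qnum (of_nat (Suc k)))"
    unfolding qfact_Suc by (rule fps_inverse_mult)
  have "- (of_nat (Suc k) * (of_nat (Suc k) - 1) / 2) + of_nat k = - (of_nat k * (of_nat k - 1) / 2 :: complex)"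
    by (simp add: field_simps)
  then have p: "qpw (- (of_nat (Suc k) * (of_nat (Suc k) - 1) / 2)) * qpw (of_nat k) = qpw (- (of_nat k * (of_nat k - 1) / 2))"
    unfolding qpw_mult by (rule arg_cong)
  have "wt j (Suc k) * (qpw (of_nat k) * qnum (of_nat (Suc k)))
      = sgn_q j ^ Suc k * (qpw (- (of_nat (Suc k) * (of_nat (Suc k) - 1) / 2)) * qpw (of_nat k))
        * inverse (qfact k) * (inverse (qnum (of_nat (Suc k))) * qnum (of_nat (Suc k)))"
    unfolding wt_def f by (simp only: mult_ac)
  also have "\<dots> = sgn_q j * wt j k"
    unfolding p u wt_def by (simp add: mult_ac)
  finally show ?thesis .
qed

lemma Wt_split:
  assumes "i \<in> {1..n}"
  shows "Wt n \<kappa> = wt i (nat (lookup \<kappa> i)) * (\<Prod>j\<in>{1..n}-{i}. wt j (nat (lookup \<kappa> j)))"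
  unfolding Wt_def using assms by (intro prod.remove) auto

text \<open>Lowering one exponent k changes a single factor of the product, by the q^2-integer
  q^(k-1) [k] and \<open>sgn_q\<close>.\<close>

lemma Wt_bet:
  assumes "\<kappa> \<in> supp n" "i \<in> {1..n}" "1 \<le> lookup \<kappa> i"
  shows "sgn_q i * Wt n (\<kappa> - bet i)
    = Wt n \<kappa> * (qpw (of_int (lookup \<kappa> i) - 1) * qnum (of_int (lookup \<kappa> i)))"
proof -
  obtain k where k: "lookup \<kappa> i = int (Suc k)"
    using assms(3) that[of "nat (lookup \<kappa> i - 1)"] by simp
  have l: "lookup (\<kappa> - bet i) j = lookup \<kappa> j - (if j = i then 1 else 0)" if "j \<noteq> 0" for j
    using that by (simp add: lookup_minus lookup_bet)
  have r: "(\<Prod>j\<in>{1..n}-{i}. wt j (nat (lookup (\<kappa> - bet i) j)))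
      = (\<Prod>j\<in>{1..n}-{i}. wt j (nat (lookup \<kappa> j)))"
    by (rule prod.cong) (auto simp: l)
  have n: "nat (lookup (\<kappa> - bet i) i) = k" "nat (lookup \<kappa> i) = Suc k"
    using assms k by (auto simp: l)
  have q: "of_int (lookup \<kappa> i) = (of_nat (Suc k) :: complex)" by (simp add: k)
  have q': "of_nat (Suc k) - 1 = (of_nat k :: complex)" by simp
  show ?thesis
    unfolding Wt_split[OF assms(2)] r n q q' mult.assoc[symmetric] wt_Suc[symmetric]
    by (simp only: mult_ac)
qed

text \<open>A q^2-integer is split along a composition of its argument: multiplied by q - q^-1, the
  summands become differences of consecutive q^(2 tail - 1), and the sum telescopes between tail =
  level and tail = 0.\<close>

lemma tail_sum:
  assumes "\<kappa> \<in> supp n" "lev \<kappa> = Suc m"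
  shows "(\<Sum>i=1..n. qpw (2 * of_int (tail n i \<kappa>)) *
      (qpw (of_int (lookup \<kappa> i) - 1) * qnum (of_int (lookup \<kappa> i))))
    = qpw (of_nat m) * qnum (of_nat (Suc m))" (is "?l = ?r")
proof -
  let ?D = "qpw 1 - qpw (- 1)"
  define g where "g i = qpw (2 * of_int (tail n i \<kappa>) - 1)" for i
  have t: "qpw (2 * of_int (tail n i \<kappa>)) * (qpw (of_int (lookup \<kappa> i) - 1) * qnum (of_int (lookup \<kappa> i))) * ?D
      = g (i - 1) - g i" if "i \<in> {1..n}" for i
  proof -
    let ?k = "of_int (lookup \<kappa> i) :: complex" and ?t = "of_int (tail n i \<kappa>) :: complex"
    have "qpw (2 * ?t) * (qpw (?k - 1) * qnum ?k) * ?D = qpw (2 * ?t) * qpw (?k - 1) * (qnum ?k * ?D)"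
      by (simp only: mult_ac)
    also have "\<dots> = qpw (2 * ?t + (?k - 1) + ?k) - qpw (2 * ?t + (?k - 1) - ?k)"
      unfolding qnum_mult unfolding right_diff_distrib qpw_mult by simp
    also have "\<dots> = g (i - 1) - g i"
      using that tail_step[of i n \<kappa>] by (simp add: g_def algebra_simps)
    finally show ?thesis .
  qed
  have tel: "(\<Sum>i=1..N. g (i - 1) - g i) = g 0 - g N" for N
    by (induction N) auto
  have t0: "tail n 0 \<kappa> = int (Suc m)"
    using supp_sum[OF assms(1)] lookup_0_lev[OF assms(1)] assms(2) by (simp add: tail_def)
  have tn: "tail n n \<kappa> = 0" by (simp add: tail_def)
  have "?l * ?D = (\<Sum>i=1..n. g (i - 1) - g i)"
    unfolding sum_distrib_right by (rule sum.cong) (use t in auto)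
  also have "\<dots> = qpw (of_nat m + of_nat (Suc m)) - qpw (of_nat m - of_nat (Suc m))"
    unfolding tel unfolding g_def t0 tn by (simp add: algebra_simps)
  also have "\<dots> = qpw (of_nat m) * (qnum (of_nat (Suc m)) * ?D)"
    unfolding qnum_mult unfolding right_diff_distrib qpw_mult by simp
  finally have "?l * ?D = ?r * ?D" by (simp only: mult.assoc)
  then show ?thesis using qpw_diff_nonzero mult_right_cancel by blast
qed

text \<open>The coefficient with which the summand i of \<open>yx\<close> acts on a pair of equal
  monomials. The opposite powers of q from \<open>head\<close> have cancelled between the two
  factors.\<close>

definition Dc :: "complex \<Rightarrow> nat \<Rightarrow> nat \<Rightarrow> lat \<Rightarrow> complex fps" where
  "Dc lam n i \<kappa> = sgn_q i * qpw (2 * of_int (tail n i \<kappa>)) * (qnum (cc lam \<kappa> 0))\<^sup>2"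

lemma Qf_Suc: "Qf (Suc m) = Qf m * (qpw (of_nat m) * qnum (of_nat (Suc m)))"
proof -
  have "of_nat (Suc m) * (of_nat (Suc m) - 1) / 2 = of_nat m * (of_nat m - 1) / 2 + (of_nat m :: complex)"
    by (simp add: field_simps)
  then have "qpw (of_nat (Suc m) * (of_nat (Suc m) - 1) / 2) = qpw (of_nat m * (of_nat m - 1) / 2) * qpw (of_nat m)"
    by (metis qpw_mult)
  then show ?thesis unfolding Qf_def qfact_Suc by (simp only: mult_ac)
qed

lemma Pq_Suc: "Pq lam (Suc m) = Pq lam m * qnum (lam - of_nat m)"
  by (simp add: Pq_def)

lemma Cf_rec:
  assumes "\<kappa> \<in> supp n" "lev \<kappa> = Suc m"
  shows "(\<Sum>i=1..n. if 1 \<le> lookup \<kappa> i then Dc lam n i (\<kappa> - bet i) * Cf lam n (\<kappa> - bet i) else 0)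
    = Cf lam n \<kappa>"
proof -
  let ?k = "\<lambda>i. of_int (lookup \<kappa> i) :: complex"
  let ?c = "(Pq lam (Suc m))\<^sup>2 * Qf m * Wt n \<kappa>"
  have "(if 1 \<le> lookup \<kappa> i then Dc lam n i (\<kappa> - bet i) * Cf lam n (\<kappa> - bet i) else 0)
      = ?c * (qpw (2 * of_int (tail n i \<kappa>)) * (qpw (?k i - 1) * qnum (?k i)))" if i: "i \<in> {1..n}" for i
  proof (cases "1 \<le> lookup \<kappa> i")
    case True
    have s: "\<kappa> - bet i \<in> supp n" using supp_minus_bet[OF assms(1)] i True by auto
    have l: "lev (\<kappa> - bet i) = m" using lev_bet[OF s, of i] i assms(2) by simp
    have t: "tail n i (\<kappa> - bet i) = tail n i \<kappa>"
      unfolding tail_def by (rule sum.cong) (auto simp: lookup_minus lookup_bet)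
    have "Dc lam n i (\<kappa> - bet i) * Cf lam n (\<kappa> - bet i)
        = (Pq lam m)\<^sup>2 * (qnum (lam - of_nat m))\<^sup>2 * Qf m * qpw (2 * of_int (tail n i \<kappa>)) * (sgn_q i * Wt n (\<kappa> - bet i))"
      unfolding Dc_def Cf_def l t cc_0_lev[OF s] by (simp only: mult_ac)
    also have "\<dots> = ?c * (qpw (2 * of_int (tail n i \<kappa>)) * (qpw (?k i - 1) * qnum (?k i)))"
      unfolding Wt_bet[OF assms(1) i True] Pq_Suc power_mult_distrib by (simp only: mult_ac)
    finally show ?thesis using True by simp
  next
    case False
    \<comment> \<open>An index of exponent 0 contributes [0] = 0 to \<open>tail_sum\<close>, so the
      restriction of the sum is harmless.\<close>
    then have "lookup \<kappa> i = 0" using supp_nonneg[OF assms(1), of i] i by simp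
    then show ?thesis by simp
  qed
  then have "(\<Sum>i=1..n. if 1 \<le> lookup \<kappa> i then Dc lam n i (\<kappa> - bet i) * Cf lam n (\<kappa> - bet i) else 0)
      = ?c * (qpw (of_nat m) * qnum (of_nat (Suc m)))"
    unfolding tail_sum[OF assms, symmetric] sum_distrib_left by (intro sum.cong) auto
  also have "\<dots> = Cf lam n \<kappa>"
    unfolding Cf_def assms(2) Qf_Suc by (simp only: mult_ac)
  finally show ?thesis .
qed

text \<open>What remains of \<open>Gc\<close> besides \<open>Wt\<close>: the q-factorial and one of
  the two factors \<open>Pq\<close> cancel against the denominator of
  \<open>lift_coeff\<close>.\<close>

definition gm :: "complex \<Rightarrow> nat \<Rightarrow> complex fps" where
  "gm lam m = (- 1) ^ m * qpw ((lam + 1) * of_nat m - (of_nat m)\<^sup>2 + of_nat m * (of_nat m - 1) / 2) * Pq lam m"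

lemma Gc_eq:
  assumes "lam \<notin> \<nat>"
  shows "Gc lam n \<kappa> = gm lam (lev \<kappa>) * Wt n \<kappa>"
proof -
  let ?m = "lev \<kappa>"
  \<comment> \<open>The denominator of \<open>lift_coeff\<close> is a unit, so the quotient of power
    series is exact.\<close>
  have "fps_nth (qfact ?m * Pq lam ?m) 0 \<noteq> 0"
    using qfact_nth_0 Pq_nth_0[OF assms] by simp
  then have "is_unit (qfact ?m * Pq lam ?m)" by (simp add: fps_is_unit_iff)
  then have "qfact ?m * Pq lam ?m dvd (- 1) ^ ?m * qpw ((lam + 1) * of_nat ?m - (of_nat ?m)\<^sup>2)"
    by (rule unit_imp_dvd)
  then have L: "lift_coeff lam ?m * (qfact ?m * Pq lam ?m)
      = (- 1) ^ ?m * qpw ((lam + 1) * of_nat ?m - (of_nat ?m)\<^sup>2)"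
    unfolding lift_coeff_def Pq_def[symmetric] by (rule dvd_div_mult_self)
  have "Gc lam n \<kappa> = lift_coeff lam ?m * (qfact ?m * Pq lam ?m) * (qpw (of_nat ?m * (of_nat ?m - 1) / 2) * Pq lam ?m * Wt n \<kappa>)"
    unfolding Gc_def Cf_def Qf_def power2_eq_square by (simp only: mult_ac)
  also have "\<dots> = gm lam ?m * Wt n \<kappa>"
    unfolding L gm_def qpw_mult[symmetric] by (simp only: mult_ac)
  finally show ?thesis .
qed

lemma gm_nth_0: "lam \<notin> \<nat> \<Longrightarrow> fps_nth (gm lam m) 0 \<noteq> 0"
  using Pq_nth_0[of lam m] by (simp add: gm_def fps_power_zeroth)

lemma Gc_nth_0: "lam \<notin> \<nat> \<Longrightarrow> fps_nth (Gc lam n \<kappa>) 0 \<noteq> 0"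
  using gm_nth_0 Wt_nth_0 by (simp add: Gc_eq)

lemma Gc_0: "lam \<notin> \<nat> \<Longrightarrow> Gc lam n 0 = 1"
  by (simp add: Gc_eq gm_def Wt_def wt_def lev_def Pq_def qfact_def)

text \<open>Invariance under e_1 amounts to this recursion in the level. With value 1 at level 0 it
  determines \<open>gm\<close>, and thereby the powers of q in the series.\<close>

lemma gm_Suc: "gm lam (Suc m) = - (qpw (lam - of_nat m) * qnum (lam - of_nat m) * gm lam m)"
proof -
  let ?e = "\<lambda>m. (lam + 1) * of_nat m - (of_nat m)\<^sup>2 + of_nat m * (of_nat m - 1) / 2"
  have "?e (Suc m) = (lam - of_nat m) + ?e m"
    by (simp add: field_simps power2_eq_square)
  then have "qpw (?e (Suc m)) = qpw (lam - of_nat m) * qpw (?e m)"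
    by (metis qpw_mult)
  then show ?thesis unfolding gm_def Pq_Suc by (simp add: mult_ac)
qed

text \<open>Invariance of the form under \<open>e\<^sub>i\<close>, written for the inverse Gram matrix.\<close>

lemma Gc_del:
  assumes lam: "lam \<notin> \<nat>" and k: "\<kappa> \<in> supp n" "\<kappa> - del i \<in> supp n" and i: "i \<in> {1..n}" "1 \<le> lookup \<kappa> i"
  shows "qnum (cc lam (\<kappa> - del i) (i - 1)) * Gc lam n (\<kappa> - del i)
    = - (qnum (cc lam \<kappa> i) * qpw (- (cc lam (\<kappa> - del i) (i - 1) - cc lam (\<kappa> - del i) i)) * Gc lam n \<kappa>)"
proof -
  let ?k = "of_int (lookup \<kappa> i) :: complex"
  have i0: "i \<noteq> 0" "i \<noteq> i - 1" using i by auto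
  have ci: "cc lam \<kappa> i = ?k" "cc lam (\<kappa> - del i) i = ?k - 1"
    using i0 by (simp_all add: cc_nonzero cc_del)
  have b: "\<kappa> - bet i \<in> supp n" using supp_minus_bet[OF k(1)] i by auto
  note W = Wt_bet[OF k(1) i]
  show ?thesis
  \<comment> \<open>For i = 1 the level drops and \<open>gm_Suc\<close> enters. For i > 1 the level
    stays, and the two exponents are compared through their common predecessor
    \<open>\<kappa> - bet i\<close>.\<close>
  proof (cases "i = 1")
    case True
    then have d: "\<kappa> - del i = \<kappa> - bet i" by (simp add: del_def bet_def)
    obtain m where m: "lev (\<kappa> - bet i) = m" "lev \<kappa> = Suc m"
      using lev_bet[OF b, of i] i by auto
    have c: "cc lam (\<kappa> - del i) (i - 1) = lam - of_nat m" using cc_0_lev[OF b] m True d by simp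
    have s1: "sgn_q i = 1" using True by (simp add: sgn_q_def)
    have e: "- ((lam - of_nat m) - (?k - 1)) + (lam - of_nat m) = ?k - 1" by simp
    have "- (qnum ?k * qpw (- ((lam - of_nat m) - (?k - 1))) * (gm lam (Suc m) * Wt n \<kappa>))
        = qnum ?k * (qpw (- ((lam - of_nat m) - (?k - 1))) * qpw (lam - of_nat m)) * qnum (lam - of_nat m) * gm lam m * Wt n \<kappa>"
      unfolding gm_Suc by (simp add: mult_ac)
    also have "\<dots> = qnum (lam - of_nat m) * gm lam m * (Wt n \<kappa> * (qpw (?k - 1) * qnum ?k))"
      unfolding qpw_mult e by (simp only: mult_ac)
    also have "\<dots> = qnum (lam - of_nat m) * (gm lam m * Wt n (\<kappa> - bet i))"
      unfolding W[symmetric] s1 by (simp only: mult_ac mult_1_left)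
    finally show ?thesis
      unfolding Gc_eq[OF lam] ci c unfolding d m by (rule sym)
  next
    case False
    let ?u = "\<kappa> - del i" and ?i = "i - 1"
    let ?l = "of_int (lookup \<kappa> ?i) :: complex"
    have i': "?i \<in> {1..n}" "?i \<noteq> 0" using i False by auto
    have d: "?u - bet ?i = \<kappa> - bet i"
      using bet_Suc[of ?i] i' by (simp add: algebra_simps)
    have lk: "lookup ?u ?i = lookup \<kappa> ?i + 1"
      using i0 by (simp add: lookup_minus lookup_del)
    have ck: "cc lam ?u ?i = ?l + 1" unfolding cc_nonzero[OF i'(2)] lk by simp
    have u1: "1 \<le> lookup ?u ?i" using lk supp_nonneg[OF k(1), of ?i] i' by simp
    have lv: "lev ?u = lev \<kappa>" using i0 i' by (simp add: lev_def lookup_minus lookup_del)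
    have W': "sgn_q ?i * Wt n (\<kappa> - bet i) = Wt n ?u * (qpw ?l * qnum (?l + 1))"
      using Wt_bet[OF k(2) i'(1) u1] unfolding d lk by simp
    have sg: "sgn_q i = - (qpw 1 * sgn_q ?i)"
    proof -
      obtain r where r: "i = Suc (Suc r)" using i'(1) i(1) False by (cases i; cases "i - 1") auto
      have "qpw (of_nat (Suc r)) = qpw 1 * qpw (of_nat r)" by (simp add: qpw_mult)
      then show ?thesis unfolding r sgn_q_def by (simp add: mult_ac)
    qed
    have "Wt n \<kappa> * (qpw (?k - 1) * qnum ?k) = - (qpw 1 * (Wt n ?u * (qpw ?l * qnum (?l + 1))))"
      unfolding W'[symmetric] W[symmetric] sg by (simp add: mult_ac)
    then have "qpw (- ?l - 1) * (Wt n \<kappa> * (qpw (?k - 1) * qnum ?k))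
        = - ((qpw (- ?l - 1) * qpw 1 * qpw ?l) * (Wt n ?u * qnum (?l + 1)))"
      by (simp add: mult_ac)
    also have "qpw (- ?l - 1) * qpw 1 * qpw ?l = 1" unfolding qpw_mult by simp
    finally have "(qpw (- ?l - 1) * qpw (?k - 1)) * (Wt n \<kappa> * qnum ?k) = - (Wt n ?u * qnum (?l + 1))"
      by (simp add: mult_ac)
    moreover have "qpw (- ?l - 1) * qpw (?k - 1) = qpw (- (?l + 1 - (?k - 1)))"
      unfolding qpw_mult by (simp add: algebra_simps)
    ultimately have main: "qpw (- (?l + 1 - (?k - 1))) * (Wt n \<kappa> * qnum ?k) = - (Wt n ?u * qnum (?l + 1))"
      by simp
    have "- (qnum ?k * qpw (- (?l + 1 - (?k - 1))) * (gm lam (lev \<kappa>) * Wt n \<kappa>))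
        = - (gm lam (lev \<kappa>) * (qpw (- (?l + 1 - (?k - 1))) * (Wt n \<kappa> * qnum ?k)))"
      by (simp only: mult_ac)
    also have "\<dots> = qnum (?l + 1) * (gm lam (lev \<kappa>) * Wt n ?u)"
      unfolding main by (simp add: mult_ac)
    finally show ?thesis
      unfolding Gc_eq[OF lam] ck ci lv by (rule sym)
  qed
qed

section \<open>The dual bases\<close>

text \<open>The representative of a monomial is required to be a multiple of a word, the form in
  which \<open>pairing_eq_coord\<close> applies.\<close>

definition zv :: "bool \<Rightarrow> nat \<Rightarrow> complex \<Rightarrow> lat \<Rightarrow> alg" where
  "zv s n lam \<kappa> = (SOME u. (\<exists>gs c. u = c \<star> lw s gs \<and> set gs \<subseteq> {1..n}) \<and> act s n lam u (bas 0) = bas \<kappa>)"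

lemma zv_prop:
  assumes "lam \<notin> \<nat>" "\<kappa> \<in> supp n"
  shows "(\<exists>gs c. zv s n lam \<kappa> = c \<star> lw s gs \<and> set gs \<subseteq> {1..n}) \<and> act s n lam (zv s n lam \<kappa>) (bas 0) = bas \<kappa>"
proof -
  obtain gs c where gs: "set gs \<subseteq> {1..n}" "fps_nth c 0 \<noteq> 0" "act s n lam (lw s gs) (bas 0) = c \<star> bas \<kappa>"
    using act_lw_ex[OF assms, of s] by blast
  have "act s n lam (inverse c \<star> lw s gs) (bas 0) = bas \<kappa>"
    by (simp add: act_smul_left gs(3) fps_inverse_unit[OF gs(2)])
  then have "\<exists>u. (\<exists>gs c. u = c \<star> lw s gs \<and> set gs \<subseteq> {1..n}) \<and> act s n lam u (bas 0) = bas \<kappa>"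
    using gs(1) by blast
  then show ?thesis unfolding zv_def by (rule someI_ex)
qed

lemma act_zv: "lam \<notin> \<nat> \<Longrightarrow> \<kappa> \<in> supp n \<Longrightarrow> act s n lam (zv s n lam \<kappa>) (bas 0) = bas \<kappa>"
  using zv_prop by blast

lemma JJ_iff: "lam \<notin> \<nat> \<Longrightarrow> u \<in> JJ s n lam \<longleftrightarrow> act s n lam u (bas 0) = 0"
proof -
  assume "lam \<notin> \<nat>"
  then interpret osc_mod s n lam by unfold_locales
  show ?thesis by (rule JJ_eq_kernel)
qed

lemma coord_opF:
  "coord \<kappa> (opF lam i t) = qnum (cc lam (\<kappa> - del i) (i - 1)) * coord (\<kappa> - del i) t"
proof -
  let ?c = "qnum (cc lam (\<kappa> - del i) (i - 1))"
  have e: "\<kappa>' + del i = \<kappa> \<longleftrightarrow> \<kappa>' = \<kappa> - del i" for \<kappa>' by (auto simp: algebra_simps)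
  have "(coord \<kappa> (opF lam i t) * 1) \<star> (bas 0 :: osc) = (coord (\<kappa> - del i) t * ?c) \<star> bas 0"
  proof (rule hlin_eqI[where x = t])
    show "hlin (\<lambda>t. (coord \<kappa> (opF lam i t) * 1) \<star> (bas 0 :: osc))"
      by (rule hlin_coord_smul[OF hlin_opF])
    show "hlin (\<lambda>t. (coord (\<kappa> - del i) t * ?c) \<star> (bas 0 :: osc))"
      by (rule hlin_coord_smul[OF hlin_id])
  qed (auto simp: opF_bas coord_bas e eq_commute[of \<kappa>] eq_commute[of "\<kappa> - del i"])
  then have "coord 0 ((coord \<kappa> (opF lam i t) * 1) \<star> (bas 0 :: osc)) = coord 0 ((coord (\<kappa> - del i) t * ?c) \<star> (bas 0 :: osc))"
    by simp
  then show ?thesis by (simp add: coord_bas mult.commute)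
qed

text \<open>The Cartan factor acts after e_i, so it is evaluated at the shifted exponent.\<close>

lemma act_antipode_gen:
  assumes "i \<in> {1..n}"
  shows "act True n lam (antipode_gen n (Egen i)) (bas \<kappa>)
    = (- (qnum (cc lam \<kappa> i) * qpw (- (cc lam (\<kappa> - del i) (i - 1) - cc lam (\<kappa> - del i) i)))) \<star> bas (\<kappa> - del i)"
proof -
  have "act True n lam (ee i) t = opE lam i t" for t using act_EF(1)[OF assms, of True] by simp
  then have "act True n lam (antipode_gen n (Egen i)) (bas \<kappa>)
      = - (qnum (cc lam \<kappa> i) \<star> (qpw (cartan_weight True n lam (\<kappa> - del i) (\<lambda>a. - alpha i a)) \<star> bas (\<kappa> - del i)))"
    by (simp add: act_minus_left act_mult opE_bas act_smul act_cartan_bas)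
  also have "cartan_weight True n lam (\<kappa> - del i) (\<lambda>a. - alpha i a)
      = - (cc lam (\<kappa> - del i) (i - 1) - cc lam (\<kappa> - del i) i)"
    unfolding cartan_weight_alpha[OF assms] by (simp add: sg_def)
  finally show ?thesis by simp
qed

text \<open>Invariance of the form moves the antipode of a word in the e's to the other argument.\<close>

lemma coord_antipode_word:
  assumes lam: "lam \<notin> \<nat>" and "set gs \<subseteq> {1..n}" "\<kappa> \<in> supp n"
  shows "coord 0 (act True n lam (prod_list (rev (map (\<lambda>i. antipode_gen n (Egen i)) gs))) (bas \<kappa>)) * Gc lam n \<kappa>
    = coord \<kappa> (act False n lam (lw False gs) (bas 0))"
  using assms(2,3)
proof (induction gs arbitrary: \<kappa>)
  case Nil
  then show ?case by (auto simp: lw_simps act_1 coord_bas Gc_0[OF lam])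
next
  case (Cons i gs)
  then have i: "i \<in> {1..n}" by simp
  let ?S = "prod_list (rev (map (\<lambda>i. antipode_gen n (Egen i)) gs))" and ?k = "\<kappa> - del i"
  let ?t = "act False n lam (lw False gs) (bas 0)"
  let ?q = "qpw (- (cc lam ?k (i - 1) - cc lam ?k i))"
  have L: "coord 0 (act True n lam (prod_list (rev (map (\<lambda>i. antipode_gen n (Egen i)) (i # gs)))) (bas \<kappa>))
      = - (qnum (cc lam \<kappa> i) * ?q) * coord 0 (act True n lam ?S (bas ?k))"
    unfolding list.map rev.simps prod_list.append act_mult
    by (simp only: prod_list.Cons prod_list.Nil mult_1_right act_antipode_gen[OF i] act_smul coord_smul)
  have R: "coord \<kappa> (act False n lam (lw False (i # gs)) (bas 0)) = qnum (cc lam ?k (i - 1)) * coord ?k ?t"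
  proof -
    have "act False n lam (lw False (i # gs)) (bas 0) = opF lam i ?t"
      unfolding lw_simps act_mult using i by (simp add: act_lo)
    then show ?thesis by (simp add: coord_opF)
  qed
  show ?case
  proof (cases "lookup \<kappa> i = 0")
    case True
    \<comment> \<open>Both sides vanish: the left one through [0], the right one because the
      exponent leaves the support.\<close>
    have "?k \<notin> supp n"
    proof
      assume "?k \<in> supp n"
      then show False using supp_nonneg[of ?k n i] i True by (auto simp: lookup_minus lookup_del split: if_splits)
    qed
    moreover have "supported n ?t" by (rule act_supported) (rule supported_bas[OF zero_supp])
    ultimately have "coord ?k ?t = 0" by (simp add: supported_def)
    moreover have "qnum (cc lam \<kappa> i) = 0" using True i by (simp add: cc_nonzero)
    ultimately show ?thesis unfolding L R by simp
  next
    case False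
    then have l: "1 \<le> lookup \<kappa> i" using supp_nonneg[OF Cons.prems(2), of i] i by simp
    then have "\<kappa> + (single (i - 1) 1 - single i 1) \<in> supp n"
      using i Cons.prems by (intro supp_move) auto
    then have k: "?k \<in> supp n" by (simp add: del_def algebra_simps del: single_one)
    have IH: "coord 0 (act True n lam ?S (bas ?k)) * Gc lam n ?k = coord ?k ?t"
      using Cons k by simp
    show ?thesis
      unfolding L R IH[symmetric] mult.left_commute[of "qnum (cc lam ?k (i - 1))"]
        Gc_del[OF lam Cons.prems(2) k i l]
      by (simp only: mult_ac minus_mult_left[symmetric] minus_mult_right[symmetric])
  qed
qed

text \<open>Once the antipode is moved over, the pairing times \<open>Gc\<close> at
  \<open>\<kappa>'\<close> becomes a coordinate of the action of \<open>zv False\<close> on the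
  generator, which is a monomial. The non-zero factor is then cancelled.\<close>

lemma pairing_zv:
  assumes lam: "lam \<notin> \<nat>" and k: "\<kappa> \<in> supp n" "\<kappa>' \<in> supp n"
  shows "pairing n lam (Gc lam n \<kappa> \<star> zv False n lam \<kappa>) (zv True n lam \<kappa>') = (if \<kappa> = \<kappa>' then 1 else 0)"
proof -
  obtain gs c where gs: "zv False n lam \<kappa> = c \<star> lw False gs" "set gs \<subseteq> {1..n}"
    using zv_prop[OF lam k(1)] by blast
  obtain hs d where hs: "zv True n lam \<kappa>' = d \<star> lw True hs" "set hs \<subseteq> {1..n}"
    using zv_prop[OF lam k(2)] by blast
  let ?G = "Gc lam n \<kappa>" and ?G' = "Gc lam n \<kappa>'"
  have "pairing n lam (?G \<star> zv False n lam \<kappa>) (zv True n lam \<kappa>')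
      = coord 0 (act True n lam (antipode n ((?G * c) \<star> lw False gs) * (d \<star> lw True hs)) (bas 0))"
    unfolding gs(1) hs(1) hs.scale_scale by (rule pairing_eq_coord[OF lam gs(2) hs(2)])
  also have "\<dots> = ?G * c * coord 0 (act True n lam (prod_list (rev (map (\<lambda>i. antipode_gen n (Egen i)) gs))) (bas \<kappa>'))"
    unfolding antipode_lw act_mult hs(1)[symmetric] act_zv[OF lam k(2)] act_smul_left coord_smul ..
  finally have "pairing n lam (?G \<star> zv False n lam \<kappa>) (zv True n lam \<kappa>') * ?G'
      = ?G * (c * coord \<kappa>' (act False n lam (lw False gs) (bas 0)))"
    unfolding coord_antipode_word[OF lam gs(2) k(2), symmetric] by (simp only: mult_ac)
  also have "\<dots> = ?G * coord \<kappa>' (act False n lam (zv False n lam \<kappa>) (bas 0))"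
    unfolding gs(1) act_smul_left coord_smul ..
  also have "\<dots> = (if \<kappa> = \<kappa>' then 1 else 0) * ?G'"
    unfolding act_zv[OF lam k(1)] coord_bas by auto
  finally have e: "pairing n lam (?G \<star> zv False n lam \<kappa>) (zv True n lam \<kappa>') * ?G' = (if \<kappa> = \<kappa>' then 1 else 0) * ?G'" .
  have "?G' \<noteq> 0" using Gc_nth_0[OF lam, of n \<kappa>'] by auto
  from mult_right_cancel[OF this, THEN iffD1, OF e] show ?thesis .
qed

lemma JJ_weight:
  assumes "lam \<notin> \<nat>" "act s n lam u (bas 0) = d \<star> bas \<kappa>" "a \<in> {1..n + 1}"
  shows "gen (Hgen a) * u - scal (fps_const (sg s * cc lam \<kappa> (a - 1))) * u \<in> JJ s n lam"
  using assms(2,3) unfolding JJ_iff[OF assms(1)] act_diff_left act_mult act_scal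
  by (simp only: act_smul act_H hs.scale_scale) (simp add: mult.commute)

section \<open>Expansion of the series\<close>

text \<open>Tensors that vanish in the product of the two modules. The expansion of each power of
  \<open>yx\<close> holds modulo this submodule alone, which lies in every step of the
  filtration.\<close>

definition JT :: "nat \<Rightarrow> complex \<Rightarrow> alg2 set" where
  "JT n lam = hmodule hull {x \<otimes>\<^sub>h y |x y. x \<in> J_plus n lam \<or> y \<in> J_minus n lam}"

lemma JT_hmodule: "hmodule (JT n lam)"
  unfolding JT_def by (rule hmodule_hull)

lemma JT_gen: "x \<in> J_plus n lam \<or> y \<in> J_minus n lam \<Longrightarrow> x \<otimes>\<^sub>h y \<in> JT n lam"
  unfolding JT_def by (rule hull_inc) blast

lemma J_conv: "J_plus n lam = JJ True n lam" "J_minus n lam = JJ False n lam"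
  by (simp_all add: JJ_def)

lemma JT_lmult:
  assumes "t \<in> JT n lam"
  shows "(x \<otimes>\<^sub>h y) * t \<in> JT n lam"
  using assms unfolding JT_def[of n lam]
proof (elim hull_hmodule_hlin[OF _ hlin_lmult hmodule_hull], fold JT_def)
  fix t assume "t \<in> {x \<otimes>\<^sub>h y |x y. x \<in> J_plus n lam \<or> y \<in> J_minus n lam}"
  then obtain x' y' where "t = x' \<otimes>\<^sub>h y'" "x' \<in> J_plus n lam \<or> y' \<in> J_minus n lam" by blast
  then show "(x \<otimes>\<^sub>h y) * t \<in> JT n lam"
    unfolding J_conv by (auto simp: tensor_mult J_conv intro!: JT_gen JJ_lmult)
qed

lemma yx_JT: "t \<in> JT n lam \<Longrightarrow> yx n lam * t \<in> JT n lam"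
  unfolding yx_def sum_distrib_right by (intro hmodule_sum[OF JT_hmodule] JT_lmult)

definition Tz :: "nat \<Rightarrow> complex \<Rightarrow> lat \<Rightarrow> alg2" where
  "Tz n lam \<kappa> = zv True n lam \<kappa> \<otimes>\<^sub>h zv False n lam \<kappa>"

lemma tensor_cong_JT:
  assumes "u - u' \<in> J_plus n lam" "w - w' \<in> J_minus n lam"
  shows "u \<otimes>\<^sub>h w - u' \<otimes>\<^sub>h w' \<in> JT n lam"
proof -
  have "(u - u') \<otimes>\<^sub>h w + u' \<otimes>\<^sub>h (w - w') \<in> JT n lam"
    using assms by (intro hmodule_add[OF JT_hmodule] JT_gen) auto
  then show ?thesis by (simp add: tensor_diff_left tensor_diff_right)
qed

lemma yx_Tz:
  assumes lam: "lam \<notin> \<nat>" and k: "\<kappa> \<in> supp n"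
  shows "yx n lam * Tz n lam \<kappa> - (\<Sum>i=1..n. Dc lam n i \<kappa> \<star> Tz n lam (\<kappa> + bet i)) \<in> JT n lam"
proof -
  have "(yroot' n lam i \<otimes>\<^sub>h xroot i) * Tz n lam \<kappa> - Dc lam n i \<kappa> \<star> Tz n lam (\<kappa> + bet i) \<in> JT n lam"
    if i: "i \<in> {1..n}" for i
  proof -
    let ?k = "\<kappa> + bet i"
    have k': "?k \<in> supp n" using supp_bet[OF k] i by auto
    define dy where "dy = qnum (cc lam \<kappa> 0) * qpw (of_int (head i \<kappa>)) * qpw (2 * of_int (tail n i \<kappa>))"
    define dx where "dx = (- 1) ^ (i - 1) * qpw (of_nat (i - 1)) * qpw (- of_int (head i \<kappa>)) * qnum (cc lam \<kappa> 0)"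
    have "yroot' n lam i * zv True n lam \<kappa> - dy \<star> zv True n lam ?k \<in> J_plus n lam"
      unfolding J_conv JJ_iff[OF lam] act_diff_left act_mult act_smul_left act_zv[OF lam k] act_zv[OF lam k']
        act_yroot'[OF k i] dy_def by simp
    moreover have "xroot i * zv False n lam \<kappa> - dx \<star> zv False n lam ?k \<in> J_minus n lam"
      unfolding J_conv JJ_iff[OF lam] act_diff_left act_mult act_smul_left act_zv[OF lam k] act_zv[OF lam k']
        act_xroot[OF i] dx_def by simp
    ultimately have "(yroot' n lam i * zv True n lam \<kappa>) \<otimes>\<^sub>h (xroot i * zv False n lam \<kappa>)
        - (dy \<star> zv True n lam ?k) \<otimes>\<^sub>h (dx \<star> zv False n lam ?k) \<in> JT n lam"
      by (rule tensor_cong_JT)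
    moreover have "dx * dy = Dc lam n i \<kappa>"
    proof -
      have "qpw (of_int (head i \<kappa>)) * qpw (- of_int (head i \<kappa>)) = 1" unfolding qpw_mult by simp
      moreover have "dx * dy = (qpw (of_int (head i \<kappa>)) * qpw (- of_int (head i \<kappa>))) * Dc lam n i \<kappa>"
        unfolding dy_def dx_def Dc_def sgn_q_def power2_eq_square by (simp only: mult_ac)
      ultimately show ?thesis by simp
    qed
    ultimately show ?thesis
      unfolding Tz_def tensor_mult tensor_smul_left tensor_smul_right hs.scale_scale by (simp only:)
  qed
  then have "(\<Sum>i=1..n. (yroot' n lam i \<otimes>\<^sub>h xroot i) * Tz n lam \<kappa> - Dc lam n i \<kappa> \<star> Tz n lam (\<kappa> + bet i)) \<in> JT n lam"
    by (intro hmodule_sum[OF JT_hmodule])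
  then show ?thesis by (simp add: sum_subtractf yx_def sum_distrib_right)
qed

definition level :: "nat \<Rightarrow> nat \<Rightarrow> lat set" where
  "level n m = {\<kappa> \<in> supp n. lev \<kappa> = m}"

lemma finite_level: "finite (level n m)"
  by (rule finite_subset[OF _ finite_supp_lev[of n m]]) (auto simp: level_def)

lemma yx_power_expand:
  assumes lam: "lam \<notin> \<nat>"
  shows "yx n lam ^ m - (\<Sum>\<kappa>\<in>level n m. Cf lam n \<kappa> \<star> Tz n lam \<kappa>) \<in> JT n lam"
proof (induction m)
  case 0
  have l: "level n 0 = {0}" using lev_0[of _ n] zero_supp[of n] by (auto simp: level_def)
  have c: "Cf lam n 0 = 1"
    by (simp add: Cf_def Pq_def Qf_def qfact_def Wt_def wt_def lev_def)
  have "1 - zv s n lam 0 \<in> JJ s n lam" for s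
    unfolding JJ_iff[OF lam] by (simp add: act_diff_left act_1 act_zv[OF lam zero_supp])
  then have "1 \<otimes>\<^sub>h 1 - Tz n lam 0 \<in> JT n lam"
    unfolding Tz_def by (intro tensor_cong_JT) (simp_all add: J_conv)
  then show ?case by (simp add: l c tensor_1)
next
  case (Suc m)
  let ?T = "Tz n lam" and ?C = "Cf lam n" and ?D = "Dc lam n"
  have "yx n lam * (yx n lam ^ m - (\<Sum>\<kappa>\<in>level n m. ?C \<kappa> \<star> ?T \<kappa>))
      + (\<Sum>\<kappa>\<in>level n m. ?C \<kappa> \<star> (yx n lam * ?T \<kappa> - (\<Sum>i=1..n. ?D i \<kappa> \<star> ?T (\<kappa> + bet i)))) \<in> JT n lam"
    by (intro hmodule_add[OF JT_hmodule] hmodule_sum[OF JT_hmodule] hmodule_smul[OF JT_hmodule] yx_JT Suc yx_Tz[OF lam])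
      (simp add: level_def)
  moreover have "(\<Sum>\<kappa>\<in>level n m. ?C \<kappa> \<star> (\<Sum>i=1..n. ?D i \<kappa> \<star> ?T (\<kappa> + bet i)))
      = (\<Sum>\<kappa>\<in>level n (Suc m). ?C \<kappa> \<star> ?T \<kappa>)"
  proof -
    have "(\<Sum>\<kappa>\<in>level n m. ?C \<kappa> \<star> (\<Sum>i=1..n. ?D i \<kappa> \<star> ?T (\<kappa> + bet i)))
        = (\<Sum>i=1..n. \<Sum>\<kappa>\<in>level n m. (?D i \<kappa> * ?C \<kappa>) \<star> ?T (\<kappa> + bet i))"
      by (subst sum.swap) (simp add: hs.scale_sum_right mult.commute)
    \<comment> \<open>Terms are re-indexed by the monomial they produce, so that the contributions
      of different i to it can be added by \<open>Cf_rec\<close>.\<close>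
    also have "\<dots> = (\<Sum>i=1..n. \<Sum>\<kappa>\<in>level n (Suc m) \<inter> {\<kappa>. 1 \<le> lookup \<kappa> i}.
        (?D i (\<kappa> - bet i) * ?C (\<kappa> - bet i)) \<star> ?T \<kappa>)"
    proof (rule sum.cong[OF refl])
      fix i assume i: "i \<in> {1..n}"
      show "(\<Sum>\<kappa>\<in>level n m. (?D i \<kappa> * ?C \<kappa>) \<star> ?T (\<kappa> + bet i))
          = (\<Sum>\<kappa>\<in>level n (Suc m) \<inter> {\<kappa>. 1 \<le> lookup \<kappa> i}. (?D i (\<kappa> - bet i) * ?C (\<kappa> - bet i)) \<star> ?T \<kappa>)"
      proof (rule sum.reindex_bij_witness[of _ "\<lambda>\<kappa>. \<kappa> - bet i" "\<lambda>\<kappa>. \<kappa> + bet i"])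
        fix \<kappa> assume k: "\<kappa> \<in> level n m"
        then show "\<kappa> + bet i \<in> level n (Suc m) \<inter> {\<kappa>. 1 \<le> lookup \<kappa> i}"
          using i supp_bet[of \<kappa> n i] lev_bet[of \<kappa> n i] supp_nonneg[of \<kappa> n i]
          by (auto simp: level_def lookup_add lookup_bet)
      next
        fix \<kappa> assume k: "\<kappa> \<in> level n (Suc m) \<inter> {\<kappa>. 1 \<le> lookup \<kappa> i}"
        then have "\<kappa> - bet i \<in> supp n" using i by (intro supp_minus_bet) (auto simp: level_def)
        then show "\<kappa> - bet i \<in> level n m"
          using k lev_bet[of "\<kappa> - bet i" n i] i by (auto simp: level_def)
      qed auto
    qed
    also have "\<dots> = (\<Sum>i=1..n. \<Sum>\<kappa>\<in>level n (Suc m). (if 1 \<le> lookup \<kappa> i then ?D i (\<kappa> - bet i) * ?C (\<kappa> - bet i) else 0) \<star> ?T \<kappa>)"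
      by (simp add: sum.inter_restrict[OF finite_level] if_distrib[of "\<lambda>c. c \<star> _"] cong: if_cong)
    also have "\<dots> = (\<Sum>\<kappa>\<in>level n (Suc m). (\<Sum>i=1..n. if 1 \<le> lookup \<kappa> i then ?D i (\<kappa> - bet i) * ?C (\<kappa> - bet i) else 0) \<star> ?T \<kappa>)"
      by (subst sum.swap) (simp add: hs.scale_sum_left)
    also have "\<dots> = (\<Sum>\<kappa>\<in>level n (Suc m). ?C \<kappa> \<star> ?T \<kappa>)"
      by (rule sum.cong) (simp_all add: level_def Cf_rec[unfolded One_nat_def])
    finally show ?thesis .
  qed
  ultimately show ?case
    by (simp add: right_diff_distrib hs.scale_right_diff_distrib sum_subtractf sum_distrib_left)
qed

subsection \<open>The filtration of the tensor product\<close>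

lemma MM_filt_hmodule: "hmodule (MM_filt n lam d)"
  unfolding MM_filt_def by (rule hmodule_hull)

lemma JT_MM_filt: "JT n lam \<subseteq> MM_filt n lam d"
  unfolding JT_def MM_filt_def by (rule hull_mono) blast

lemma zv_deg_plus:
  assumes "lam \<notin> \<nat>" "\<kappa> \<in> supp n"
  shows "zv True n lam \<kappa> \<in> deg_plus n lam (lev \<kappa>)"
  using JJ_weight[OF assms(1), of True n "zv True n lam \<kappa>" 1 \<kappa> 1]
  by (simp add: deg_plus_def J_conv act_zv[OF assms] sg_def cc_0_lev[OF assms(2)])

lemma Tz_MM_filt:
  assumes "lam \<notin> \<nat>" "\<kappa> \<in> supp n" "d \<le> lev \<kappa>"
  shows "Tz n lam \<kappa> \<in> MM_filt n lam d"
  unfolding Tz_def MM_filt_def by (rule hull_inc) (use zv_deg_plus[OF assms(1,2)] assms(3) in blast)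

lemma yx_power_MM_filt:
  assumes lam: "lam \<notin> \<nat>" and "d \<le> m"
  shows "yx n lam ^ m \<in> MM_filt n lam d"
proof -
  have "(\<Sum>\<kappa>\<in>level n m. Cf lam n \<kappa> \<star> Tz n lam \<kappa>) \<in> MM_filt n lam d"
    using assms(2) by (intro hmodule_sum[OF MM_filt_hmodule] hmodule_smul[OF MM_filt_hmodule] Tz_MM_filt[OF lam])
      (auto simp: level_def)
  then show ?thesis
    using yx_power_expand[OF lam] JT_MM_filt hmodule_cong[OF MM_filt_hmodule] by blast
qed

text \<open>Power m of \<open>yx\<close> involves exactly the exponents of level m, so every
  exponent receives its coefficient from a single term of the series.\<close>

lemma partial_sum_expand:
  assumes lam: "lam \<notin> \<nat>"
  shows "(\<Sum>m<k. lift_coeff lam m \<star> yx n lam ^ m)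
    - (\<Sum>\<kappa>\<in>{\<kappa> \<in> supp n. lev \<kappa> < k}. Gc lam n \<kappa> \<star> Tz n lam \<kappa>) \<in> JT n lam"
proof -
  have fin: "finite {\<kappa> \<in> supp n. lev \<kappa> < k}"
    by (rule finite_subset[OF _ finite_supp_lev[of n k]]) auto
  have "(\<Sum>\<kappa>\<in>{\<kappa> \<in> supp n. lev \<kappa> < k}. Gc lam n \<kappa> \<star> Tz n lam \<kappa>)
      = (\<Sum>m<k. \<Sum>\<kappa>\<in>{\<kappa> \<in> {\<kappa> \<in> supp n. lev \<kappa> < k}. lev \<kappa> = m}. Gc lam n \<kappa> \<star> Tz n lam \<kappa>)"
    by (rule sum.group[symmetric]) (use fin in auto)
  also have "\<dots> = (\<Sum>m<k. lift_coeff lam m \<star> (\<Sum>\<kappa>\<in>level n m. Cf lam n \<kappa> \<star> Tz n lam \<kappa>))"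
  proof (rule sum.cong[OF refl])
    fix m assume "m \<in> {..<k}"
    then have "{\<kappa> \<in> {\<kappa> \<in> supp n. lev \<kappa> < k}. lev \<kappa> = m} = level n m" by (auto simp: level_def)
    then show "(\<Sum>\<kappa>\<in>{\<kappa> \<in> {\<kappa> \<in> supp n. lev \<kappa> < k}. lev \<kappa> = m}. Gc lam n \<kappa> \<star> Tz n lam \<kappa>)
        = lift_coeff lam m \<star> (\<Sum>\<kappa>\<in>level n m. Cf lam n \<kappa> \<star> Tz n lam \<kappa>)"
      by (auto simp: hs.scale_sum_right level_def Gc_def intro!: sum.cong)
  qed
  finally have e: "(\<Sum>\<kappa>\<in>{\<kappa> \<in> supp n. lev \<kappa> < k}. Gc lam n \<kappa> \<star> Tz n lam \<kappa>)
      = (\<Sum>m<k. lift_coeff lam m \<star> (\<Sum>\<kappa>\<in>level n m. Cf lam n \<kappa> \<star> Tz n lam \<kappa>))" .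
  have "(\<Sum>m<k. lift_coeff lam m \<star> (yx n lam ^ m - (\<Sum>\<kappa>\<in>level n m. Cf lam n \<kappa> \<star> Tz n lam \<kappa>))) \<in> JT n lam"
    by (intro hmodule_sum[OF JT_hmodule] hmodule_smul[OF JT_hmodule] yx_power_expand[OF lam])
  then show ?thesis unfolding e by (simp add: sum_subtractf hs.scale_right_diff_distrib)
qed

theorem theorem6p2:
  fixes n :: nat and lam :: complex
  assumes "n \<ge> 1" and "lam \<notin> \<nat>"
  shows "\<exists>\<Omega>. canonical_element n lam \<Omega> \<and>
    is_lift n lam (\<lambda>k. \<Sum>m<k. scal (lift_coeff lam m) * yx n lam ^ m) \<Omega>"
proof -
  note lam = assms(2)
  \<comment> \<open>\<open>S\<close> serves both as the lift and as \<Omega>: the product of the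
    generators is represented by \<open>1 \<otimes>\<^sub>h 1\<close>, the unit.\<close>
  define S where "S k = (\<Sum>m<k. lift_coeff lam m \<star> yx n lam ^ m)" for k
  have S: "S = (\<lambda>k. \<Sum>m<k. scal (lift_coeff lam m) * yx n lam ^ m)"
    by (simp add: S_def smul_def fun_eq_iff)
  obtain kk :: "nat \<Rightarrow> lat" where kk: "bij_betw kk UNIV (supp n)" using supp_enum[OF assms(1)] by blast
  note kks = kk_supp[OF kk]
  \<comment> \<open>The inverse Gram entries are put into the second basis, so that it becomes dual
    to the first.\<close>
  let ?a = "\<lambda>i. zv True n lam (kk i)" and ?b = "\<lambda>i. Gc lam n (kk i) \<star> zv False n lam (kk i)"
  have a: "act True n lam (?a i) (bas 0) = 1 \<star> bas (kk i)" for i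
    by (simp add: act_zv[OF lam kks])
  have b: "act False n lam (?b i) (bas 0) = Gc lam n (kk i) \<star> bas (kk i)" for i
    by (simp add: act_smul_left act_zv[OF lam kks])
  have "dual_bases n lam ?a ?b"
    unfolding dual_bases_def J_conv
  proof (intro conjI allI)
    show "is_basis (JJ True n lam) ?a" by (rule is_basis_osc[OF kk lam a]) simp
    show "is_basis (JJ False n lam) ?b" by (rule is_basis_osc[OF kk lam b]) (rule Gc_nth_0[OF lam])
    show "\<exists>\<mu>. weight_vector n (JJ True n lam) \<mu> (?a i)" for i
      unfolding weight_vector_def
      by (rule exI[of _ "\<lambda>c. sg True * cc lam (kk i) (c - 1)"]) (intro ballI JJ_weight[OF lam a])
    show "\<exists>\<mu>. weight_vector n (JJ False n lam) \<mu> (?b i)" for i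
      unfolding weight_vector_def
      by (rule exI[of _ "\<lambda>c. sg False * cc lam (kk i) (c - 1)"]) (intro ballI JJ_weight[OF lam b])
    show "pairing n lam (?b i) (?a j) = (if i = j then 1 else 0)" for i j
      using pairing_zv[OF lam kks kks, of i j] by (simp add: kk_inj[OF kk])
  qed
  moreover have cS: "cauchy_seq (MM_filt n lam) S"
    unfolding S_def
    by (rule cauchy_partial_sums[OF MM_filt_hmodule]) (intro hmodule_smul[OF MM_filt_hmodule] yx_power_MM_filt[OF lam])
  moreover have "null_seq (MM_filt n lam) (\<lambda>k. S k - (\<Sum>i<k. ?a i \<otimes>\<^sub>h ?b i))"
    unfolding null_seq_def
  proof
    fix d
    let ?g = "\<lambda>\<kappa>. Gc lam n \<kappa> \<star> Tz n lam \<kappa>"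
    \<comment> \<open>The sums of \<open>S\<close> run over levels below k, those of the bases over
      the first k exponents of the numbering. For large k they differ only in exponents of level at
      least d.\<close>
    have "finite {\<kappa> \<in> supp n. lev \<kappa> \<le> d}" by (rule finite_supp_lev)
    then have "\<forall>\<^sub>F k in sequentially. (\<forall>i. kk i \<in> {\<kappa> \<in> supp n. lev \<kappa> \<le> d} \<longrightarrow> i < k) \<and> d \<le> k"
      by (intro eventually_conj eventually_kk[OF kk] eventually_ge_at_top)
    then show "\<forall>\<^sub>F k in sequentially. S k - (\<Sum>i<k. ?a i \<otimes>\<^sub>h ?b i) \<in> MM_filt n lam d"
    proof (rule eventually_mono, elim conjE)
      fix k assume k: "\<forall>i. kk i \<in> {\<kappa> \<in> supp n. lev \<kappa> \<le> d} \<longrightarrow> i < k" "d \<le> k"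
      let ?A = "{\<kappa> \<in> supp n. lev \<kappa> < k}" and ?B = "kk ` {..<k}"
      have fA: "finite ?A" by (rule finite_subset[OF _ finite_supp_lev[of n k]]) auto
      have BB: "?B \<subseteq> supp n" using kks by blast
      have "(\<Sum>i<k. ?a i \<otimes>\<^sub>h ?b i) = (\<Sum>i<k. ?g (kk i))"
        by (simp add: Tz_def tensor_smul_right)
      also have "\<dots> = sum ?g ?B"
        by (rule sum.reindex[symmetric, unfolded comp_def]) (simp add: inj_on_def kk_inj[OF kk])
      finally have B: "(\<Sum>i<k. ?a i \<otimes>\<^sub>h ?b i) = sum ?g ?B" .
      have split: "sum ?g ?A - sum ?g ?B = sum ?g (?A - ?B) - sum ?g (?B - ?A)"
      proof -
        have "sum ?g ?A = sum ?g (?A \<inter> ?B) + sum ?g (?A - ?B)"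
          by (rule sum.Int_Diff[OF fA])
        moreover have "sum ?g ?B = sum ?g (?A \<inter> ?B) + sum ?g (?B - ?A)"
          by (subst Int_commute) (rule sum.Int_Diff, simp)
        ultimately show ?thesis by (simp only: add_diff_cancel_left)
      qed
      have m: "?g \<kappa> \<in> MM_filt n lam d" if "\<kappa> \<in> supp n" "d \<le> lev \<kappa>" for \<kappa>
        by (intro hmodule_smul[OF MM_filt_hmodule] Tz_MM_filt[OF lam] that)
      have "sum ?g (?A - ?B) \<in> MM_filt n lam d"
      proof (intro hmodule_sum[OF MM_filt_hmodule] m)
        fix \<kappa> assume x: "\<kappa> \<in> ?A - ?B"
        then show "\<kappa> \<in> supp n" by simp
        then obtain i where i: "\<kappa> = kk i" using kk by (auto simp: bij_betw_def)
        then have "\<not> i < k" using x by auto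
        then have "kk i \<notin> {\<kappa> \<in> supp n. lev \<kappa> \<le> d}" using k(1) by blast
        then show "d \<le> lev \<kappa>" using i kks[of i] by simp
      qed
      moreover have "sum ?g (?B - ?A) \<in> MM_filt n lam d"
        using BB k(2) by (intro hmodule_sum[OF MM_filt_hmodule] m) auto
      ultimately have "sum ?g ?A - sum ?g ?B \<in> MM_filt n lam d"
        unfolding split by (rule hmodule_diff[OF MM_filt_hmodule])
      moreover have "S k - sum ?g ?A \<in> MM_filt n lam d"
        using partial_sum_expand[OF lam, of n k] JT_MM_filt unfolding S_def by blast
      ultimately have "(S k - sum ?g ?A) + (sum ?g ?A - sum ?g ?B) \<in> MM_filt n lam d"
        by (intro hmodule_add[OF MM_filt_hmodule])
      then show "S k - (\<Sum>i<k. ?a i \<otimes>\<^sub>h ?b i) \<in> MM_filt n lam d"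
        unfolding B by simp
    qed
  qed
  ultimately have "canonical_element n lam S"
    unfolding canonical_element_def by blast
  moreover have "is_lift n lam S S"
    unfolding is_lift_def
  proof (intro conjI allI)
    show "S k \<in> U_p_tensor n" for k
      unfolding S_def U_p_tensor_def
      by (intro hmodule_sum[OF closed_span_hmodule] hmodule_smul[OF closed_span_hmodule])
        (use yx_power_UU UU_U_p_tensor in \<open>unfold U_p_tensor_def, blast\<close>)
    show "cauchy_seq (U_p_filt n) S"
      unfolding S_def
    proof (rule cauchy_partial_sums[OF U_p_filt_hmodule])
      fix d m :: nat assume "d \<le> m"
      then show "lift_coeff lam m \<star> yx n lam ^ m \<in> U_p_filt n d"
        using yx_power_UU UU_U_p_filt by (intro hmodule_smul[OF U_p_filt_hmodule]) blast
    qed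
    show "null_seq (MM_filt n lam) (\<lambda>k. S k * (1 \<otimes>\<^sub>h 1) - S k)"
      by (simp add: null_seq_def tensor_1 hmodule_0[OF MM_filt_hmodule])
  qed
  ultimately show ?thesis unfolding S[symmetric] by blast
qed

end
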